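(* (i) For an ideal $I\subset\mathbf{k}[x]_0$, $\mathcal{E}(I,\mathcal{U}_{\mathrm{loc}})=\mathcal{E}(\hat O I,\mathcal{U}_{\mathrm{loc}})$. (ii) If $\mathbf{k}=\mathbb{C}$ and $I\subset\mathcal{O}_0$ is an ideal, then $\mathcal{E}(I,\mathcal{U}_{\mathrm{loc}})=\mathcal{E}(\hat O I,\mathcal{U}_{\mathrm{loc}})$. (1) For an ideal $I\subset D_{\{0\}}$, $\mathcal{E}(I,\mathcal{W}_{\mathrm{loc}})=\mathcal{E}(\hat D I,\mathcal{W}_{\mathrm{loc}})$. (2) If $\mathbf{k}=\mathbb{C}$ and $I\subset\mathcal{D}_0$ is an ideal, then $\mathcal{E}(I,\mathcal{W}_{\mathrm{loc}})=\mathcal{E}(\hat D I,\mathcal{W}_{\mathrm{loc}})$.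
   Context: Fix $n\ge 1$, a field $\mathbf{k}$ and $x=(x_1,\dots,x_n)$. $\mathbf{k}[x]_0$ is the localization of $\mathbf{k}[x]$ at $0\in\mathbf{k}^n$; $\hat O=\mathbf{k}[[x]]$; when $\mathbf{k}=\mathbb{C}$, $\mathcal{O}_0$ is the ring of convergent power series. $D_{\{0\}},\mathcal{D}_0,\hat D$ are the rings of differential operators with coefficients in $\mathbf{k}[x]_0,\mathcal{O}_0,\hat O$ (generated by the coefficients and $\partial_1,\dots,\partial_n$ with $\partial_ic(x)-c(x)\partial_i=\partial c(x)/\partial x_i$). Ideals in rings of operators are left ideals. $\mathcal{U}_{\mathrm{loc}}=\{u\in\mathbb{R}^n:u_i\le0\ \forall i\}$, $\mathcal{W}_{\mathrm{loc}}=\{(u,v)\in\mathbb{R}^{2n}:u_i\le0,\ u_i+v_i\ge0\ \forall i\}$. For nonzero $f=\sum c_\alpha x^\alpha$, $\mathrm{ord}^u(f)=\max\{u\cdot\alpha:c_\alpha\neq0\}$; for nonzero $P=\sum c_{\alpha,\beta}x^\alpha\partial^\beta$ and $w=(u,v)$, $\mathrm{ord}^w(P)=\max\{u\cdot\alpha+v\cdot\beta:c_{\alpha,\beta}\ne0\}$. These define filtrations $F_m=\{\mathrm{ord}\le m\}$ and graded rings $\mathrm{gr}^u(\mathcal{C})$, $\mathrm{gr}^w(\mathcal{R})$, $\mathrm{gr}=\bigoplus_mF_m/F_{<m}$, for $\mathcal C\in\{\mathbf{k}[x]_0,\mathcal{O}_0,\hat O\}$, $\mathcal R\in\{D_{\{0\}},\mathcal{D}_0,\hat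 D\}$. The initial form $\mathrm{in}_u(f)$ (resp. $\mathrm{in}_w(P)$) is the class in $F_m/F_{<m}$, $m$ being the order (zero for the zero element), and for an ideal $I$, $\mathrm{in}_u(I)$ (resp. $\mathrm{in}_w(I)$) is the ideal of the graded ring generated by the initial forms of all elements of $I$. Identifications: with $M=\{i:u_i<0\}$, $\mathrm{gr}^u(\hat O)=\mathbf{k}[[x_i:i\notin M]][x_i:i\in M]$, $\mathrm{gr}^u(\mathcal{O}_0)=\mathbb{C}\{x_i:i\notin M\}[x_i:i\in M]$, $\mathrm{gr}^u(\mathbf{k}[x]_0)=\{f/g:f\in\mathbf{k}[x],\ g\in\mathbf{k}[x_i:i\notin M],\ g(0)\neq0\}$. With moreover $P=\{i:u_i+v_i>0\}$, $\mathrm{gr}^w$ of $\hat D,\mathcal{D}_0,D_{\{0\}}$ is the ring of polynomials in $\partial_i$ ($i\notin P$) and commutative variables $\xi_i$ ($i\in P$, the class of $\partial_i$) with coefficients in the corresponding ring $\mathrm{gr}^u$ just described, where $[\partial_i,a]=\partial a/\partial x_i$. For an ideal $I$ of one of these rings, two weights are equivalent iff the corresponding graded rings of that ring are equal (for $u,u'$: same set $M$; for $w,w'$: same $M$ and same $P$) and the corresponding initial ideals of $I$ are equal. $\mathcal{E}(I,\mathcal{U}_{\mathrm{loc}})$ (resp. $\mathcal{E}(I,\mathcal{W}_{\mathrm{loc}})$), the open Gröbner fan, is the set of equivalence classes on $\mathcal{U}_{\mathrm{loc}}$ (resp. $\mathcal{W}_{\mathrm{loc}}$). *)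

theory Defs
  imports "HOL-Analysis.Analysis" "HOL-Library.Poly_Mapping" "HOL-Algebra.Ideal"
begin

text \<open>
  Formal power series \<open>\<Sum>\<^sub>\<alpha> c\<^sub>\<alpha> x\<^sup>\<alpha>\<close> in variables indexed by the finite type \<open>'n\<close>.
\<close>

typedef ('n::finite, 'k) mps = "UNIV :: (nat^'n \<Rightarrow> 'k) set"
  morphisms coeff Abs_mps ..

setup_lifting type_definition_mps

lemma mps_eq_iff: "f = g \<longleftrightarrow> (\<forall>\<alpha>. coeff f \<alpha> = coeff g \<alpha>)"
  by transfer auto

lemma mps_eqI: "(\<And>\<alpha>. coeff f \<alpha> = coeff g \<alpha>) \<Longrightarrow> f = g"
  by (simp add: mps_eq_iff)

lemma finite_le_multi: "finite {\<alpha>::nat^'n. \<forall>i. \<alpha> $ i \<le> g i}"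
proof (rule finite_subset)
  show "{\<alpha>::nat^'n. \<forall>i. \<alpha> $ i \<le> g i} \<subseteq> vec_lambda ` (PiE UNIV (\<lambda>i. {..g i}))"
  proof
    fix \<alpha> :: "nat^'n" assume "\<alpha> \<in> {\<alpha>. \<forall>i. \<alpha> $ i \<le> g i}"
    then have "vec_nth \<alpha> \<in> PiE UNIV (\<lambda>i. {..g i})" by auto
    then show "\<alpha> \<in> vec_lambda ` (PiE UNIV (\<lambda>i. {..g i}))"
      by (metis image_eqI vec_nth_inverse)
  qed
qed (intro finite_imageI finite_PiE, auto)

lemma finite_splits [simp]: "finite {(\<alpha>, \<beta>). \<alpha> + \<beta> = (\<gamma>::nat^'n)}"
proof (rule finite_subset)
  show "{(\<alpha>, \<beta>). \<alpha> + \<beta> = \<gamma>} \<subseteq> {\<alpha>. \<forall>i. \<alpha> $ i \<le> \<gamma> $ i} \<times> {\<alpha>. \<forall>i. \<alpha> $ i \<le> \<gamma> $ i}"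
    by auto
qed (intro finite_cartesian_product finite_le_multi)

instantiation mps :: (finite, comm_ring_1) comm_ring_1
begin

lift_definition zero_mps :: "('a, 'b) mps" is "\<lambda>\<alpha>. 0" .
lift_definition one_mps :: "('a, 'b) mps" is "\<lambda>\<alpha>. if \<alpha> = 0 then 1 else 0" .
lift_definition plus_mps :: "('a, 'b) mps \<Rightarrow> ('a, 'b) mps \<Rightarrow> ('a, 'b) mps"
  is "\<lambda>f g \<alpha>. f \<alpha> + g \<alpha>" .
lift_definition minus_mps :: "('a, 'b) mps \<Rightarrow> ('a, 'b) mps \<Rightarrow> ('a, 'b) mps"
  is "\<lambda>f g \<alpha>. f \<alpha> - g \<alpha>" .
lift_definition uminus_mps :: "('a, 'b) mps \<Rightarrow> ('a, 'b) mps"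
  is "\<lambda>f \<alpha>. - f \<alpha>" .
lift_definition times_mps :: "('a, 'b) mps \<Rightarrow> ('a, 'b) mps \<Rightarrow> ('a, 'b) mps"
  is "\<lambda>f g \<gamma>. \<Sum>(\<alpha>, \<beta>) | \<alpha> + \<beta> = \<gamma>. f \<alpha> * g \<beta>" .

instance
proof
  fix f g h :: "('a, 'b) mps"
  show "f + g + h = f + (g + h)" "f + g = g + f" "0 + f = f" "- f + f = 0" "f - g = f + - g"
    by (transfer; simp add: algebra_simps)+
  show "f * g * h = f * (g * h)"
  proof (transfer, rule ext)
    fix f g h :: "nat^'a \<Rightarrow> 'b" and \<gamma>
    have "(\<Sum>(\<alpha>, \<beta>) | \<alpha> + \<beta> = \<gamma>. (\<Sum>(\<mu>, \<nu>) | \<mu> + \<nu> = \<alpha>. f \<mu> * g \<nu>) * h \<beta>)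
        = (\<Sum>(\<alpha>, \<beta>) | \<alpha> + \<beta> = \<gamma>. \<Sum>(\<mu>, \<nu>) | \<mu> + \<nu> = \<alpha>. f \<mu> * g \<nu> * h \<beta>)"
      by (simp add: sum_distrib_right case_prod_unfold)
    also have "\<dots> = (\<Sum>((\<alpha>, \<beta>), (\<mu>, \<nu>)) \<in> Sigma {(\<alpha>, \<beta>). \<alpha> + \<beta> = \<gamma>} (\<lambda>(\<alpha>, \<beta>). {(\<mu>, \<nu>). \<mu> + \<nu> = \<alpha>}).
                     f \<mu> * g \<nu> * h \<beta>)"
      by (subst sum.Sigma[symmetric]) (auto intro!: sum.cong)
    also have "\<dots> = (\<Sum>((\<mu>, \<rho>), (\<nu>, \<beta>)) \<in> Sigma {(\<alpha>, \<beta>). \<alpha> + \<beta> = \<gamma>} (\<lambda>(\<alpha>, \<beta>). {(\<mu>, \<nu>). \<mu> + \<nu> = \<beta>}).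
                     f \<mu> * (g \<nu> * h \<beta>))"
      by (rule sum.reindex_bij_witness[where
            j = "\<lambda>((\<alpha>, \<beta>), (\<mu>, \<nu>)). ((\<mu>, \<nu> + \<beta>), (\<nu>, \<beta>))" and
            i = "\<lambda>((\<mu>, \<rho>), (\<nu>, \<beta>)). ((\<mu> + \<nu>, \<beta>), (\<mu>, \<nu>))"])
         (auto simp: algebra_simps)
    also have "\<dots> = (\<Sum>(\<mu>, \<rho>) | \<mu> + \<rho> = \<gamma>. \<Sum>(\<nu>, \<beta>) | \<nu> + \<beta> = \<rho>. f \<mu> * (g \<nu> * h \<beta>))"
      by (subst sum.Sigma[symmetric]) (auto intro!: sum.cong)
    also have "\<dots> = (\<Sum>(\<mu>, \<rho>) | \<mu> + \<rho> = \<gamma>. f \<mu> * (\<Sum>(\<nu>, \<beta>) | \<nu> + \<beta> = \<rho>. g \<nu> * h \<beta>))"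
      by (simp add: sum_distrib_left case_prod_unfold)
    finally show "(\<Sum>(\<alpha>, \<beta>) | \<alpha> + \<beta> = \<gamma>. (\<Sum>(\<mu>, \<nu>) | \<mu> + \<nu> = \<alpha>. f \<mu> * g \<nu>) * h \<beta>)
        = (\<Sum>(\<mu>, \<rho>) | \<mu> + \<rho> = \<gamma>. f \<mu> * (\<Sum>(\<nu>, \<beta>) | \<nu> + \<beta> = \<rho>. g \<nu> * h \<beta>))" .
  qed
  show "f * g = g * f"
  proof (transfer, rule ext)
    fix f g :: "nat^'a \<Rightarrow> 'b" and \<gamma>
    show "(\<Sum>(\<alpha>, \<beta>) | \<alpha> + \<beta> = \<gamma>. f \<alpha> * g \<beta>) = (\<Sum>(\<alpha>, \<beta>) | \<alpha> + \<beta> = \<gamma>. g \<alpha> * f \<beta>)"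
      by (rule sum.reindex_bij_witness[where i = "\<lambda>(a, b). (b, a)" and j = "\<lambda>(a, b). (b, a)"])
         (auto simp: algebra_simps)
  qed
  show "1 * f = f"
  proof (transfer, rule ext)
    fix f :: "nat^'a \<Rightarrow> 'b" and \<gamma>
    have "(\<Sum>(\<alpha>, \<beta>) | \<alpha> + \<beta> = \<gamma>. (if \<alpha> = 0 then 1 else 0) * f \<beta>)
        = (\<Sum>(\<alpha>, \<beta>) \<in> {(0::nat^'a, \<gamma>)}. (if \<alpha> = 0 then 1 else 0) * f \<beta>)"
      by (intro sum.mono_neutral_right) (auto split: if_splits)
    then show "(\<Sum>(\<alpha>, \<beta>) | \<alpha> + \<beta> = \<gamma>. (if \<alpha> = 0 then 1 else 0) * f \<beta>) = f \<gamma>"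
      by simp
  qed
  show "(f + g) * h = f * h + g * h"
    by transfer (simp add: algebra_simps case_prod_unfold sum.distrib)
  show "(0::('a, 'b) mps) \<noteq> 1"
    by transfer (metis zero_neq_one)
qed

end

lemmas coeff_simps [simp] =
  zero_mps.rep_eq one_mps.rep_eq plus_mps.rep_eq minus_mps.rep_eq uminus_mps.rep_eq

lemmas coeff_mult = times_mps.rep_eq

lemma coeff_sum: "coeff (\<Sum>x\<in>A. f x) \<alpha> = (\<Sum>x\<in>A. coeff (f x) \<alpha>)"
  by (induction A rule: infinite_finite_induct) auto

subsection \<open>Groebner fans for rings of series\<close>

definition total_deg :: "nat^'n::finite \<Rightarrow> nat"
  where "total_deg \<alpha> = (\<Sum>i\<in>UNIV. \<alpha> $ i)"

definition polys :: "('n::finite, 'k::field) mps set"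
  where "polys = {f. finite {\<alpha>. coeff f \<alpha> \<noteq> 0}}"

text \<open>
  The localization of the polynomial ring at the origin, identified with its image under Taylor
  expansion: \<open>f / g\<close> is the only series \<open>h\<close> with \<open>g * h = f\<close> (see \<open>mps_mult_eq_0\<close> below).
  The full ring of formal power series is \<open>UNIV\<close>.
\<close>

definition loc_polys :: "('n::finite, 'k::field) mps set"
  where "loc_polys = {h. \<exists>f\<in>polys. \<exists>g\<in>polys. coeff g 0 \<noteq> 0 \<and> g * h = f}"

definition conv_series :: "('n::finite, complex) mps set"
  where "conv_series = {f. \<exists>r>0. (\<lambda>\<alpha>. cmod (coeff f \<alpha>) * r ^ total_deg \<alpha>) summable_on UNIV}"

definition series_ring :: "('n::finite, 'k::field) mps set \<Rightarrow> ('n, 'k) mps ring"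
  where "series_ring C = \<lparr>carrier = C, monoid.mult = (*), one = 1, zero = 0, add = (+)\<rparr>"

definition graded_sum :: "(real \<Rightarrow> 'a::comm_monoid_add set) \<Rightarrow> 'a set"
  where "graded_sum X = {\<Sum>m\<in>S. h m | S h. finite S \<and> (\<forall>m\<in>S. h m \<in> X m)}"

definition U_loc :: "(real^'n::finite) set"
  where "U_loc = {u. \<forall>i. u $ i \<le> 0}"

definition wt :: "real^'n::finite \<Rightarrow> nat^'n \<Rightarrow> real"
  where "wt u \<alpha> = (\<Sum>i\<in>UNIV. u $ i * real (\<alpha> $ i))"

definition neg_vars :: "real^'n::finite \<Rightarrow> 'n set"
  where "neg_vars u = {i. u $ i < 0}"

text \<open>
  For nonzero \<open>f\<close> and \<open>u \<in> U_loc\<close> the maximum exists (\<open>ser_ord_attained\<close>).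
  The value at \<open>0\<close> is irrelevant: \<open>0\<close> lies in every step of the filtration and its initial form is \<open>0\<close>.
\<close>

definition ser_ord :: "real^'n::finite \<Rightarrow> ('n, 'k::field) mps \<Rightarrow> real"
  where "ser_ord u f = (GREATEST m. \<exists>\<alpha>. coeff f \<alpha> \<noteq> 0 \<and> m = wt u \<alpha>)"

definition ser_filt :: "('n::finite, 'k::field) mps set \<Rightarrow> real^'n \<Rightarrow> real \<Rightarrow> ('n, 'k) mps set"
  where "ser_filt C u m = {f \<in> C. f = 0 \<or> ser_ord u f \<le> m}"

definition ser_filt_less :: "('n::finite, 'k::field) mps set \<Rightarrow> real^'n \<Rightarrow> real \<Rightarrow> ('n, 'k) mps set"
  where "ser_filt_less C u m = {f \<in> C. f = 0 \<or> ser_ord u f < m}"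

text \<open>
  On the step \<open>ser_filt C u m\<close> of the filtration, the kernel of \<open>ser_part u m\<close> is \<open>ser_filt_less C u m\<close>
  (\<open>ser_part_kernel\<close>), so its image is the quotient \<open>F(m) / F(<m)\<close>, with the class of \<open>f\<close> represented by
  \<open>ser_part u m f\<close>. With this identification the multiplication of the graded ring is the one of power
  series (\<open>ser_part_mult\<close>), and all graded rings lie in the same ambient ring. The resulting explicit
  descriptions are \<open>ser_gr_UNIV\<close>, \<open>ser_gr_conv_series\<close> and \<open>ser_gr_loc_polys\<close>.
\<close>

lift_definition ser_part :: "real^'n::finite \<Rightarrow> real \<Rightarrow> ('n, 'k::field) mps \<Rightarrow> ('n, 'k) mps"
  is "\<lambda>u m f \<alpha>. if wt u \<alpha> = m then f \<alpha> else 0" .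

definition ser_gr :: "('n::finite, 'k::field) mps set \<Rightarrow> real^'n \<Rightarrow> ('n, 'k) mps set"
  where "ser_gr C u = graded_sum (\<lambda>m. ser_part u m ` ser_filt C u m)"

definition ser_in :: "real^'n::finite \<Rightarrow> ('n, 'k::field) mps \<Rightarrow> ('n, 'k) mps"
  where "ser_in u f = ser_part u (ser_ord u f) f"

definition ser_in_ideal :: "('n::finite, 'k::field) mps set \<Rightarrow> real^'n \<Rightarrow> ('n, 'k) mps set \<Rightarrow> ('n, 'k) mps set"
  where "ser_in_ideal C u I = genideal (series_ring (ser_gr C u)) (ser_in u ` I)"

definition ser_fan :: "('n::finite, 'k::field) mps set \<Rightarrow> ('n, 'k) mps set \<Rightarrow> (real^'n) set set"
  where "ser_fan C I = U_loc // {(u, u'). u \<in> U_loc \<and> u' \<in> U_loc \<and>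
    neg_vars u = neg_vars u' \<and> ser_in_ideal C u I = ser_in_ideal C u' I}"

subsection \<open>Groebner fans for rings of differential operators\<close>

lift_definition pdiff :: "'n::finite \<Rightarrow> ('n, 'k::field) mps \<Rightarrow> ('n, 'k) mps"
  is "\<lambda>i f \<alpha>. of_nat (\<alpha> $ i + 1) * f (\<alpha> + axis i 1)" .

text \<open>
  The iterated derivative with multiplicities \<open>\<delta>\<close>; see \<open>pdiffs_0\<close> and \<open>pdiffs_add_axis\<close>.
\<close>

lift_definition pdiffs :: "nat^'n::finite \<Rightarrow> ('n, 'k::field) mps \<Rightarrow> ('n, 'k) mps"
  is "\<lambda>\<delta> f \<alpha>. of_nat (\<Prod>i\<in>UNIV. pochhammer (\<alpha> $ i + 1) (\<delta> $ i)) * f (\<alpha> + \<delta>)" .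

text \<open>
  The operator \<open>\<Sum>\<^sub>\<beta> a\<^sub>\<beta> \<partial>\<^sup>\<beta>\<close> is represented by its finitely supported family of coefficients, written to
  the left of the derivations. In \<open>op_mult P\<close> the variables with index in \<open>P\<close> commute with the
  coefficients (they are the \<open>\<xi>\<^sub>i\<close>), while for \<open>i \<notin> P\<close> the relation \<open>\<partial>\<^sub>i c - c \<partial>\<^sub>i = \<partial>c / \<partial>x\<^sub>i\<close> holds; the
  formula is the resulting Leibniz rule (see \<open>op_mult_comm_rel\<close>, \<open>op_mult_assoc\<close>). Operator rings are the case \<open>P = {}\<close>.
  The product of the type \<open>\<Rightarrow>\<^sub>0\<close> itself is not used in these definitions.
\<close>

type_synonym ('n, 'k) dop = "(nat^'n) \<Rightarrow>\<^sub>0 ('n, 'k) mps"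

definition op_mult :: "'n set \<Rightarrow> ('n::finite, 'k::field) dop \<Rightarrow> ('n, 'k) dop \<Rightarrow> ('n, 'k) dop"
  where "op_mult P A B =
    (\<Sum>\<beta>\<in>Poly_Mapping.keys A. \<Sum>\<gamma>\<in>Poly_Mapping.keys B. \<Sum>\<delta> | (\<forall>i. \<delta> $ i \<le> \<beta> $ i) \<and> (\<forall>i\<in>P. \<delta> $ i = 0).
      Poly_Mapping.single (\<beta> - \<delta> + \<gamma>)
        (of_nat (\<Prod>i\<in>UNIV. \<beta> $ i choose \<delta> $ i) * Poly_Mapping.lookup A \<beta> * pdiffs \<delta> (Poly_Mapping.lookup B \<gamma>)))"

definition ops :: "('n::finite, 'k::field) mps set \<Rightarrow> ('n, 'k) dop set"
  where "ops C = {A. \<forall>\<beta>. Poly_Mapping.lookup A \<beta> \<in> C}"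

definition op_ring :: "'n set \<Rightarrow> ('n::finite, 'k::field) dop set \<Rightarrow> ('n, 'k) dop ring"
  where "op_ring P X = \<lparr>carrier = X, monoid.mult = op_mult P, one = 1, zero = 0, add = (+)\<rparr>"

definition left_ideal :: "'a set \<Rightarrow> ('a, 'b) ring_scheme \<Rightarrow> bool"
  where "left_ideal I R \<longleftrightarrow> additive_subgroup I R \<and> (\<forall>a\<in>I. \<forall>x\<in>carrier R. x \<otimes>\<^bsub>R\<^esub> a \<in> I)"

definition gen_left_ideal :: "('a, 'b) ring_scheme \<Rightarrow> 'a set \<Rightarrow> 'a set"
  where "gen_left_ideal R S = \<Inter>{I. left_ideal I R \<and> S \<subseteq> I}"

definition W_loc :: "((real^'n::finite) \<times> (real^'n)) set"
  where "W_loc = {(u, v). \<forall>i. u $ i \<le> 0 \<and> u $ i + v $ i \<ge> 0}"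

definition pos_vars :: "(real^'n::finite) \<times> (real^'n) \<Rightarrow> 'n set"
  where "pos_vars w = {i. fst w $ i + snd w $ i > 0}"

definition op_wt :: "(real^'n::finite) \<times> (real^'n) \<Rightarrow> nat^'n \<Rightarrow> nat^'n \<Rightarrow> real"
  where "op_wt w \<alpha> \<beta> = wt (fst w) \<alpha> + wt (snd w) \<beta>"

definition op_ord :: "(real^'n::finite) \<times> (real^'n) \<Rightarrow> ('n, 'k::field) dop \<Rightarrow> real"
  where "op_ord w A = (GREATEST m. \<exists>\<alpha> \<beta>. coeff (Poly_Mapping.lookup A \<beta>) \<alpha> \<noteq> 0 \<and> m = op_wt w \<alpha> \<beta>)"

definition op_filt :: "('n::finite, 'k::field) mps set \<Rightarrow> (real^'n) \<times> (real^'n) \<Rightarrow> real \<Rightarrow> ('n, 'k) dop set"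
  where "op_filt C w m = {A \<in> ops C. A = 0 \<or> op_ord w A \<le> m}"

definition op_filt_less :: "('n::finite, 'k::field) mps set \<Rightarrow> (real^'n) \<times> (real^'n) \<Rightarrow> real \<Rightarrow> ('n, 'k) dop set"
  where "op_filt_less C w m = {A \<in> ops C. A = 0 \<or> op_ord w A < m}"

text \<open>
  As for series, this represents the class in \<open>F(m) / F(<m)\<close>: it keeps the terms \<open>c x\<^sup>\<alpha> \<partial>\<^sup>\<beta>\<close> of
  weight \<open>m\<close> (\<open>coeff_op_part\<close>, \<open>op_part_kernel\<close>). The induced product is \<open>op_mult (pos_vars w)\<close>
  (\<open>op_part_mult\<close>), and \<open>op_gr_coeffs\<close> describes the graded ring as polynomials in \<open>\<partial>\<^sub>i\<close>, \<open>\<xi>\<^sub>i\<close> over \<open>ser_gr C (fst w)\<close>.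
\<close>

definition op_part :: "(real^'n::finite) \<times> (real^'n) \<Rightarrow> real \<Rightarrow> ('n, 'k::field) dop \<Rightarrow> ('n, 'k) dop"
  where "op_part w m A = Poly_Mapping.mapp (\<lambda>\<beta>. ser_part (fst w) (m - wt (snd w) \<beta>)) A"

definition op_gr :: "('n::finite, 'k::field) mps set \<Rightarrow> (real^'n) \<times> (real^'n) \<Rightarrow> ('n, 'k) dop set"
  where "op_gr C w = graded_sum (\<lambda>m. op_part w m ` op_filt C w m)"

definition op_in :: "(real^'n::finite) \<times> (real^'n) \<Rightarrow> ('n, 'k::field) dop \<Rightarrow> ('n, 'k) dop"
  where "op_in w A = op_part w (op_ord w A) A"

definition op_in_ideal ::
    "('n::finite, 'k::field) mps set \<Rightarrow> (real^'n) \<times> (real^'n) \<Rightarrow> ('n, 'k) dop set \<Rightarrow> ('n, 'k) dop set"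
  where "op_in_ideal C w I = gen_left_ideal (op_ring (pos_vars w) (op_gr C w)) (op_in w ` I)"

definition op_fan :: "('n::finite, 'k::field) mps set \<Rightarrow> ('n, 'k) dop set \<Rightarrow> ((real^'n) \<times> (real^'n)) set set"
  where "op_fan C I = W_loc // {(w, w'). w \<in> W_loc \<and> w' \<in> W_loc \<and>
    neg_vars (fst w) = neg_vars (fst w') \<and> pos_vars w = pos_vars w' \<and>
    op_in_ideal C w I = op_in_ideal C w' I}"

subsection \<open>The series rings, their filtrations and graded rings\<close>

lemma series_ring_simps [simp]:
  "carrier (series_ring C) = C" "x \<otimes>\<^bsub>series_ring C\<^esub> y = x * y" "\<one>\<^bsub>series_ring C\<^esub> = 1"
  "\<zero>\<^bsub>series_ring C\<^esub> = 0" "x \<oplus>\<^bsub>series_ring C\<^esub> y = x + y"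
  by (simp_all add: series_ring_def)

lemma cring_series_ring:
  assumes "1 \<in> C" "0 \<in> C" "\<And>f. f \<in> C \<Longrightarrow> - f \<in> C"
    "\<And>f g. f \<in> C \<Longrightarrow> g \<in> C \<Longrightarrow> f + g \<in> C" "\<And>f g. f \<in> C \<Longrightarrow> g \<in> C \<Longrightarrow> f * g \<in> C"
  shows "cring (series_ring C)"
proof (rule cringI)
  show "abelian_group (series_ring C)"
  proof (rule abelian_groupI)
    fix x assume "x \<in> carrier (series_ring C)"
    then show "\<exists>y\<in>carrier (series_ring C). y \<oplus>\<^bsub>series_ring C\<^esub> x = \<zero>\<^bsub>series_ring C\<^esub>"
      using assms(3) by (auto intro!: bexI[of _ "- x"])
  qed (use assms in \<open>auto simp: algebra_simps\<close>)
  show "comm_monoid (series_ring C)"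
    by (rule comm_monoidI) (use assms in \<open>auto simp: algebra_simps\<close>)
qed (auto simp: algebra_simps)

lemma series_ring_closed:
  assumes "cring (series_ring C)"
  shows "1 \<in> C" "0 \<in> C" "f \<in> C \<Longrightarrow> - f \<in> C"
    "f \<in> C \<Longrightarrow> g \<in> C \<Longrightarrow> f + g \<in> C" "f \<in> C \<Longrightarrow> g \<in> C \<Longrightarrow> f * g \<in> C"
proof -
  interpret cring "series_ring C" by fact
  show "1 \<in> C" using one_closed by simp
  show "0 \<in> C" using zero_closed by simp
  show "f \<in> C \<Longrightarrow> - f \<in> C"
  proof -
    assume f: "f \<in> C"
    then obtain y where "y \<in> C" "f + y = 0" using r_neg[of f] a_inv_closed[of f] by auto
    then show "- f \<in> C" by (metis add.inverse_inverse add_eq_0_iff)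
  qed
  show "f \<in> C \<Longrightarrow> g \<in> C \<Longrightarrow> f + g \<in> C" using a_closed[of f g] by simp
  show "f \<in> C \<Longrightarrow> g \<in> C \<Longrightarrow> f * g \<in> C" using m_closed[of f g] by simp
qed

lemma coeff_mult_0 [simp]: "coeff (f * g) 0 = coeff f 0 * coeff g (0::nat^'n::finite)"
proof -
  have "{(\<alpha>, \<beta>). \<alpha> + \<beta> = (0::nat^'n)} = {(0, 0)}" by (auto simp: vec_eq_iff)
  then show ?thesis by (simp add: coeff_mult)
qed

lemma polys_closed:
  "1 \<in> polys" "0 \<in> polys" "f \<in> polys \<Longrightarrow> - f \<in> polys"
  "f \<in> polys \<Longrightarrow> g \<in> polys \<Longrightarrow> f + g \<in> polys" "f \<in> polys \<Longrightarrow> g \<in> polys \<Longrightarrow> f * g \<in> polys"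
proof -
  show "1 \<in> polys" "0 \<in> polys" "f \<in> polys \<Longrightarrow> - f \<in> polys" by (auto simp: polys_def)
  { assume "f \<in> polys" "g \<in> polys"
    then have fin: "finite ({\<alpha>. coeff f \<alpha> \<noteq> 0} \<union> {\<alpha>. coeff g \<alpha> \<noteq> 0})"
      "finite ((\<lambda>(\<alpha>, \<beta>). \<alpha> + \<beta>) ` ({\<alpha>. coeff f \<alpha> \<noteq> 0} \<times> {\<alpha>. coeff g \<alpha> \<noteq> 0}))"
      by (auto simp: polys_def)
    show "f + g \<in> polys"
      unfolding polys_def by (rule CollectI, rule finite_subset[OF _ fin(1)]) auto
    have "\<gamma> \<in> (\<lambda>(\<alpha>, \<beta>). \<alpha> + \<beta>) ` ({\<alpha>. coeff f \<alpha> \<noteq> 0} \<times> {\<alpha>. coeff g \<alpha> \<noteq> 0})"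
      if "coeff (f * g) \<gamma> \<noteq> 0" for \<gamma>
    proof -
      from that have "\<exists>p\<in>{(\<alpha>, \<beta>). \<alpha> + \<beta> = \<gamma>}. (case p of (\<alpha>, \<beta>) \<Rightarrow> coeff f \<alpha> * coeff g \<beta>) \<noteq> 0"
        unfolding coeff_mult by (meson sum.neutral)
      then show ?thesis by force
    qed
    then show "f * g \<in> polys"
      unfolding polys_def by (intro CollectI finite_subset[OF _ fin(2)]) auto
  }
qed

lemma loc_polys_cring: "cring (series_ring (loc_polys :: ('n::finite, 'k::field) mps set))"
proof (rule cring_series_ring)
  have "coeff (1 :: ('n, 'k) mps) 0 \<noteq> 0" by simp
  then show "1 \<in> (loc_polys :: ('n, 'k) mps set)" "0 \<in> (loc_polys :: ('n, 'k) mps set)"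
    unfolding loc_polys_def using polys_closed(1,2)
    by (metis (mono_tags, lifting) mem_Collect_eq mult_1, metis (mono_tags, lifting) mem_Collect_eq mult_1)
  fix a assume "a \<in> (loc_polys :: ('n, 'k) mps set)"
  then obtain p q :: "('n, 'k) mps" where 1: "p \<in> polys" "q \<in> polys" "coeff q 0 \<noteq> 0" "q * a = p"
    unfolding loc_polys_def by blast
  show "- a \<in> loc_polys"
    unfolding loc_polys_def
    by (intro CollectI bexI[of _ "- p"] bexI[of _ q]) (use 1 in \<open>auto simp: polys_closed\<close>)
  fix b assume "b \<in> (loc_polys :: ('n, 'k) mps set)"
  then obtain p' q' :: "('n, 'k) mps" where 2: "p' \<in> polys" "q' \<in> polys" "coeff q' 0 \<noteq> 0" "q' * b = p'"
    unfolding loc_polys_def by blast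
  have "(q * q') * (a + b) = q' * p + q * p'" "(q * q') * (a * b) = p * p'"
    using 1(4) 2(4) by (auto simp: algebra_simps)
  moreover have "coeff (q * q') 0 \<noteq> 0" "q * q' \<in> polys" "q' * p + q * p' \<in> polys" "p * p' \<in> polys"
    using 1 2 by (auto simp: polys_closed)
  ultimately show "a + b \<in> loc_polys" "a * b \<in> loc_polys"
    unfolding loc_polys_def by blast+
qed

lemma total_deg_add [simp]: "total_deg (\<alpha> + \<beta>) = total_deg \<alpha> + total_deg \<beta>"
  by (simp add: total_deg_def sum.distrib)

lemma conv_mono:
  assumes "(\<lambda>\<alpha>. cmod (coeff f \<alpha>) * r ^ total_deg \<alpha>) summable_on UNIV" "0 < s" "s \<le> r"
  shows "(\<lambda>\<alpha>. cmod (coeff f \<alpha>) * s ^ total_deg \<alpha>) summable_on UNIV"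
  by (rule summable_on_comparison_test[OF assms(1)])
     (use assms in \<open>auto intro!: mult_left_mono power_mono\<close>)

lemma conv_mult:
  fixes f g :: "('n::finite, complex) mps"
  assumes r: "r > 0"
    and f: "(\<lambda>\<alpha>. cmod (coeff f \<alpha>) * r ^ total_deg \<alpha>) summable_on UNIV"
    and g: "(\<lambda>\<alpha>. cmod (coeff g \<alpha>) * r ^ total_deg \<alpha>) summable_on UNIV"
  shows "(\<lambda>\<alpha>. cmod (coeff (f * g) \<alpha>) * r ^ total_deg \<alpha>) summable_on UNIV"
proof (rule nonneg_bdd_above_summable_on)
  define F where "F \<alpha> = cmod (coeff f \<alpha>) * r ^ total_deg \<alpha>" for \<alpha>
  define G where "G \<alpha> = cmod (coeff g \<alpha>) * r ^ total_deg \<alpha>" for \<alpha>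
  have nn: "F \<alpha> \<ge> 0" "G \<alpha> \<ge> 0" for \<alpha> using r by (auto simp: F_def G_def)
  show "bdd_above (sum (\<lambda>\<alpha>. cmod (coeff (f * g) \<alpha>) * r ^ total_deg \<alpha>) ` {F. F \<subseteq> UNIV \<and> finite F})"
  proof (rule bdd_aboveI2)
    fix S :: "(nat^'n) set" assume "S \<in> {F. F \<subseteq> UNIV \<and> finite F}"
    then have S: "finite S" by auto
    define T where "T = (\<Union>\<gamma>\<in>S. {(\<alpha>, \<beta>). \<alpha> + \<beta> = \<gamma>})"
    have T: "finite T" unfolding T_def using S by auto
    have "(\<Sum>\<gamma>\<in>S. cmod (coeff (f * g) \<gamma>) * r ^ total_deg \<gamma>)
       \<le> (\<Sum>\<gamma>\<in>S. \<Sum>(\<alpha>, \<beta>) | \<alpha> + \<beta> = \<gamma>. F \<alpha> * G \<beta>)"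
    proof (rule sum_mono)
      fix \<gamma>
      have "cmod (coeff (f * g) \<gamma>) * r ^ total_deg \<gamma>
          \<le> (\<Sum>(\<alpha>, \<beta>) | \<alpha> + \<beta> = \<gamma>. cmod (coeff f \<alpha> * coeff g \<beta>)) * r ^ total_deg \<gamma>"
        unfolding coeff_mult case_prod_unfold using r by (intro mult_right_mono norm_sum) auto
      also have "\<dots> = (\<Sum>(\<alpha>, \<beta>) | \<alpha> + \<beta> = \<gamma>. F \<alpha> * G \<beta>)"
        unfolding sum_distrib_right
        by (rule sum.cong) (auto simp: F_def G_def norm_mult power_add)
      finally show "cmod (coeff (f * g) \<gamma>) * r ^ total_deg \<gamma> \<le> (\<Sum>(\<alpha>, \<beta>) | \<alpha> + \<beta> = \<gamma>. F \<alpha> * G \<beta>)" .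
    qed
    also have "\<dots> = (\<Sum>(\<alpha>, \<beta>)\<in>T. F \<alpha> * G \<beta>)"
      unfolding T_def using S by (subst sum.UNION_disjoint) auto
    also have "\<dots> \<le> (\<Sum>(\<alpha>, \<beta>)\<in>fst ` T \<times> snd ` T. F \<alpha> * G \<beta>)"
      by (rule sum_mono2) (use T nn in \<open>force+\<close>)
    also have "\<dots> = (\<Sum>\<alpha>\<in>fst ` T. F \<alpha>) * (\<Sum>\<beta>\<in>snd ` T. G \<beta>)"
      by (simp add: sum_product sum.cartesian_product)
    also have "\<dots> \<le> infsum F UNIV * infsum G UNIV"
      using f g T nn unfolding F_def[symmetric] G_def[symmetric]
      by (intro mult_mono finite_sum_le_infsum sum_nonneg infsum_nonneg) auto
    finally show "(\<Sum>\<gamma>\<in>S. cmod (coeff (f * g) \<gamma>) * r ^ total_deg \<gamma>) \<le> infsum F UNIV * infsum G UNIV" .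
  qed
qed (use r in auto)

lemma conv_series_cring: "cring (series_ring (conv_series :: ('n::finite, complex) mps set))"
proof (rule cring_series_ring)
  have "(\<lambda>\<alpha>. cmod (coeff (1::('n, complex) mps) \<alpha>) * 1 ^ total_deg \<alpha>) summable_on UNIV
     \<longleftrightarrow> (\<lambda>\<alpha>. cmod (coeff (1::('n, complex) mps) \<alpha>) * 1 ^ total_deg \<alpha>) summable_on {0}"
    by (rule summable_on_cong_neutral) auto
  then show "1 \<in> (conv_series :: ('n, complex) mps set)"
    unfolding conv_series_def by (intro CollectI exI[of _ 1]) auto
  show "0 \<in> conv_series" unfolding conv_series_def by (intro CollectI exI[of _ 1]) auto
  fix a :: "('n, complex) mps" assume "a \<in> conv_series"
  then obtain r where a: "r > 0" "(\<lambda>\<alpha>. cmod (coeff a \<alpha>) * r ^ total_deg \<alpha>) summable_on UNIV"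
    unfolding conv_series_def by blast
  then show "- a \<in> conv_series" unfolding conv_series_def by auto
  fix b :: "('n, complex) mps" assume "b \<in> conv_series"
  then obtain s where b: "s > 0" "(\<lambda>\<alpha>. cmod (coeff b \<alpha>) * s ^ total_deg \<alpha>) summable_on UNIV"
    unfolding conv_series_def by blast
  define t where "t = min r s"
  have t: "t > 0" using a b by (simp add: t_def)
  have a': "(\<lambda>\<alpha>. cmod (coeff a \<alpha>) * t ^ total_deg \<alpha>) summable_on UNIV"
    by (rule conv_mono[OF a(2) t]) (simp add: t_def)
  have b': "(\<lambda>\<alpha>. cmod (coeff b \<alpha>) * t ^ total_deg \<alpha>) summable_on UNIV"
    by (rule conv_mono[OF b(2) t]) (simp add: t_def)
  show "a * b \<in> conv_series" unfolding conv_series_def using t conv_mult[OF t a' b'] by blast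
  have "(\<lambda>\<alpha>. cmod (coeff (a + b) \<alpha>) * t ^ total_deg \<alpha>) summable_on UNIV"
    by (rule summable_on_comparison_test[OF summable_on_add[OF a' b']])
       (use t in \<open>auto simp: distrib_right[symmetric] intro!: mult_right_mono norm_triangle_ineq\<close>)
  then show "a + b \<in> conv_series" unfolding conv_series_def using t by blast
qed

lemma wt_add [simp]: "wt u (\<alpha> + \<beta>) = wt u \<alpha> + wt u \<beta>"
  by (simp add: wt_def sum.distrib algebra_simps)

lemma wt_0 [simp]: "wt u 0 = 0"
  by (simp add: wt_def)

lemma finite_wt_ge:
  assumes "u \<in> U_loc"
  shows "finite {wt u \<alpha> | \<alpha>. wt u \<alpha> \<ge> c}"
proof (rule finite_subset)
  let ?g = "\<lambda>i. nat \<lceil>c / u $ i\<rceil>"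
  show "{wt u \<alpha> | \<alpha>. wt u \<alpha> \<ge> c} \<subseteq> wt u ` {\<alpha>. \<forall>i. \<alpha> $ i \<le> ?g i}"
  proof safe
    fix \<alpha> assume c: "wt u \<alpha> \<ge> c"
    define \<beta> :: "nat^'a" where "\<beta> = (\<chi> i. if u $ i = 0 then 0 else \<alpha> $ i)"
    have "wt u \<beta> = wt u \<alpha>" unfolding wt_def \<beta>_def by (rule sum.cong) auto
    moreover have "\<beta> $ i \<le> ?g i" for i
    proof (cases "u $ i = 0")
      case False
      then have ui: "u $ i < 0" using assms by (force simp: U_loc_def less_le)
      have "wt u \<alpha> = u $ i * real (\<alpha> $ i) + (\<Sum>j\<in>UNIV - {i}. u $ j * real (\<alpha> $ j))"
        unfolding wt_def by (simp add: sum.remove[of _ i])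
      also have "\<dots> \<le> u $ i * real (\<alpha> $ i)"
        using assms by (simp add: U_loc_def sum_nonpos mult_nonpos_nonneg)
      finally have "c \<le> u $ i * real (\<alpha> $ i)" using c by simp
      then have "real (\<alpha> $ i) \<le> c / u $ i" using ui by (simp add: field_simps)
      then have "\<alpha> $ i \<le> ?g i" by linarith
      then show ?thesis using False by (simp add: \<beta>_def)
    qed (simp add: \<beta>_def)
    ultimately show "wt u \<alpha> \<in> wt u ` {\<alpha>. \<forall>i. \<alpha> $ i \<le> ?g i}" by (intro image_eqI[of _ _ \<beta>]) auto
  qed
qed (intro finite_imageI finite_le_multi)

lemma Greatest_attained:
  fixes X :: "real set"
  assumes fin: "\<And>c. finite {x \<in> X. x \<ge> c}" and "X \<noteq> {}"
  shows "(GREATEST x. x \<in> X) \<in> X" "x \<in> X \<Longrightarrow> x \<le> (GREATEST x. x \<in> X)"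
proof -
  obtain x0 where x0: "x0 \<in> X" using assms by blast
  let ?M = "Max {x \<in> X. x \<ge> x0}"
  have "?M \<in> {x \<in> X. x \<ge> x0}" using x0 fin by (intro Max_in) auto
  then have M: "?M \<in> X" "?M \<ge> x0" by auto
  have ge: "x \<le> ?M" if "x \<in> X" for x
    using that M fin[of x0] by (cases "x \<ge> x0") auto
  have "(GREATEST x. x \<in> X) = ?M" using M ge by (intro Greatest_equality) auto
  then show "(GREATEST x. x \<in> X) \<in> X" "x \<in> X \<Longrightarrow> x \<le> (GREATEST x. x \<in> X)"
    using M ge by auto
qed

lemma ser_ord_attained:
  assumes "u \<in> U_loc" "f \<noteq> 0"
  shows "\<exists>\<alpha>. coeff f \<alpha> \<noteq> 0 \<and> ser_ord u f = wt u \<alpha>"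
    and "coeff f \<alpha> \<noteq> 0 \<Longrightarrow> wt u \<alpha> \<le> ser_ord u f"
proof -
  let ?X = "{m. \<exists>\<alpha>. coeff f \<alpha> \<noteq> 0 \<and> m = wt u \<alpha>}"
  have fin: "finite {x \<in> ?X. x \<ge> c}" for c
    by (rule finite_subset[OF _ finite_wt_ge[OF assms(1), of c]]) auto
  have ne: "?X \<noteq> {}" using assms(2) by (auto simp: mps_eq_iff)
  show "\<exists>\<alpha>. coeff f \<alpha> \<noteq> 0 \<and> ser_ord u f = wt u \<alpha>"
    using Greatest_attained(1)[OF fin ne] by (simp add: ser_ord_def)
  show "coeff f \<alpha> \<noteq> 0 \<Longrightarrow> wt u \<alpha> \<le> ser_ord u f"
    using Greatest_attained(2)[OF fin ne, of "wt u \<alpha>"] by (auto simp: ser_ord_def)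
qed

lemma mem_ser_filt:
  assumes "u \<in> U_loc"
  shows "f \<in> ser_filt C u m \<longleftrightarrow> f \<in> C \<and> (\<forall>\<alpha>. coeff f \<alpha> \<noteq> 0 \<longrightarrow> wt u \<alpha> \<le> m)"
    and "f \<in> ser_filt_less C u m \<longleftrightarrow> f \<in> C \<and> (\<forall>\<alpha>. coeff f \<alpha> \<noteq> 0 \<longrightarrow> wt u \<alpha> < m)"
proof -
  have *: "((\<forall>\<alpha>. coeff f \<alpha> \<noteq> 0 \<longrightarrow> wt u \<alpha> \<le> m) \<longleftrightarrow> ser_ord u f \<le> m) \<and>
    ((\<forall>\<alpha>. coeff f \<alpha> \<noteq> 0 \<longrightarrow> wt u \<alpha> < m) \<longleftrightarrow> ser_ord u f < m)" if nz: "f \<noteq> 0"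
  proof -
    obtain \<alpha>0 where 0: "coeff f \<alpha>0 \<noteq> 0" "ser_ord u f = wt u \<alpha>0"
      using ser_ord_attained(1)[OF assms nz] by blast
    have 1: "wt u \<alpha> \<le> wt u \<alpha>0" if "coeff f \<alpha> \<noteq> 0" for \<alpha>
      using ser_ord_attained(2)[OF assms nz that] 0 by simp
    show ?thesis unfolding 0(2) using 0(1) by (auto dest: 1)
  qed
  show "f \<in> ser_filt C u m \<longleftrightarrow> f \<in> C \<and> (\<forall>\<alpha>. coeff f \<alpha> \<noteq> 0 \<longrightarrow> wt u \<alpha> \<le> m)"
    "f \<in> ser_filt_less C u m \<longleftrightarrow> f \<in> C \<and> (\<forall>\<alpha>. coeff f \<alpha> \<noteq> 0 \<longrightarrow> wt u \<alpha> < m)"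
    using * by (cases "f = 0"; simp add: ser_filt_def ser_filt_less_def)+
qed

lemma coeff_ser_part [simp]: "coeff (ser_part u m f) \<alpha> = (if wt u \<alpha> = m then coeff f \<alpha> else 0)"
  by transfer simp

lemma ser_part_0 [simp]: "ser_part u m 0 = 0"
  by (simp add: mps_eq_iff)

lemma ser_part_kernel:
  assumes "u \<in> U_loc" "f \<in> ser_filt C u m"
  shows "ser_part u m f = 0 \<longleftrightarrow> f \<in> ser_filt_less C u m"
proof -
  have "wt u \<alpha> < m \<longleftrightarrow> wt u \<alpha> \<noteq> m" if "coeff f \<alpha> \<noteq> 0" for \<alpha>
    using assms that by (auto simp: mem_ser_filt less_le)
  then show ?thesis
    using assms(2) unfolding mem_ser_filt[OF assms(1)] by (auto simp: mps_eq_iff)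
qed

lemma ser_part_add: "ser_part u m (f + g) = ser_part u m f + ser_part u m g"
  by (simp add: mps_eq_iff)

lemma ser_part_mult:
  assumes u: "u \<in> U_loc" and "f \<in> ser_filt C u m" "g \<in> ser_filt C u m'"
  shows "ser_part u (m + m') (f * g) = ser_part u m f * ser_part u m' g"
proof (rule mps_eqI)
  fix \<gamma>
  have *: "coeff f \<alpha> * coeff g \<beta> = 0"
    if "wt u \<alpha> + wt u \<beta> = m + m'" "wt u \<alpha> \<noteq> m \<or> wt u \<beta> \<noteq> m'" for \<alpha> \<beta>
  proof (rule ccontr)
    assume "coeff f \<alpha> * coeff g \<beta> \<noteq> 0"
    then have "wt u \<alpha> \<le> m" "wt u \<beta> \<le> m'" using assms by (auto simp: mem_ser_filt)
    then show False using that by linarith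
  qed
  show "coeff (ser_part u (m + m') (f * g)) \<gamma> = coeff (ser_part u m f * ser_part u m' g) \<gamma>"
  proof (cases "wt u \<gamma> = m + m'")
    case True
    have "(\<Sum>(\<alpha>, \<beta>) | \<alpha> + \<beta> = \<gamma>. coeff f \<alpha> * coeff g \<beta>) =
      (\<Sum>(\<alpha>, \<beta>) | \<alpha> + \<beta> = \<gamma>. coeff (ser_part u m f) \<alpha> * coeff (ser_part u m' g) \<beta>)"
    proof (rule sum.cong[OF refl], clarify)
      fix \<alpha> \<beta> assume "\<gamma> = \<alpha> + \<beta>"
      then show "coeff f \<alpha> * coeff g \<beta> = coeff (ser_part u m f) \<alpha> * coeff (ser_part u m' g) \<beta>"
        using *[of \<alpha> \<beta>] True by (cases "wt u \<alpha> = m \<and> wt u \<beta> = m'") auto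
    qed
    then show ?thesis using True by (simp add: coeff_mult)
  next
    case False
    then have "coeff (ser_part u m f * ser_part u m' g) \<gamma> = 0"
      unfolding coeff_mult coeff_ser_part by (intro sum.neutral) auto
    then show ?thesis using False by simp
  qed
qed

lemma ser_filt_add:
  "u \<in> U_loc \<Longrightarrow> cring (series_ring C) \<Longrightarrow> f \<in> ser_filt C u m \<Longrightarrow> g \<in> ser_filt C u m \<Longrightarrow> f + g \<in> ser_filt C u m"
  using series_ring_closed(4)[of C f g] by (auto simp: mem_ser_filt) (metis add.right_neutral)

lemma ser_filt_mult:
  assumes "u \<in> U_loc" "cring (series_ring C)" "f \<in> ser_filt C u m" "g \<in> ser_filt C u m'"
  shows "f * g \<in> ser_filt C u (m + m')"
proof -
  have "wt u \<gamma> \<le> m + m'" if "coeff (f * g) \<gamma> \<noteq> 0" for \<gamma>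
  proof -
    from that have "\<exists>p\<in>{(\<alpha>, \<beta>). \<alpha> + \<beta> = \<gamma>}. (case p of (\<alpha>, \<beta>) \<Rightarrow> coeff f \<alpha> * coeff g \<beta>) \<noteq> 0"
      unfolding coeff_mult by (meson sum.neutral)
    then obtain \<alpha> \<beta> where "\<alpha> + \<beta> = \<gamma>" "coeff f \<alpha> \<noteq> 0" "coeff g \<beta> \<noteq> 0" by auto
    moreover from this have "wt u \<alpha> \<le> m" "wt u \<beta> \<le> m'"
      using assms by (auto simp: mem_ser_filt)
    ultimately show ?thesis by auto
  qed
  then show ?thesis using assms series_ring_closed(5)[OF assms(2)] by (auto simp: mem_ser_filt)
qed


lemma graded_sum_piece: "h \<in> X m \<Longrightarrow> h \<in> graded_sum X"
  unfolding graded_sum_def by (intro CollectI exI[of _ "{m}"] exI[of _ "\<lambda>_. h"]) auto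

lemma graded_sum_0: "0 \<in> graded_sum X"
  unfolding graded_sum_def by (intro CollectI exI[of _ "{}"]) auto

lemma graded_sum_add:
  assumes X: "\<And>m. 0 \<in> X m" "\<And>m a b. a \<in> X m \<Longrightarrow> b \<in> X m \<Longrightarrow> a + b \<in> X m"
    and ab: "a \<in> graded_sum X" "b \<in> graded_sum X"
  shows "a + b \<in> graded_sum X"
proof -
  obtain S h where a: "a = (\<Sum>m\<in>S. h m)" "finite S" "\<forall>m\<in>S. h m \<in> X m"
    using ab unfolding graded_sum_def by blast
  obtain S' h' where b: "b = (\<Sum>m\<in>S'. h' m)" "finite S'" "\<forall>m\<in>S'. h' m \<in> X m"
    using ab unfolding graded_sum_def by blast
  define k where "k m = (if m \<in> S then h m else 0)" for m
  define k' where "k' m = (if m \<in> S' then h' m else 0)" for m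
  have "a = (\<Sum>m\<in>S \<union> S'. k m)" unfolding a(1) k_def using a(2) b(2)
    by (intro sum.mono_neutral_cong_left) auto
  moreover have "b = (\<Sum>m\<in>S \<union> S'. k' m)" unfolding b(1) k'_def using a(2) b(2)
    by (intro sum.mono_neutral_cong_left) auto
  ultimately have "a + b = (\<Sum>m\<in>S \<union> S'. k m + k' m)" by (simp add: sum.distrib)
  moreover have "k m + k' m \<in> X m" for m
    using a b X by (auto simp: k_def k'_def)
  ultimately show ?thesis unfolding graded_sum_def using a(2) b(2)
    by (intro CollectI exI[of _ "S \<union> S'"] exI[of _ "\<lambda>m. k m + k' m"]) auto
qed

lemma graded_sum_induct [consumes 1, case_names zero piece add]:
  assumes "x \<in> graded_sum X" "P 0" "\<And>m h. h \<in> X m \<Longrightarrow> P h" "\<And>a b. P a \<Longrightarrow> P b \<Longrightarrow> P (a + b)"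
  shows "P x"
proof -
  obtain S h where x: "x = (\<Sum>m\<in>S. h m)" "finite S" "\<forall>m\<in>S. h m \<in> X m"
    using assms(1) unfolding graded_sum_def by blast
  show ?thesis using x(2,3) unfolding x(1)
    by (induction S rule: finite_induct) (auto intro: assms)
qed

lemma graded_sum_mono:
  assumes "\<And>m. X m \<subseteq> Y m" "x \<in> graded_sum X"
  shows "x \<in> graded_sum Y"
proof -
  obtain S h where "x = (\<Sum>m\<in>S. h m)" "finite S" "\<forall>m\<in>S. h m \<in> X m"
    using assms(2) unfolding graded_sum_def by blast
  then show ?thesis using assms(1) unfolding graded_sum_def by blast
qed

lemma graded_sum_sum:
  assumes X: "\<And>m. 0 \<in> X m" "\<And>m a b. a \<in> X m \<Longrightarrow> b \<in> X m \<Longrightarrow> a + b \<in> X m"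
    and "\<And>x. x \<in> S \<Longrightarrow> f x \<in> graded_sum X"
  shows "sum f S \<in> graded_sum X"
  using assms(3)
  by (induction S rule: infinite_finite_induct) (simp_all add: graded_sum_0 graded_sum_add[of X, OF X])

lemma ser_pieces:
  assumes u: "u \<in> U_loc" and C: "cring (series_ring C)"
  shows "0 \<in> ser_part u m ` ser_filt C u m"
    "a \<in> ser_part u m ` ser_filt C u m \<Longrightarrow> b \<in> ser_part u m ` ser_filt C u m \<Longrightarrow>
      a + b \<in> ser_part u m ` ser_filt C u m"
proof -
  show "0 \<in> ser_part u m ` ser_filt C u m"
    by (rule image_eqI[of _ _ 0]) (auto simp: ser_filt_def series_ring_closed[OF C])
  assume "a \<in> ser_part u m ` ser_filt C u m" "b \<in> ser_part u m ` ser_filt C u m"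
  then obtain f g where "a = ser_part u m f" "f \<in> ser_filt C u m" "b = ser_part u m g" "g \<in> ser_filt C u m"
    by blast
  then show "a + b \<in> ser_part u m ` ser_filt C u m"
    using ser_filt_add[OF u C] by (intro image_eqI[of _ _ "f + g"]) (auto simp: ser_part_add)
qed

lemma cring_ser_gr:
  assumes u: "u \<in> U_loc" and C: "cring (series_ring C)"
  shows "cring (series_ring (ser_gr C u))"
proof (rule cring_series_ring)
  note cl = series_ring_closed[OF C] and pc = ser_pieces[OF u C]
  let ?X = "\<lambda>m. ser_part u m ` ser_filt C u m"
  show "0 \<in> ser_gr C u" unfolding ser_gr_def by (rule graded_sum_0)
  show "a + b \<in> ser_gr C u" if "a \<in> ser_gr C u" "b \<in> ser_gr C u" for a b
    using that unfolding ser_gr_def by (intro graded_sum_add pc)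
  have const: "a \<in> ser_gr C u" if "a = 1 \<or> a = - 1" for a
    unfolding ser_gr_def
  proof (rule graded_sum_piece[where X = ?X and m = 0], rule image_eqI[of _ _ a])
    show "a = ser_part u 0 a" using that by (intro mps_eqI) auto
    show "a \<in> ser_filt C u 0" using that cl by (auto simp: mem_ser_filt[OF u] split: if_splits)
  qed
  then show "1 \<in> ser_gr C u" by simp
  show mult: "a * b \<in> ser_gr C u" if ab: "a \<in> ser_gr C u" "b \<in> ser_gr C u" for a b
    using ab(1) unfolding ser_gr_def
  proof (induction rule: graded_sum_induct)
    case (piece m h)
    show ?case using ab(2) unfolding ser_gr_def
    proof (induction rule: graded_sum_induct)
      case (piece m' h')
      obtain f g where fg: "f \<in> ser_filt C u m" "h = ser_part u m f" "g \<in> ser_filt C u m'" "h' = ser_part u m' g"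
        using \<open>h \<in> ?X m\<close> piece by blast
      show ?case
        by (rule graded_sum_piece[where m = "m + m'"], rule image_eqI[of _ _ "f * g"])
           (use ser_part_mult[OF u fg(1,3)] ser_filt_mult[OF u C fg(1,3)] fg(2,4) in simp_all)
    qed (auto simp: distrib_left graded_sum_0 intro: graded_sum_add pc)
  qed (auto simp: distrib_right graded_sum_0 intro: graded_sum_add pc)
  show "- f \<in> ser_gr C u" if "f \<in> ser_gr C u" for f
    using mult[OF const that, of "- 1"] by simp
qed

subsection \<open>The operator rings, their filtrations and graded rings\<close>

lemmas coeff_pdiff [simp] = pdiff.rep_eq and coeff_pdiffs [simp] = pdiffs.rep_eq

lemma multi_induct [case_names 0 add]:
  fixes \<beta> :: "nat^'n::finite"
  assumes "P 0" "\<And>\<beta> i. P \<beta> \<Longrightarrow> P (\<beta> + axis i 1)"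
  shows "P \<beta>"
proof (induction "total_deg \<beta>" arbitrary: \<beta>)
  case 0
  then have "\<beta> = 0" by (auto simp: total_deg_def vec_eq_iff)
  then show ?case using assms(1) by simp
next
  case (Suc k)
  then have "\<exists>i. \<beta> $ i \<noteq> 0" by (metis (no_types, lifting) nat.distinct(1) sum.neutral total_deg_def)
  then obtain i where i: "\<beta> $ i \<noteq> 0" by blast
  define \<gamma> where "\<gamma> = (\<chi> j. if j = i then \<beta> $ j - 1 else \<beta> $ j)"
  have \<beta>: "\<beta> = \<gamma> + axis i 1" using i by (auto simp: \<gamma>_def vec_eq_iff axis_def)
  have "total_deg (axis i 1 :: nat^'n) = 1" by (simp add: total_deg_def axis_def)
  then have "total_deg \<gamma> = k" using Suc.hyps(2) unfolding \<beta> by simp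
  then show ?case using Suc.hyps(1)[of \<gamma>] assms(2) \<beta> by simp
qed

lemma pdiffs_0 [simp]: "pdiffs 0 f = f"
  by (simp add: mps_eq_iff)

lemma pdiffs_add_axis: "pdiffs (\<delta> + axis i 1) f = pdiff i (pdiffs \<delta> f)"
proof (rule mps_eqI)
  fix \<alpha> :: "nat^'a"
  have "(\<Prod>j\<in>UNIV. pochhammer (\<alpha> $ j + 1) ((\<delta> + axis i 1) $ j)) =
    pochhammer (\<alpha> $ i + 1) (\<delta> $ i + 1) * (\<Prod>j\<in>UNIV-{i}. pochhammer (\<alpha> $ j + 1) ((\<delta> + axis i 1) $ j))"
    by (simp add: prod.remove[of UNIV i] axis_def)
  also have "(\<Prod>j\<in>UNIV-{i}. pochhammer (\<alpha> $ j + 1) ((\<delta> + axis i 1) $ j)) =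
     (\<Prod>j\<in>UNIV-{i}. pochhammer ((\<alpha> + axis i 1) $ j + 1) (\<delta> $ j))"
    by (rule prod.cong) (auto simp: axis_def)
  also have "pochhammer (\<alpha> $ i + 1) (\<delta> $ i + 1) = (\<alpha> $ i + 1) * pochhammer ((\<alpha> + axis i 1) $ i + 1) (\<delta> $ i)"
    by (simp add: pochhammer_rec axis_def)
  also have "(\<alpha> $ i + 1) * pochhammer ((\<alpha> + axis i 1) $ i + 1) (\<delta> $ i) * (\<Prod>j\<in>UNIV-{i}. pochhammer ((\<alpha> + axis i 1) $ j + 1) (\<delta> $ j))
     = (\<alpha> $ i + 1) * (\<Prod>j\<in>UNIV. pochhammer ((\<alpha> + axis i 1) $ j + 1) (\<delta> $ j))"
    by (simp add: prod.remove[of UNIV i] algebra_simps)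
  finally have "(\<Prod>j\<in>UNIV. pochhammer (\<alpha> $ j + 1) ((\<delta> + axis i 1) $ j)) =
    (\<alpha> $ i + 1) * (\<Prod>j\<in>UNIV. pochhammer ((\<alpha> + axis i 1) $ j + 1) (\<delta> $ j))" .
  then show "coeff (pdiffs (\<delta> + axis i 1) f) \<alpha> = coeff (pdiff i (pdiffs \<delta> f)) \<alpha>"
    by (simp only: coeff_pdiffs coeff_pdiff of_nat_mult mult.assoc)
       (simp add: add_ac)
qed

lemma pdiff_add: "pdiff i (f + g) = pdiff i f + pdiff i g"
  by (simp add: mps_eq_iff algebra_simps)

lemma pdiff_0 [simp]: "pdiff i 0 = 0"
  by (simp add: mps_eq_iff)

lemma pdiffs_add: "pdiffs \<delta> (f + g) = pdiffs \<delta> f + pdiffs \<delta> g"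
  by (simp add: mps_eq_iff distrib_left)

lemma pdiffs_zero [simp]: "pdiffs \<delta> 0 = 0"
  by (simp add: mps_eq_iff)

lemma pdiff_mult: "pdiff i (f * g) = pdiff i f * g + f * pdiff i g"
proof -
  have aux: "(\<Sum>(\<mu>, \<nu>) | \<mu> + \<nu> = \<alpha> + axis i 1. of_nat (\<mu> $ i) * coeff f \<mu> * coeff g \<nu>)
      = coeff (pdiff i f * g) \<alpha>" for f g :: "('a, 'b) mps" and \<alpha>
  proof -
    have "(\<Sum>(\<mu>, \<nu>) | \<mu> + \<nu> = \<alpha> + axis i 1. of_nat (\<mu> $ i) * coeff f \<mu> * coeff g \<nu>) =
      (\<Sum>(\<mu>, \<nu>) | \<mu> + \<nu> = \<alpha> + axis i 1 \<and> \<mu> $ i \<noteq> 0. of_nat (\<mu> $ i) * coeff f \<mu> * coeff g \<nu>)"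
    proof (rule sum.mono_neutral_right)
      show "finite {(\<mu>, \<nu>). \<mu> + \<nu> = \<alpha> + axis i 1}" by simp
    qed (auto intro!: Nat.gr0I)
    also have "\<dots> = (\<Sum>(\<mu>, \<nu>) | \<mu> + \<nu> = \<alpha>. of_nat (\<mu> $ i + 1) * coeff f (\<mu> + axis i 1) * coeff g \<nu>)"
    proof (rule sum.reindex_bij_witness[where i = "\<lambda>(\<mu>, \<nu>). (\<mu> + axis i 1, \<nu>)" and j = "\<lambda>(\<mu>, \<nu>). (\<mu> - axis i 1, \<nu>)"])
      have *: "\<mu> - axis i 1 + axis i 1 = \<mu>" if "\<mu> $ i \<noteq> 0" for \<mu> :: "nat^'a"
        using that by (auto simp: vec_eq_iff axis_def)
      have **: "Suc ((\<mu> - axis i 1) $ i) = \<mu> $ i" if "\<mu> $ i \<noteq> 0" for \<mu> :: "nat^'a"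
        using that by (auto simp: axis_def)
      fix p assume "p \<in> {(\<mu>, \<nu>). \<mu> + \<nu> = \<alpha> + axis i 1 \<and> \<mu> $ i \<noteq> 0}"
      then obtain \<mu> \<nu> where p: "p = (\<mu>, \<nu>)" "\<mu> + \<nu> = \<alpha> + axis i 1" "\<mu> $ i \<noteq> 0" by auto
      have "\<mu> - axis i 1 + \<nu> + axis i 1 = \<alpha> + axis i 1"
        using *[OF p(3)] p(2) by (metis add.assoc add.commute)
      then show "(case p of (\<mu>, \<nu>) \<Rightarrow> (\<mu> - axis i 1, \<nu>)) \<in> {(\<mu>, \<nu>). \<mu> + \<nu> = \<alpha>}"
        using p(1) by simp
      show "(case case p of (\<mu>, \<nu>) \<Rightarrow> (\<mu> - axis i 1, \<nu>) of (\<mu>, \<nu>) \<Rightarrow> (\<mu> + axis i 1, \<nu>)) = p"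
        using p(1) *[OF p(3)] by simp
      show "(case case p of (\<mu>, \<nu>) \<Rightarrow> (\<mu> - axis i 1, \<nu>) of (\<mu>, \<nu>) \<Rightarrow> of_nat (\<mu> $ i + 1) * coeff f (\<mu> + axis i 1) * coeff g \<nu>)
         = (case p of (\<mu>, \<nu>) \<Rightarrow> of_nat (\<mu> $ i) * coeff f \<mu> * coeff g \<nu>)"
        using p(1) *[OF p(3)] **[OF p(3)] by (simp del: of_nat_Suc vector_minus_component)
    next
      fix q assume "q \<in> {(\<mu>, \<nu>). \<mu> + \<nu> = \<alpha>}"
      then obtain \<mu> \<nu> where q: "q = (\<mu>, \<nu>)" "\<mu> + \<nu> = \<alpha>" by auto
      show "(case case q of (\<mu>, \<nu>) \<Rightarrow> (\<mu> + axis i 1, \<nu>) of (\<mu>, \<nu>) \<Rightarrow> (\<mu> - axis i 1, \<nu>)) = q"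
        using q by (simp add: vec_eq_iff)
      show "(case q of (\<mu>, \<nu>) \<Rightarrow> (\<mu> + axis i 1, \<nu>)) \<in> {(\<mu>, \<nu>). \<mu> + \<nu> = \<alpha> + axis i 1 \<and> \<mu> $ i \<noteq> 0}"
        using q by (auto simp: algebra_simps axis_def)
    qed
    also have "\<dots> = coeff (pdiff i f * g) \<alpha>"
      by (simp add: coeff_mult)
    finally show ?thesis .
  qed
  show ?thesis
  proof (rule mps_eqI)
    fix \<alpha>
    have "coeff (pdiff i (f * g)) \<alpha> =
        (\<Sum>(\<mu>, \<nu>) | \<mu> + \<nu> = \<alpha> + axis i 1. of_nat (\<alpha> $ i + 1) * (coeff f \<mu> * coeff g \<nu>))"
      by (simp add: coeff_mult sum_distrib_left case_prod_unfold del: of_nat_Suc)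
    also have "\<dots> = (\<Sum>(\<mu>, \<nu>) | \<mu> + \<nu> = \<alpha> + axis i 1. of_nat (\<mu> $ i) * coeff f \<mu> * coeff g \<nu>
         + of_nat (\<nu> $ i) * coeff g \<nu> * coeff f \<mu>)"
    proof (rule sum.cong[OF refl], clarify)
      fix \<mu> \<nu> :: "nat^'a" assume "\<mu> + \<nu> = \<alpha> + axis i 1"
      then have "\<mu> $ i + \<nu> $ i = \<alpha> $ i + 1" by (metis axis_nth vector_add_component)
      then have "(of_nat (\<alpha> $ i + 1) :: 'b) = of_nat (\<mu> $ i) + of_nat (\<nu> $ i)" by (metis of_nat_add)
      then show "of_nat (\<alpha> $ i + 1) * (coeff f \<mu> * coeff g \<nu>) = of_nat (\<mu> $ i) * coeff f \<mu> * coeff g \<nu>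
         + of_nat (\<nu> $ i) * coeff g \<nu> * coeff f \<mu>"
        by (simp add: algebra_simps)
    qed
    also have "\<dots> = (\<Sum>(\<mu>, \<nu>) | \<mu> + \<nu> = \<alpha> + axis i 1. of_nat (\<mu> $ i) * coeff f \<mu> * coeff g \<nu>)
       + (\<Sum>(\<mu>, \<nu>) | \<mu> + \<nu> = \<alpha> + axis i 1. of_nat (\<nu> $ i) * coeff g \<nu> * coeff f \<mu>)"
      by (simp add: sum.distrib case_prod_unfold)
    also have "(\<Sum>(\<mu>, \<nu>) | \<mu> + \<nu> = \<alpha> + axis i 1. of_nat (\<nu> $ i) * coeff g \<nu> * coeff f \<mu>)
       = (\<Sum>(\<mu>, \<nu>) | \<mu> + \<nu> = \<alpha> + axis i 1. of_nat (\<mu> $ i) * coeff g \<mu> * coeff f \<nu>)"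
      by (rule sum.reindex_bij_witness[where i = "\<lambda>(a, b). (b, a)" and j = "\<lambda>(a, b). (b, a)"])
         (auto simp: add.commute)
    finally show "coeff (pdiff i (f * g)) \<alpha> = coeff (pdiff i f * g + f * pdiff i g) \<alpha>"
      unfolding aux by (simp add: mult.commute[of f])
  qed
qed

definition pdiff_closed :: "('n::finite, 'k::field) mps set \<Rightarrow> bool"
  where "pdiff_closed C \<longleftrightarrow> (\<forall>i. \<forall>f\<in>C. pdiff i f \<in> C)"

lemma pdiffs_closed: "pdiff_closed C \<Longrightarrow> f \<in> C \<Longrightarrow> pdiffs \<delta> f \<in> C"
  by (induction \<delta> rule: multi_induct) (auto simp: pdiffs_add_axis pdiff_closed_def simp del: One_nat_def)

lemma pdiff_closed_UNIV: "pdiff_closed UNIV"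
  by (simp add: pdiff_closed_def)

lemma pdiff_polys: "f \<in> polys \<Longrightarrow> pdiff i f \<in> polys"
proof -
  assume "f \<in> polys"
  then have "finite ((\<lambda>\<alpha>. \<alpha> - axis i 1) ` {\<alpha>. coeff f \<alpha> \<noteq> 0})" by (simp add: polys_def)
  moreover have "{\<alpha>. coeff (pdiff i f) \<alpha> \<noteq> 0} \<subseteq> (\<lambda>\<alpha>. \<alpha> - axis i 1) ` {\<alpha>. coeff f \<alpha> \<noteq> 0}"
  proof
    fix \<alpha> assume "\<alpha> \<in> {\<alpha>. coeff (pdiff i f) \<alpha> \<noteq> 0}"
    then have "coeff f (\<alpha> + axis i 1) \<noteq> 0" by auto
    moreover have "\<alpha> + axis i 1 - axis i 1 = \<alpha>" by (simp add: vec_eq_iff)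
    ultimately show "\<alpha> \<in> (\<lambda>\<alpha>. \<alpha> - axis i 1) ` {\<alpha>. coeff f \<alpha> \<noteq> 0}"
      by (intro image_eqI[of _ _ "\<alpha> + axis i 1"]) auto
  qed
  ultimately show ?thesis unfolding polys_def by (simp add: finite_subset)
qed

lemma pdiff_closed_loc_polys: "pdiff_closed (loc_polys :: ('n::finite, 'k::field) mps set)"
  unfolding pdiff_closed_def
proof clarify
  fix i and h :: "('n, 'k) mps" assume "h \<in> loc_polys"
  then obtain p q :: "('n, 'k) mps" where h: "p \<in> polys" "q \<in> polys" "coeff q 0 \<noteq> 0" "q * h = p"
    unfolding loc_polys_def by blast
  have "pdiff i p = pdiff i q * h + q * pdiff i h" using h(4) pdiff_mult[of i q h] by simp
  then have "q * (q * pdiff i h) = q * (pdiff i p - pdiff i q * h)" by simp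
  then have "q * q * pdiff i h = q * pdiff i p - pdiff i q * p"
    unfolding h(4)[symmetric] by (simp add: algebra_simps)
  moreover have "q * pdiff i p - pdiff i q * p \<in> polys"
    using polys_closed(4)[OF polys_closed(5)[OF h(2) pdiff_polys[OF h(1)]]
        polys_closed(3)[OF polys_closed(5)[OF pdiff_polys[OF h(2)] h(1)]]] by simp
  moreover have "q * q \<in> polys" "coeff (q * q) 0 \<noteq> 0"
    using h(2,3) by (auto intro!: polys_closed)
  ultimately show "pdiff i h \<in> loc_polys" unfolding loc_polys_def by blast
qed

lemma pdiff_closed_conv_series: "pdiff_closed (conv_series :: ('n::finite, complex) mps set)"
  unfolding pdiff_closed_def
proof clarify
  fix i and f :: "('n, complex) mps" assume "f \<in> conv_series"
  then obtain r where r: "r > 0" "(\<lambda>\<alpha>. cmod (coeff f \<alpha>) * r ^ total_deg \<alpha>) summable_on UNIV"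
    unfolding conv_series_def by blast
  let ?F = "\<lambda>\<alpha>. cmod (coeff f \<alpha>) * r ^ total_deg \<alpha>"
  have "?F summable_on range (\<lambda>\<alpha>. \<alpha> + axis i 1)"
    by (rule summable_on_subset_banach[OF r(2)]) simp
  then have s: "(?F \<circ> (\<lambda>\<alpha>. \<alpha> + axis i 1)) summable_on UNIV"
    by (subst summable_on_reindex[symmetric]) (auto simp: inj_on_def)
  have "(\<lambda>\<alpha>. cmod (coeff (pdiff i f) \<alpha>) * (r / 2) ^ total_deg \<alpha>) summable_on UNIV"
  proof (rule summable_on_comparison_test[OF summable_on_cmult_right[OF s, of "1 / r"]])
    fix \<alpha> :: "nat^'n"
    have "\<alpha> $ i \<le> total_deg \<alpha>" unfolding total_deg_def by (rule member_le_sum) auto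
    then have "real (\<alpha> $ i + 1) \<le> real (total_deg \<alpha> + 1)" by simp
    also have "\<dots> \<le> 2 ^ total_deg \<alpha>"
      by (metis Suc_eq_plus1 less_exp Suc_leI of_nat_le_iff of_nat_numeral of_nat_power)
    finally have "real (\<alpha> $ i + 1) \<le> 2 ^ total_deg \<alpha>" .
    then have "real (\<alpha> $ i + 1) * (r / 2) ^ total_deg \<alpha> \<le> 2 ^ total_deg \<alpha> * (r / 2) ^ total_deg \<alpha>"
      using r(1) by (intro mult_right_mono) auto
    also have "\<dots> = r ^ total_deg \<alpha>" by (simp add: power_divide)
    finally have *: "real (\<alpha> $ i + 1) * (r / 2) ^ total_deg \<alpha> \<le> r ^ total_deg \<alpha>" .
    have td: "total_deg (axis i 1 :: nat^'n) = 1" by (simp add: total_deg_def axis_def)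
    have "cmod (coeff (pdiff i f) \<alpha>) * (r / 2) ^ total_deg \<alpha>
       = cmod (coeff f (\<alpha> + axis i 1)) * (real (\<alpha> $ i + 1) * (r / 2) ^ total_deg \<alpha>)"
      by (simp only: coeff_pdiff norm_mult norm_of_nat) (simp add: mult_ac)
    also have "\<dots> \<le> cmod (coeff f (\<alpha> + axis i 1)) * r ^ total_deg \<alpha>"
      by (rule mult_left_mono[OF *]) simp
    also have "\<dots> = 1 / r * (?F \<circ> (\<lambda>\<alpha>. \<alpha> + axis i 1)) \<alpha>"
      using r(1) td by (simp add: field_simps)
    finally show "cmod (coeff (pdiff i f) \<alpha>) * (r / 2) ^ total_deg \<alpha> \<le> 1 / r * (?F \<circ> (\<lambda>\<alpha>. \<alpha> + axis i 1)) \<alpha>" .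
  qed (use r in auto)
  then show "pdiff i f \<in> conv_series" unfolding conv_series_def using r(1) by (intro CollectI exI[of _ "r / 2"]) auto
qed

abbreviation (input) "lkp \<equiv> Poly_Mapping.lookup"
abbreviation (input) "sgl \<equiv> Poly_Mapping.single"

definition mapd :: "(('n::finite, 'k::field) mps \<Rightarrow> ('n, 'k) mps) \<Rightarrow> ('n, 'k) dop \<Rightarrow> ('n, 'k) dop"
  where "mapd g B = Poly_Mapping.mapp (\<lambda>_. g) B"

definition mbox :: "'n set \<Rightarrow> nat^'n::finite \<Rightarrow> (nat^'n) set"
  where "mbox P \<beta> = {\<delta>. (\<forall>i. \<delta> $ i \<le> \<beta> $ i) \<and> (\<forall>i\<in>P. \<delta> $ i = 0)}"

definition mbinom :: "nat^'n::finite \<Rightarrow> nat^'n \<Rightarrow> nat"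
  where "mbinom \<beta> \<delta> = (\<Prod>i\<in>UNIV. \<beta> $ i choose \<delta> $ i)"

definition act :: "'n set \<Rightarrow> nat^'n \<Rightarrow> ('n::finite, 'k::field) dop \<Rightarrow> ('n, 'k) dop"
  where "act P \<beta> B = (\<Sum>\<delta>\<in>mbox P \<beta>. sgl (\<beta> - \<delta>) (of_nat (mbinom \<beta> \<delta>)) * mapd (pdiffs \<delta>) B)"

lemma finite_mbox [simp]: "finite (mbox P \<beta>)"
  unfolding mbox_def by (rule finite_subset[OF _ finite_le_multi[of "\<lambda>i. \<beta> $ i"]]) auto

lemma lookup_mapd [simp]: "g 0 = 0 \<Longrightarrow> lkp (mapd g B) \<gamma> = g (lkp B \<gamma>)"
  by (simp add: mapd_def lookup_mapp when_def in_keys_iff)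

lemma sum_sgl: "(\<Sum>\<gamma>\<in>Poly_Mapping.keys B. sgl \<gamma> (lkp B \<gamma>)) = B"
  by (rule poly_mapping_eqI) (simp add: lookup_sum lookup_single when_def in_keys_iff)

lemma op_mult_act: "op_mult P A B = (\<Sum>\<beta>\<in>Poly_Mapping.keys A. sgl 0 (lkp A \<beta>) * act P \<beta> B)"
proof -
  have "(\<Sum>\<gamma>\<in>Poly_Mapping.keys B. \<Sum>\<delta>\<in>mbox P \<beta>.
      sgl (\<beta> - \<delta> + \<gamma>) (of_nat (mbinom \<beta> \<delta>) * a * pdiffs \<delta> (lkp B \<gamma>))) = sgl 0 a * act P \<beta> B" for a \<beta>
  proof -
    have "(\<Sum>\<gamma>\<in>Poly_Mapping.keys B. sgl (\<beta> - \<delta> + \<gamma>) (of_nat (mbinom \<beta> \<delta>) * a * pdiffs \<delta> (lkp B \<gamma>)))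
      = sgl 0 a * (sgl (\<beta> - \<delta>) (of_nat (mbinom \<beta> \<delta>)) * mapd (pdiffs \<delta>) B)" for \<delta>
    proof -
      have B: "mapd (pdiffs \<delta>) B = (\<Sum>\<gamma>\<in>Poly_Mapping.keys B. sgl \<gamma> (pdiffs \<delta> (lkp B \<gamma>)))"
        by (rule poly_mapping_eqI) (simp add: lookup_sum lookup_single when_def in_keys_iff)
      show ?thesis unfolding B by (simp add: sum_distrib_left mult_single mult_ac add.commute)
    qed
    then show ?thesis unfolding act_def by (subst sum.swap) (simp add: sum_distrib_left)
  qed
  then show ?thesis unfolding op_mult_def mbox_def mbinom_def by simp
qed

lemma op_mult_superset:
  assumes "finite K" "Poly_Mapping.keys A \<subseteq> K"
  shows "op_mult P A B = (\<Sum>\<beta>\<in>K. sgl 0 (lkp A \<beta>) * act P \<beta> B)"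
  unfolding op_mult_act by (rule sum.mono_neutral_left) (use assms in \<open>auto simp: in_keys_iff\<close>)

lemma op_mult_add_left: "op_mult P (A + A') B = op_mult P A B + op_mult P A' B"
proof -
  let ?K = "Poly_Mapping.keys A \<union> Poly_Mapping.keys A'"
  show ?thesis
    using Poly_Mapping.keys_add[of A A']
    by (simp add: op_mult_superset[of ?K] lookup_add single_add distrib_right sum.distrib)
qed

lemma mapd_add:
  "(\<And>a b. g (a + b) = g a + g b) \<Longrightarrow> g 0 = 0 \<Longrightarrow> mapd g (A + B) = mapd g A + mapd g B"
  by (rule poly_mapping_eqI) (simp add: lookup_add)

lemma mapd_zero: "g 0 = 0 \<Longrightarrow> mapd g 0 = 0"
  by (rule poly_mapping_eqI) simp

lemma mapd_sum:
  "(\<And>a b. g (a + b) = g a + g b) \<Longrightarrow> g 0 = 0 \<Longrightarrow> mapd g (sum f S) = (\<Sum>x\<in>S. mapd g (f x))"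
  by (induction S rule: infinite_finite_induct) (simp_all add: mapd_add mapd_zero)

lemma act_add: "act P \<beta> (A + B) = act P \<beta> A + act P \<beta> B"
  by (simp add: act_def mapd_add pdiffs_add distrib_left sum.distrib)

lemma act_zero [simp]: "act P \<beta> 0 = 0"
  using act_add[of P \<beta> 0 0] by simp

lemma act_sum: "act P \<beta> (sum f S) = (\<Sum>x\<in>S. act P \<beta> (f x))"
  by (induction S rule: infinite_finite_induct) (auto simp: act_add)

lemma op_mult_add_right: "op_mult P A (B + B') = op_mult P A B + op_mult P A B'"
  by (simp add: op_mult_act act_add distrib_left sum.distrib)

lemma op_mult_0_left [simp]: "op_mult P 0 B = 0" and op_mult_0_right [simp]: "op_mult P A 0 = 0"
  by (simp_all add: op_mult_act)

lemma op_mult_sum_left: "op_mult P (sum f S) B = (\<Sum>x\<in>S. op_mult P (f x) B)"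
  by (induction S rule: infinite_finite_induct) (auto simp: op_mult_add_left)

lemma op_mult_sum_right: "op_mult P A (sum f S) = (\<Sum>x\<in>S. op_mult P A (f x))"
  by (induction S rule: infinite_finite_induct) (auto simp: op_mult_add_right)

lemma op_mult_single: "op_mult P (sgl \<beta> a) B = sgl 0 a * act P \<beta> B"
  using op_mult_superset[of "{\<beta>}" "sgl \<beta> a" P B] by (simp add: lookup_single when_def)

lemma mbox_0 [simp]: "mbox P 0 = {0}"
  by (auto simp: mbox_def vec_eq_iff)

lemma act_0 [simp]: "act P 0 B = B"
proof -
  have "mapd (pdiffs 0) B = B" by (rule poly_mapping_eqI) simp
  then show ?thesis by (simp add: act_def mbinom_def)
qed

definition dmul :: "'n set \<Rightarrow> 'n \<Rightarrow> ('n::finite, 'k::field) dop \<Rightarrow> ('n, 'k) dop"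
  where "dmul P i B = sgl (axis i 1) 1 * B + (if i \<in> P then 0 else mapd (pdiff i) B)"

lemma dmul_add: "dmul P i (A + B) = dmul P i A + dmul P i B"
  by (simp add: dmul_def mapd_add pdiff_add distrib_left)

lemma dmul_0 [simp]: "dmul P i 0 = 0"
  using dmul_add[of P i 0 0] by simp

lemma dmul_sum: "dmul P i (sum f S) = (\<Sum>x\<in>S. dmul P i (f x))"
  by (induction S rule: infinite_finite_induct) (auto simp: dmul_add)

lemma lookup_sgl0_mult: "lkp (sgl 0 a * B) \<gamma> = a * lkp B \<gamma>"
proof -
  have "sgl 0 a * B = (\<Sum>\<gamma>\<in>Poly_Mapping.keys B. sgl \<gamma> (a * lkp B \<gamma>))"
    by (subst sum_sgl[symmetric, of B]) (simp add: sum_distrib_left mult_single)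
  then show ?thesis by (simp add: lookup_sum lookup_single when_def in_keys_iff)
qed

lemma dmul_sgl0:
  "dmul P i (sgl 0 a * B) = sgl 0 a * dmul P i B + (if i \<in> P then 0 else sgl 0 (pdiff i a) * B)"
proof -
  have "mapd (pdiff i) (sgl 0 a * B) = sgl 0 (pdiff i a) * B + sgl 0 a * mapd (pdiff i) B"
    by (rule poly_mapping_eqI) (simp add: lookup_sgl0_mult lookup_add pdiff_mult)
  then show ?thesis by (simp add: dmul_def algebra_simps)
qed

lemma mapd_sgl_mult:
  assumes "\<And>a b. g (a + b) = g a + g b" "g 0 = 0" "\<And>a. g (c * a) = c * g a"
  shows "mapd g (sgl \<alpha> c * B) = sgl \<alpha> c * mapd g B"
proof -
  note sums = mapd_sum[of g, OF assms(1,2)]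
  have sg: "mapd g (sgl \<gamma> a) = sgl \<gamma> (g a)" for \<gamma> a
    by (rule poly_mapping_eqI) (use assms in \<open>auto simp: lookup_single when_def\<close>)
  show ?thesis
    by (subst (1 2) sum_sgl[symmetric, of B]) (simp add: sum_distrib_left mult_single sums sg assms(3))
qed

lemma pdiff_of_nat [simp]: "pdiff i (of_nat k) = 0"
proof (induction k)
  case (Suc k)
  have "pdiff i (1 :: ('a, 'b) mps) = 0"
    by (simp add: mps_eq_iff vec_eq_iff axis_def) (metis)
  then show ?case using Suc by (simp add: pdiff_add)
qed simp

lemma act_add_axis: "act P (\<beta> + axis i 1) B = dmul P i (act P \<beta> B)"
proof -
  let ?e = "axis i 1 :: nat^'a"
  let ?D = "\<lambda>\<delta>. mapd (pdiffs \<delta>) B"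
  let ?s = "\<lambda>\<delta> c. sgl (\<beta> + ?e - \<delta>) (of_nat c) * ?D \<delta>"
  have mb: "mbinom (\<beta> + ?e) \<delta> = mbinom \<beta> \<delta> + (if \<delta> $ i = 0 then 0 else mbinom \<beta> (\<delta> - ?e))" for \<delta>
  proof -
    let ?R = "\<Prod>j\<in>UNIV-{i}. \<beta> $ j choose \<delta> $ j"
    have 1: "mbinom (\<beta> + ?e) \<delta> = (Suc (\<beta> $ i) choose \<delta> $ i) * ?R"
    proof -
      have "(\<Prod>j\<in>UNIV-{i}. (\<beta> + ?e) $ j choose \<delta> $ j) = ?R" by (rule prod.cong) (auto simp: axis_def)
      then show ?thesis by (simp add: mbinom_def prod.remove[of UNIV i] axis_def)
    qed
    have 2: "mbinom \<beta> \<delta> = (\<beta> $ i choose \<delta> $ i) * ?R"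
      by (simp add: mbinom_def prod.remove[of UNIV i])
    have 3: "mbinom \<beta> (\<delta> - ?e) = (\<beta> $ i choose (\<delta> $ i - 1)) * ?R"
    proof -
      have "(\<Prod>j\<in>UNIV-{i}. \<beta> $ j choose (\<delta> - ?e) $ j) = ?R" by (rule prod.cong) (auto simp: axis_def)
      then show ?thesis by (simp add: mbinom_def prod.remove[of UNIV i] axis_def)
    qed
    show ?thesis unfolding 1 2 3 by (cases "\<delta> $ i") (auto simp: algebra_simps)
  qed
  have ex: "\<delta> - ?e + ?e = \<delta>" if "\<delta> $ i \<noteq> 0" for \<delta>
    using that by (auto simp: vec_eq_iff axis_def)
  have S1: "sgl ?e 1 * act P \<beta> B = (\<Sum>\<delta>\<in>mbox P (\<beta> + ?e). ?s \<delta> (mbinom \<beta> \<delta>))"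
  proof -
    have "sgl ?e 1 * act P \<beta> B = (\<Sum>\<delta>\<in>mbox P \<beta>. sgl (?e + (\<beta> - \<delta>)) (of_nat (mbinom \<beta> \<delta>)) * ?D \<delta>)"
      unfolding act_def sum_distrib_left by (simp add: mult.assoc[symmetric] mult_single)
    also have "\<dots> = (\<Sum>\<delta>\<in>mbox P \<beta>. ?s \<delta> (mbinom \<beta> \<delta>))"
    proof (rule sum.cong[OF refl])
      fix \<delta> assume "\<delta> \<in> mbox P \<beta>"
      then have "?e + (\<beta> - \<delta>) = \<beta> + ?e - \<delta>" by (auto simp: mbox_def vec_eq_iff)
      then show "sgl (?e + (\<beta> - \<delta>)) (of_nat (mbinom \<beta> \<delta>)) * ?D \<delta> = ?s \<delta> (mbinom \<beta> \<delta>)" by simp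
    qed
    also have "\<dots> = (\<Sum>\<delta>\<in>mbox P (\<beta> + ?e). ?s \<delta> (mbinom \<beta> \<delta>))"
    proof (rule sum.mono_neutral_left)
      show "mbox P \<beta> \<subseteq> mbox P (\<beta> + ?e)" by (auto simp: mbox_def intro: le_trans)
      show "\<forall>\<delta>\<in>mbox P (\<beta> + ?e) - mbox P \<beta>. ?s \<delta> (mbinom \<beta> \<delta>) = 0"
      proof
        fix \<delta> assume "\<delta> \<in> mbox P (\<beta> + ?e) - mbox P \<beta>"
        then obtain j where "\<not> \<delta> $ j \<le> \<beta> $ j" by (auto simp: mbox_def)
        then have "mbinom \<beta> \<delta> = 0" unfolding mbinom_def
          by (intro prod_zero bexI[of _ j]) (auto simp: binomial_eq_0)
        then show "?s \<delta> (mbinom \<beta> \<delta>) = 0" by simp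
      qed
    qed simp
    finally show ?thesis .
  qed
  have S2: "mapd (pdiff i) (act P \<beta> B) =
     (\<Sum>\<delta>\<in>mbox P (\<beta> + ?e). ?s \<delta> (if \<delta> $ i = 0 then 0 else mbinom \<beta> (\<delta> - ?e)))" if i: "i \<notin> P"
  proof -
    note sums = mapd_sum[of "pdiff i", OF pdiff_add pdiff_0]
    have dd: "mapd (pdiff i) (?D \<delta>) = ?D (\<delta> + ?e)" for \<delta>
      by (rule poly_mapping_eqI) (simp add: pdiffs_add_axis del: One_nat_def)
    have "mapd (pdiff i) (act P \<beta> B) = (\<Sum>\<delta>\<in>mbox P \<beta>. sgl (\<beta> - \<delta>) (of_nat (mbinom \<beta> \<delta>)) * ?D (\<delta> + ?e))"
      unfolding act_def sums
      by (subst mapd_sgl_mult) (auto simp: pdiff_add pdiff_mult dd simp del: One_nat_def)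
    also have "\<dots> = (\<Sum>\<delta>\<in>{\<delta>\<in>mbox P (\<beta> + ?e). \<delta> $ i \<noteq> 0}. ?s \<delta> (mbinom \<beta> (\<delta> - ?e)))"
    proof (rule sum.reindex_bij_witness[where i = "\<lambda>\<delta>. \<delta> - ?e" and j = "\<lambda>\<delta>. \<delta> + ?e"])
      fix \<delta> assume d: "\<delta> \<in> mbox P \<beta>"
      show "\<delta> + ?e - ?e = \<delta>" by (simp add: vec_eq_iff)
      show "\<delta> + ?e \<in> {\<delta> \<in> mbox P (\<beta> + ?e). \<delta> $ i \<noteq> 0}" using d i by (auto simp: mbox_def axis_def)
      have "\<beta> + ?e - (\<delta> + ?e) = \<beta> - \<delta>" by (simp add: vec_eq_iff)
      then show "?s (\<delta> + ?e) (mbinom \<beta> (\<delta> + ?e - ?e)) = sgl (\<beta> - \<delta>) (of_nat (mbinom \<beta> \<delta>)) * ?D (\<delta> + ?e)"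
        by (simp add: \<open>\<delta> + ?e - ?e = \<delta>\<close> del: One_nat_def)
    next
      fix \<delta> assume d: "\<delta> \<in> {\<delta> \<in> mbox P (\<beta> + ?e). \<delta> $ i \<noteq> 0}"
      then show "\<delta> - ?e + ?e = \<delta>" using ex by blast
      show "\<delta> - ?e \<in> mbox P \<beta>" 
      proof -
        have "(\<delta> - ?e) $ j \<le> \<beta> $ j" for j
        proof -
          have "\<delta> $ j \<le> (\<beta> + ?e) $ j" using d by (auto simp: mbox_def)
          then show ?thesis by (simp add: le_diff_conv)
        qed
        then show ?thesis using d by (simp add: mbox_def)
      qed
    qed
    also have "\<dots> = (\<Sum>\<delta>\<in>mbox P (\<beta> + ?e). ?s \<delta> (if \<delta> $ i = 0 then 0 else mbinom \<beta> (\<delta> - ?e)))"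
      by (rule sum.mono_neutral_cong_left) auto
    finally show ?thesis .
  qed
  show ?thesis
  proof (cases "i \<in> P")
    case True
    then have "mbinom (\<beta> + ?e) \<delta> = mbinom \<beta> \<delta>" if "\<delta> \<in> mbox P (\<beta> + ?e)" for \<delta>
      using that by (simp add: mb mbox_def del: One_nat_def)
    then have "act P (\<beta> + ?e) B = (\<Sum>\<delta>\<in>mbox P (\<beta> + ?e). ?s \<delta> (mbinom \<beta> \<delta>))"
      unfolding act_def by (intro sum.cong) auto
    then show ?thesis unfolding dmul_def S1 using True by simp
  next
    case False
    have "act P (\<beta> + ?e) B = (\<Sum>\<delta>\<in>mbox P (\<beta> + ?e). ?s \<delta> (mbinom \<beta> \<delta>) +
        ?s \<delta> (if \<delta> $ i = 0 then 0 else mbinom \<beta> (\<delta> - ?e)))"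
      unfolding act_def mb of_nat_add single_add distrib_right ..
    also have "\<dots> = dmul P i (act P \<beta> B)"
      unfolding sum.distrib dmul_def S1 S2[OF False] using False by simp
    finally show ?thesis .
  qed
qed

lemma dmul_op_mult: "dmul P i (op_mult P A B) = op_mult P (dmul P i A) B"
proof -
  have *: "dmul P i (op_mult P (sgl \<beta> a) B) = op_mult P (dmul P i (sgl \<beta> a)) B" for \<beta> a
  proof -
    have "mapd (pdiff i) (sgl \<beta> a) = sgl \<beta> (pdiff i a)"
      by (rule poly_mapping_eqI) (simp add: lookup_single when_def)
    then have "dmul P i (sgl \<beta> a) = sgl (\<beta> + axis i 1) a + (if i \<in> P then 0 else sgl \<beta> (pdiff i a))"
      by (simp add: dmul_def mult_single add.commute del: One_nat_def)
    then have "op_mult P (dmul P i (sgl \<beta> a)) B =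
       sgl 0 a * dmul P i (act P \<beta> B) + (if i \<in> P then 0 else sgl 0 (pdiff i a) * act P \<beta> B)"
      by (simp add: op_mult_add_left op_mult_single act_add_axis del: One_nat_def)
    also have "\<dots> = dmul P i (op_mult P (sgl \<beta> a) B)"
      by (simp add: op_mult_single dmul_sgl0)
    finally show ?thesis ..
  qed
  show ?thesis
    by (subst (1 2) sum_sgl[symmetric, of A]) (simp add: op_mult_sum_left dmul_sum *)
qed

lemma act_op_mult: "act P \<beta> (op_mult P A B) = op_mult P (act P \<beta> A) B"
  by (induction \<beta> rule: multi_induct) (simp_all add: act_add_axis dmul_op_mult del: One_nat_def)

lemma op_mult_sgl0: "op_mult P (sgl 0 a * A) B = sgl 0 a * op_mult P A B"
proof -
  have *: "op_mult P (sgl 0 a * sgl \<beta> b) B = sgl 0 a * op_mult P (sgl \<beta> b) B" for \<beta> b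
    by (simp add: mult_single op_mult_single mult.assoc[symmetric])
  show ?thesis
    by (subst (1 2) sum_sgl[symmetric, of A]) (simp add: sum_distrib_left op_mult_sum_left *)
qed

lemma op_mult_assoc: "op_mult P (op_mult P A B) E = op_mult P A (op_mult P B E)"
  unfolding op_mult_act[of P A] op_mult_sum_left op_mult_sgl0 act_op_mult ..

lemma op_mult_1_left [simp]: "op_mult P 1 A = A"
proof -
  have "op_mult P (sgl 0 1) A = A" unfolding op_mult_single by simp
  then show ?thesis by simp
qed

lemma act_1: "act P \<beta> 1 = sgl \<beta> 1"
proof (induction \<beta> rule: multi_induct)
  case (add \<beta> i)
  have "pdiff i (1 :: ('a, 'b) mps) = 0" using pdiff_of_nat[of i 1] by simp
  then have "mapd (pdiff i) (sgl \<beta> (1 :: ('a, 'b) mps)) = 0"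
    by (intro poly_mapping_eqI) (simp add: lookup_single when_def)
  then show ?case using add by (simp add: act_add_axis dmul_def mult_single add.commute del: One_nat_def)
qed simp

lemma op_mult_1_right [simp]: "op_mult P A 1 = A"
  unfolding op_mult_act act_1 by (simp add: mult_single sum_sgl)

lemma op_mult_comm_rel: "op_mult P (sgl (axis i 1) 1) (sgl 0 c) =
    op_mult P (sgl 0 c) (sgl (axis i 1) 1) + (if i \<in> P then 0 else sgl 0 (pdiff i c))"
proof -
  have "op_mult P (sgl (axis i 1) 1) (sgl 0 c) = dmul P i (sgl 0 c)"
    using act_add_axis[of P 0 i "sgl 0 c"] by (simp add: op_mult_single del: One_nat_def)
  also have "mapd (pdiff i) (sgl 0 c) = sgl 0 (pdiff i c)"
    by (rule poly_mapping_eqI) (simp add: lookup_single when_def)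
  then have "dmul P i (sgl 0 c) = sgl (axis i 1) c + (if i \<in> P then 0 else sgl 0 (pdiff i c))"
    by (simp add: dmul_def mult_single)
  finally show ?thesis by (simp add: op_mult_single mult_single)
qed

lemma op_ring_simps [simp]:
  "carrier (op_ring P X) = X" "x \<otimes>\<^bsub>op_ring P X\<^esub> y = op_mult P x y" "\<one>\<^bsub>op_ring P X\<^esub> = 1"
  "\<zero>\<^bsub>op_ring P X\<^esub> = 0" "x \<oplus>\<^bsub>op_ring P X\<^esub> y = x + y"
  by (simp_all add: op_ring_def)

lemma ring_op_ring:
  assumes "1 \<in> X" "0 \<in> X" "\<And>f. f \<in> X \<Longrightarrow> - f \<in> X"
    "\<And>f g. f \<in> X \<Longrightarrow> g \<in> X \<Longrightarrow> f + g \<in> X" "\<And>f g. f \<in> X \<Longrightarrow> g \<in> X \<Longrightarrow> op_mult P f g \<in> X"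
  shows "ring (op_ring P X)"
proof (rule ringI)
  show "abelian_group (op_ring P X)"
  proof (rule abelian_groupI)
    fix x assume "x \<in> carrier (op_ring P X)"
    then show "\<exists>y\<in>carrier (op_ring P X). y \<oplus>\<^bsub>op_ring P X\<^esub> x = \<zero>\<^bsub>op_ring P X\<^esub>"
      using assms(3) by (auto intro!: bexI[of _ "- x"])
  qed (use assms in \<open>auto simp: algebra_simps\<close>)
  show "Group.monoid (op_ring P X)"
    by (rule monoidI) (use assms in \<open>auto simp: op_mult_assoc\<close>)
qed (auto simp: op_mult_add_left op_mult_add_right)

lemma ops_closed:
  assumes C: "cring (series_ring C)" and D: "pdiff_closed C"
  shows "1 \<in> ops C" "0 \<in> ops C" "A \<in> ops C \<Longrightarrow> - A \<in> ops C"
    "A \<in> ops C \<Longrightarrow> B \<in> ops C \<Longrightarrow> A + B \<in> ops C"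
    "A \<in> ops C \<Longrightarrow> B \<in> ops C \<Longrightarrow> op_mult P A B \<in> ops C"
proof -
  note cl = series_ring_closed[OF C]
  show "1 \<in> ops C" by (auto simp: ops_def lookup_one when_def cl)
  show 0: "0 \<in> ops C" by (auto simp: ops_def cl)
  show "A \<in> ops C \<Longrightarrow> - A \<in> ops C" by (auto simp: ops_def cl)
  have add: "A + B \<in> ops C" if "A \<in> ops C" "B \<in> ops C" for A B
    using that by (auto simp: ops_def cl lookup_add)
  then show "A \<in> ops C \<Longrightarrow> B \<in> ops C \<Longrightarrow> A + B \<in> ops C" .
  have sums: "(\<And>x. x \<in> S \<Longrightarrow> f x \<in> ops C) \<Longrightarrow> sum f S \<in> ops C" for f :: "nat^'a \<Rightarrow> _" and S
    by (induction S rule: infinite_finite_induct) (auto simp: 0 add)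
  have nat: "of_nat k \<in> C" for k by (induction k) (auto simp: cl)
  show "op_mult P A B \<in> ops C" if "A \<in> ops C" "B \<in> ops C"
    unfolding op_mult_def
  proof (intro sums)
    fix \<beta> \<gamma> \<delta>
    have "of_nat (\<Prod>i\<in>UNIV. \<beta> $ i choose \<delta> $ i) * lkp A \<beta> * pdiffs \<delta> (lkp B \<gamma>) \<in> C"
      using that nat by (intro cl pdiffs_closed[OF D]) (auto simp: ops_def simp del: of_nat_prod)
    then show "sgl (\<beta> - \<delta> + \<gamma>) (of_nat (\<Prod>i\<in>UNIV. \<beta> $ i choose \<delta> $ i) * lkp A \<beta> * pdiffs \<delta> (lkp B \<gamma>)) \<in> ops C"
      by (auto simp: ops_def lookup_single when_def cl)
  qed
qed

lemma ring_ops: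
  assumes "cring (series_ring C)" "pdiff_closed C"
  shows "ring (op_ring P (ops C))"
  by (intro ring_op_ring ops_closed assms)

lemma fst_W_loc: "w \<in> W_loc \<Longrightarrow> fst w \<in> U_loc"
  by (auto simp: W_loc_def U_loc_def)

lemma op_ord_attained:
  assumes "w \<in> W_loc" "A \<noteq> 0"
  shows "\<exists>\<alpha> \<beta>. coeff (lkp A \<beta>) \<alpha> \<noteq> 0 \<and> op_ord w A = op_wt w \<alpha> \<beta>"
    and "coeff (lkp A \<beta>) \<alpha> \<noteq> 0 \<Longrightarrow> op_wt w \<alpha> \<beta> \<le> op_ord w A"
proof -
  let ?X = "{m. \<exists>\<alpha> \<beta>. coeff (lkp A \<beta>) \<alpha> \<noteq> 0 \<and> m = op_wt w \<alpha> \<beta>}"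
  have fin: "finite {x \<in> ?X. x \<ge> c}" for c
  proof (rule finite_subset)
    show "{x \<in> ?X. x \<ge> c} \<subseteq> (\<Union>\<beta>\<in>Poly_Mapping.keys A.
        (\<lambda>x. x + wt (snd w) \<beta>) ` {wt (fst w) \<alpha> | \<alpha>. wt (fst w) \<alpha> \<ge> c - wt (snd w) \<beta>})"
    proof clarify
      fix \<alpha> \<beta> assume *: "coeff (lkp A \<beta>) \<alpha> \<noteq> 0" "op_wt w \<alpha> \<beta> \<ge> c"
      then have "\<beta> \<in> Poly_Mapping.keys A" by (auto simp: in_keys_iff)
      then show "op_wt w \<alpha> \<beta> \<in> (\<Union>\<beta>\<in>Poly_Mapping.keys A.
        (\<lambda>x. x + wt (snd w) \<beta>) ` {wt (fst w) \<alpha> | \<alpha>. wt (fst w) \<alpha> \<ge> c - wt (snd w) \<beta>})"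
        using * by (intro UN_I[of \<beta>] image_eqI[of _ _ "wt (fst w) \<alpha>"]) (auto simp: op_wt_def)
    qed
  qed (intro finite_UN_I finite_keys finite_imageI finite_wt_ge fst_W_loc assms)
  obtain \<beta>1 where "lkp A \<beta>1 \<noteq> 0" using assms(2) by (metis poly_mapping_eqI lookup_zero)
  then obtain \<alpha>1 where "coeff (lkp A \<beta>1) \<alpha>1 \<noteq> 0" by (auto simp: mps_eq_iff)
  then have ne: "?X \<noteq> {}" by blast
  show "\<exists>\<alpha> \<beta>. coeff (lkp A \<beta>) \<alpha> \<noteq> 0 \<and> op_ord w A = op_wt w \<alpha> \<beta>"
    using Greatest_attained(1)[OF fin ne] by (simp add: op_ord_def)
  show "coeff (lkp A \<beta>) \<alpha> \<noteq> 0 \<Longrightarrow> op_wt w \<alpha> \<beta> \<le> op_ord w A"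
    using Greatest_attained(2)[OF fin ne, of "op_wt w \<alpha> \<beta>"] by (auto simp: op_ord_def)
qed

lemma mem_op_filt:
  assumes "w \<in> W_loc"
  shows "A \<in> op_filt C w m \<longleftrightarrow> A \<in> ops C \<and> (\<forall>\<alpha> \<beta>. coeff (lkp A \<beta>) \<alpha> \<noteq> 0 \<longrightarrow> op_wt w \<alpha> \<beta> \<le> m)"
    and "A \<in> op_filt_less C w m \<longleftrightarrow> A \<in> ops C \<and> (\<forall>\<alpha> \<beta>. coeff (lkp A \<beta>) \<alpha> \<noteq> 0 \<longrightarrow> op_wt w \<alpha> \<beta> < m)"
proof -
  have *: "((\<forall>\<alpha> \<beta>. coeff (lkp A \<beta>) \<alpha> \<noteq> 0 \<longrightarrow> op_wt w \<alpha> \<beta> \<le> m) \<longleftrightarrow> op_ord w A \<le> m) \<and>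
    ((\<forall>\<alpha> \<beta>. coeff (lkp A \<beta>) \<alpha> \<noteq> 0 \<longrightarrow> op_wt w \<alpha> \<beta> < m) \<longleftrightarrow> op_ord w A < m)" if nz: "A \<noteq> 0"
  proof -
    obtain \<alpha>0 \<beta>0 where 0: "coeff (lkp A \<beta>0) \<alpha>0 \<noteq> 0" "op_ord w A = op_wt w \<alpha>0 \<beta>0"
      using op_ord_attained(1)[OF assms nz] by blast
    have 1: "op_wt w \<alpha> \<beta> \<le> op_wt w \<alpha>0 \<beta>0" if "coeff (lkp A \<beta>) \<alpha> \<noteq> 0" for \<alpha> \<beta>
      using op_ord_attained(2)[OF assms nz that] 0 by simp
    show ?thesis unfolding 0(2) using 0(1) by (auto dest: 1)
  qed
  show "A \<in> op_filt C w m \<longleftrightarrow> A \<in> ops C \<and> (\<forall>\<alpha> \<beta>. coeff (lkp A \<beta>) \<alpha> \<noteq> 0 \<longrightarrow> op_wt w \<alpha> \<beta> \<le> m)"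
    "A \<in> op_filt_less C w m \<longleftrightarrow> A \<in> ops C \<and> (\<forall>\<alpha> \<beta>. coeff (lkp A \<beta>) \<alpha> \<noteq> 0 \<longrightarrow> op_wt w \<alpha> \<beta> < m)"
    using * by (cases "A = 0"; simp add: op_filt_def op_filt_less_def)+
qed

lemma op_filt_coeffs:
  assumes "w \<in> W_loc"
  shows "A \<in> op_filt C w m \<longleftrightarrow> (\<forall>\<beta>. lkp A \<beta> \<in> ser_filt C (fst w) (m - wt (snd w) \<beta>))"
  unfolding mem_op_filt[OF assms] mem_ser_filt[OF fst_W_loc[OF assms]] ops_def op_wt_def
  by (auto simp: algebra_simps)

lemma lookup_op_part [simp]: "lkp (op_part w m A) \<beta> = ser_part (fst w) (m - wt (snd w) \<beta>) (lkp A \<beta>)"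
  by (simp add: op_part_def lookup_mapp when_def in_keys_iff)

lemma coeff_op_part: "coeff (lkp (op_part w m A) \<beta>) \<alpha> = (if op_wt w \<alpha> \<beta> = m then coeff (lkp A \<beta>) \<alpha> else 0)"
  by (auto simp: op_wt_def)

lemma op_part_kernel:
  assumes "w \<in> W_loc" "A \<in> op_filt C w m"
  shows "op_part w m A = 0 \<longleftrightarrow> A \<in> op_filt_less C w m"
proof -
  have "op_wt w \<alpha> \<beta> < m \<longleftrightarrow> op_wt w \<alpha> \<beta> \<noteq> m" if "coeff (lkp A \<beta>) \<alpha> \<noteq> 0" for \<alpha> \<beta>
    using assms that by (auto simp: mem_op_filt less_le)
  moreover have "op_part w m A = 0 \<longleftrightarrow> (\<forall>\<alpha> \<beta>. coeff (lkp (op_part w m A) \<beta>) \<alpha> = 0)"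
    unfolding poly_mapping_eq_iff fun_eq_iff mps_eq_iff by auto
  ultimately show ?thesis
    using assms(2) unfolding mem_op_filt[OF assms(1)] coeff_op_part by auto
qed

lemma op_part_add: "op_part w m (A + B) = op_part w m A + op_part w m B"
  by (rule poly_mapping_eqI) (simp add: lookup_add ser_part_add)

lemma ser_part_sum: "ser_part u m (sum f S) = (\<Sum>x\<in>S. ser_part u m (f x))"
  by (induction S rule: infinite_finite_induct) (auto simp: ser_part_add)

lemma pdiffs_ser_filt:
  assumes "u \<in> U_loc" "pdiff_closed C" "f \<in> ser_filt C u m"
  shows "pdiffs \<delta> f \<in> ser_filt C u (m - wt u \<delta>)"
proof -
  have "wt u \<alpha> \<le> m - wt u \<delta>" if "coeff (pdiffs \<delta> f) \<alpha> \<noteq> 0" for \<alpha>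
  proof -
    have "coeff f (\<alpha> + \<delta>) \<noteq> 0" using that by auto
    then have "wt u (\<alpha> + \<delta>) \<le> m" using assms by (auto simp: mem_ser_filt simp del: wt_add)
    then show ?thesis by simp
  qed
  then show ?thesis using assms by (auto simp: mem_ser_filt pdiffs_closed)
qed

lemma pdiffs_ser_part: "ser_part u (m - wt u \<delta>) (pdiffs \<delta> f) = pdiffs \<delta> (ser_part u m f)"
  by (auto simp: mps_eq_iff)

lemma ser_part_above: "u \<in> U_loc \<Longrightarrow> f \<in> ser_filt C u m \<Longrightarrow> m < m' \<Longrightarrow> ser_part u m' f = 0"
  by (auto simp: mps_eq_iff mem_ser_filt)

lemma lookup_op_mult:
  assumes "finite K" "Poly_Mapping.keys A \<subseteq> K" "finite L" "Poly_Mapping.keys B \<subseteq> L"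
  shows "lkp (op_mult P A B) \<epsilon> = (\<Sum>\<beta>\<in>K. \<Sum>\<gamma>\<in>L. \<Sum>\<delta>\<in>{\<delta>\<in>mbox P \<beta>. \<beta> - \<delta> + \<gamma> = \<epsilon>}.
    of_nat (mbinom \<beta> \<delta>) * lkp A \<beta> * pdiffs \<delta> (lkp B \<gamma>))"
proof -
  let ?t = "\<lambda>\<beta> \<gamma>. \<Sum>\<delta>\<in>mbox P \<beta>. sgl (\<beta> - \<delta> + \<gamma>) (of_nat (mbinom \<beta> \<delta>) * lkp A \<beta> * pdiffs \<delta> (lkp B \<gamma>))"
  have "op_mult P A B = (\<Sum>\<beta>\<in>Poly_Mapping.keys A. \<Sum>\<gamma>\<in>Poly_Mapping.keys B. ?t \<beta> \<gamma>)"
    by (simp add: op_mult_def mbox_def mbinom_def)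
  also have "\<dots> = (\<Sum>\<beta>\<in>K. \<Sum>\<gamma>\<in>Poly_Mapping.keys B. ?t \<beta> \<gamma>)"
    by (rule sum.mono_neutral_left) (use assms in \<open>auto simp: in_keys_iff\<close>)
  also have "\<dots> = (\<Sum>\<beta>\<in>K. \<Sum>\<gamma>\<in>L. ?t \<beta> \<gamma>)"
    by (intro sum.cong refl sum.mono_neutral_left) (use assms in \<open>auto simp: in_keys_iff\<close>)
  also have "lkp \<dots> \<epsilon> = (\<Sum>\<beta>\<in>K. \<Sum>\<gamma>\<in>L. \<Sum>\<delta>\<in>mbox P \<beta>. if \<beta> - \<delta> + \<gamma> = \<epsilon> then
     of_nat (mbinom \<beta> \<delta>) * lkp A \<beta> * pdiffs \<delta> (lkp B \<gamma>) else 0)"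
    by (simp add: lookup_sum lookup_single when_def)
  finally show ?thesis by (simp add: sum.inter_filter)
qed

lemma ser_part_of_nat: "ser_part u m (of_nat k * f) = of_nat k * ser_part u m f"
  by (induction k) (auto simp: algebra_simps ser_part_add)

lemma ser_filt_of_nat:
  assumes "u \<in> U_loc" "cring (series_ring C)" "f \<in> ser_filt C u m"
  shows "of_nat k * f \<in> ser_filt C u m"
proof (induction k)
  case 0
  then show ?case using series_ring_closed(2)[OF assms(2)] by (simp add: ser_filt_def)
next
  case (Suc k)
  then show ?case using ser_filt_add[OF assms(1,2,3) Suc] by (simp add: distrib_right)
qed

lemma op_part_mult:
  assumes w: "w \<in> W_loc" and C: "cring (series_ring C)" "pdiff_closed C"
    and A: "A \<in> op_filt C w m" and B: "B \<in> op_filt C w m'"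
  shows "op_part w (m + m') (op_mult {} A B) = op_mult (pos_vars w) (op_part w m A) (op_part w m' B)"
    and "op_mult {} A B \<in> op_filt C w (m + m')"
proof -
  let ?u = "fst w" and ?v = "snd w"
  note u = fst_W_loc[OF w]
  let ?K = "Poly_Mapping.keys A" and ?L = "Poly_Mapping.keys B"
  let ?T = "\<lambda>\<beta> \<gamma> \<delta>. of_nat (mbinom \<beta> \<delta>) * lkp A \<beta> * pdiffs \<delta> (lkp B \<gamma>)"
  have kA: "Poly_Mapping.keys (op_part w m A) \<subseteq> ?K" and kB: "Poly_Mapping.keys (op_part w m' B) \<subseteq> ?L"
    by (auto simp: in_keys_iff)
  have fA: "lkp A \<beta> \<in> ser_filt C ?u (m - wt ?v \<beta>)" for \<beta> using A op_filt_coeffs[OF w] by blast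
  have fB: "lkp B \<beta> \<in> ser_filt C ?u (m' - wt ?v \<beta>)" for \<beta> using B op_filt_coeffs[OF w] by blast
  have T: "?T \<beta> \<gamma> \<delta> \<in> ser_filt C ?u (m - wt ?v \<beta> + (m' - wt ?v \<gamma> - wt ?u \<delta>))" for \<beta> \<gamma> \<delta>
    by (intro ser_filt_mult ser_filt_of_nat pdiffs_ser_filt fA fB u C)
  have s0: "wt ?u \<delta> + wt ?v \<delta> = (\<Sum>i\<in>UNIV. (?u $ i + ?v $ i) * real (\<delta> $ i))" for \<delta>
    by (simp add: wt_def sum.distrib[symmetric] algebra_simps)
  have uv: "?u $ i + ?v $ i \<ge> 0" for i using w by (auto simp: W_loc_def)
  have nn: "wt ?u \<delta> + wt ?v \<delta> \<ge> 0" for \<delta>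
    unfolding s0 using uv by (intro sum_nonneg mult_nonneg_nonneg) auto
  have zero: "wt ?u \<delta> + wt ?v \<delta> = 0 \<longleftrightarrow> (\<forall>i\<in>pos_vars w. \<delta> $ i = 0)" for \<delta>
  proof -
    have "wt ?u \<delta> + wt ?v \<delta> = 0 \<longleftrightarrow> (\<forall>i\<in>UNIV. (?u $ i + ?v $ i) * real (\<delta> $ i) = 0)"
      unfolding s0 using uv by (intro sum_nonneg_eq_0_iff) auto
    also have "\<dots> \<longleftrightarrow> (\<forall>i. \<not> ?u $ i + ?v $ i > 0 \<or> \<delta> $ i = 0)"
      using uv by (auto simp: less_le)
    finally show ?thesis by (auto simp: pos_vars_def)
  qed
  have wts: "m - wt ?v \<beta> + (m' - wt ?v \<gamma> - wt ?u \<delta>) = m + m' - wt ?v \<epsilon> - (wt ?u \<delta> + wt ?v \<delta>)"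
    if "\<delta> \<in> mbox {} \<beta>" "\<beta> - \<delta> + \<gamma> = \<epsilon>" for \<beta> \<gamma> \<delta> \<epsilon>
  proof -
    have "\<beta> = \<beta> - \<delta> + \<delta>" using that(1) by (auto simp: mbox_def vec_eq_iff)
    then have "wt ?v \<beta> = wt ?v (\<beta> - \<delta>) + wt ?v \<delta>" by (metis wt_add)
    then show ?thesis using that(2) by auto
  qed
  have main: "ser_part ?u (m + m' - wt ?v \<epsilon>) (?T \<beta> \<gamma> \<delta>) =
     (if \<delta> \<in> mbox (pos_vars w) \<beta> then
        of_nat (mbinom \<beta> \<delta>) * lkp (op_part w m A) \<beta> * pdiffs \<delta> (lkp (op_part w m' B) \<gamma>) else 0)"
    if d: "\<delta> \<in> mbox {} \<beta>" "\<beta> - \<delta> + \<gamma> = \<epsilon>" for \<beta> \<gamma> \<delta> \<epsilon>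
  proof (cases "\<delta> \<in> mbox (pos_vars w) \<beta>")
    case True
    then have 0: "wt ?u \<delta> + wt ?v \<delta> = 0" unfolding zero by (auto simp: mbox_def)
    have "ser_part ?u (m - wt ?v \<beta> + (m' - wt ?v \<gamma> - wt ?u \<delta>)) (?T \<beta> \<gamma> \<delta>)
       = ser_part ?u (m - wt ?v \<beta>) (of_nat (mbinom \<beta> \<delta>) * lkp A \<beta>) *
         ser_part ?u (m' - wt ?v \<gamma> - wt ?u \<delta>) (pdiffs \<delta> (lkp B \<gamma>))"
      by (rule ser_part_mult[where C = C]) (intro ser_filt_of_nat pdiffs_ser_filt fA fB u C)+
    then show ?thesis using True unfolding wts[OF d] 0 by (simp add: ser_part_of_nat pdiffs_ser_part)
  next
    case False
    then have "\<not> (\<forall>i\<in>pos_vars w. \<delta> $ i = 0)" using d(1) unfolding mbox_def by blast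
    then have "wt ?u \<delta> + wt ?v \<delta> \<noteq> 0" by (simp only: zero not_False_eq_True)
    then have "wt ?u \<delta> + wt ?v \<delta> > 0" using nn[of \<delta>] by linarith
    then have "m - wt ?v \<beta> + (m' - wt ?v \<gamma> - wt ?u \<delta>) < m + m' - wt ?v \<epsilon>"
      using wts[OF d] by linarith
    then have "ser_part ?u (m + m' - wt ?v \<epsilon>) (?T \<beta> \<gamma> \<delta>) = 0"
      by (rule ser_part_above[OF u T])
    then show ?thesis using False by simp
  qed
  show "op_part w (m + m') (op_mult {} A B) = op_mult (pos_vars w) (op_part w m A) (op_part w m' B)"
  proof (rule poly_mapping_eqI)
    fix \<epsilon>
    have "lkp (op_part w (m + m') (op_mult {} A B)) \<epsilon> =
      (\<Sum>\<beta>\<in>?K. \<Sum>\<gamma>\<in>?L. \<Sum>\<delta>\<in>{\<delta>\<in>mbox {} \<beta>. \<beta> - \<delta> + \<gamma> = \<epsilon>}. ser_part ?u (m + m' - wt ?v \<epsilon>) (?T \<beta> \<gamma> \<delta>))"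
      by (simp add: lookup_op_mult[of ?K _ ?L] ser_part_sum)
    also have "\<dots> = (\<Sum>\<beta>\<in>?K. \<Sum>\<gamma>\<in>?L. \<Sum>\<delta>\<in>{\<delta>\<in>mbox (pos_vars w) \<beta>. \<beta> - \<delta> + \<gamma> = \<epsilon>}.
        of_nat (mbinom \<beta> \<delta>) * lkp (op_part w m A) \<beta> * pdiffs \<delta> (lkp (op_part w m' B) \<gamma>))"
    proof (rule sum.cong[OF refl], rule sum.cong[OF refl])
      fix \<beta> \<gamma>
      let ?S = "{\<delta>\<in>mbox {} \<beta>. \<beta> - \<delta> + \<gamma> = \<epsilon>}" and ?S' = "{\<delta>\<in>mbox (pos_vars w) \<beta>. \<beta> - \<delta> + \<gamma> = \<epsilon>}"
      let ?g = "\<lambda>\<delta>. of_nat (mbinom \<beta> \<delta>) * lkp (op_part w m A) \<beta> * pdiffs \<delta> (lkp (op_part w m' B) \<gamma>)"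
      have sub: "?S' \<subseteq> ?S" by (auto simp: mbox_def)
      have g: "ser_part ?u (m + m' - wt ?v \<epsilon>) (?T \<beta> \<gamma> \<delta>) = (if \<delta> \<in> ?S' then ?g \<delta> else 0)"
        if "\<delta> \<in> ?S" for \<delta>
        using that main[of \<delta> \<beta> \<gamma> \<epsilon>] by (simp del: lookup_op_part)
      have "(\<Sum>\<delta>\<in>?S. ser_part ?u (m + m' - wt ?v \<epsilon>) (?T \<beta> \<gamma> \<delta>)) = (\<Sum>\<delta>\<in>?S. if \<delta> \<in> ?S' then ?g \<delta> else 0)"
        by (rule sum.cong[OF refl g])
      also have "\<dots> = (\<Sum>\<delta>\<in>?S \<inter> ?S'. ?g \<delta>)"
        by (rule sum.inter_restrict[symmetric]) simp
      also have "?S \<inter> ?S' = ?S'" using sub by blast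
      finally show "(\<Sum>\<delta>\<in>?S. ser_part ?u (m + m' - wt ?v \<epsilon>) (?T \<beta> \<gamma> \<delta>)) = (\<Sum>\<delta>\<in>?S'. ?g \<delta>)" .
    qed
    also have "\<dots> = lkp (op_mult (pos_vars w) (op_part w m A) (op_part w m' B)) \<epsilon>"
      using kA kB by (simp only: lookup_op_mult[OF finite_keys kA finite_keys kB])
    finally show "lkp (op_part w (m + m') (op_mult {} A B)) \<epsilon> =
      lkp (op_mult (pos_vars w) (op_part w m A) (op_part w m' B)) \<epsilon>" .
  qed
  have mono: "ser_filt C ?u a \<subseteq> ser_filt C ?u b" if "a \<le> b" for a b
    using that by (auto simp: ser_filt_def)
  have z: "0 \<in> ser_filt C ?u a" for a using series_ring_closed(2)[OF C(1)] by (simp add: ser_filt_def)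
  have sums: "(\<And>x. x \<in> S \<Longrightarrow> f x \<in> ser_filt C ?u a) \<Longrightarrow> sum f S \<in> ser_filt C ?u a"
    for f :: "nat^'a \<Rightarrow> _" and S a
    by (induction S rule: infinite_finite_induct)
       (simp_all add: ser_filt_add[OF u C(1)] z)
  show "op_mult {} A B \<in> op_filt C w (m + m')"
    unfolding op_filt_coeffs[OF w]
  proof
    fix \<epsilon>
    show "lkp (op_mult {} A B) \<epsilon> \<in> ser_filt C ?u (m + m' - wt ?v \<epsilon>)"
      unfolding lookup_op_mult[OF finite_keys order_refl finite_keys order_refl]
    proof (intro sums)
      fix \<beta> \<gamma> \<delta> assume "\<delta> \<in> {\<delta>\<in>mbox {} \<beta>. \<beta> - \<delta> + \<gamma> = \<epsilon>}"
      then have d: "\<delta> \<in> mbox {} \<beta>" "\<beta> - \<delta> + \<gamma> = \<epsilon>" by auto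
      show "?T \<beta> \<gamma> \<delta> \<in> ser_filt C ?u (m + m' - wt ?v \<epsilon>)"
        by (rule subsetD[OF mono T]) (use nn[of \<delta>] wts[OF d] in linarith)
    qed
  qed
qed

lemma op_filt_add:
  assumes "w \<in> W_loc" "cring (series_ring C)" "A \<in> op_filt C w m" "B \<in> op_filt C w m"
  shows "A + B \<in> op_filt C w m"
  using assms(3,4) ser_filt_add[OF fst_W_loc[OF assms(1)] assms(2)]
  unfolding op_filt_coeffs[OF assms(1)] by (simp add: lookup_add)

lemma op_part_0 [simp]: "op_part w m 0 = 0"
  by (rule poly_mapping_eqI) simp

lemma op_pieces:
  assumes w: "w \<in> W_loc" and C: "cring (series_ring C)"
  shows "0 \<in> op_part w m ` op_filt C w m"
    "a \<in> op_part w m ` op_filt C w m \<Longrightarrow> b \<in> op_part w m ` op_filt C w m \<Longrightarrow>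
      a + b \<in> op_part w m ` op_filt C w m"
proof -
  show "0 \<in> op_part w m ` op_filt C w m"
    by (rule image_eqI[of _ _ 0]) (auto simp: op_filt_def ops_def series_ring_closed[OF C])
  assume "a \<in> op_part w m ` op_filt C w m" "b \<in> op_part w m ` op_filt C w m"
  then obtain f g where "a = op_part w m f" "f \<in> op_filt C w m" "b = op_part w m g" "g \<in> op_filt C w m"
    by blast
  then show "a + b \<in> op_part w m ` op_filt C w m"
    using op_filt_add[OF w C] by (intro image_eqI[of _ _ "f + g"]) (auto simp: op_part_add)
qed

lemma ring_op_gr:
  assumes w: "w \<in> W_loc" and C: "cring (series_ring C)" and D: "pdiff_closed C"
  shows "ring (op_ring (pos_vars w) (op_gr C w))"
proof (rule ring_op_ring)
  note pc = op_pieces[OF w C]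
  let ?X = "\<lambda>m. op_part w m ` op_filt C w m"
  note cl = ops_closed[OF C D]
  show zero: "0 \<in> op_gr C w" unfolding op_gr_def by (rule graded_sum_0)
  show add: "a + b \<in> op_gr C w" if "a \<in> op_gr C w" "b \<in> op_gr C w" for a b
    using that unfolding op_gr_def by (intro graded_sum_add pc)
  have const: "a \<in> op_gr C w" if "a = 1 \<or> a = - 1" for a
    unfolding op_gr_def
  proof (rule graded_sum_piece[where X = ?X and m = 0], rule image_eqI[of _ _ a])
    show "a = op_part w 0 a" using that
      by (intro poly_mapping_eqI) (auto simp: lookup_one when_def mps_eq_iff)
    show "a \<in> op_filt C w 0" using that cl
      by (auto simp: mem_op_filt[OF w] lookup_one when_def op_wt_def split: if_splits)
  qed
  then show "1 \<in> op_gr C w" by simp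
  show "op_mult (pos_vars w) a b \<in> op_gr C w" if ab: "a \<in> op_gr C w" "b \<in> op_gr C w" for a b
    using ab(1) unfolding op_gr_def
  proof (induction rule: graded_sum_induct)
    case (piece m h)
    show ?case using ab(2) unfolding op_gr_def
    proof (induction rule: graded_sum_induct)
      case (piece m' h')
      obtain A B where AB: "A \<in> op_filt C w m" "h = op_part w m A" "B \<in> op_filt C w m'" "h' = op_part w m' B"
        using \<open>h \<in> ?X m\<close> piece by blast
      show ?case
        by (rule graded_sum_piece[where m = "m + m'"])
           (use op_part_mult[OF w C D AB(1,3)] AB(2,4) in \<open>simp add: image_iff bexI[of _ "op_mult {} A B"]\<close>)
    qed (auto simp: op_mult_add_right graded_sum_0 intro: graded_sum_add pc)
  qed (auto simp: op_mult_add_left graded_sum_0 intro: graded_sum_add pc)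
  then have *: "op_mult (pos_vars w) (- 1) f \<in> op_gr C w" if "f \<in> op_gr C w" for f
    using const[of "- 1"] that by blast
  have neg: "op_mult (pos_vars w) (- 1) f = - f" for f
  proof -
    have "op_mult (pos_vars w) (- 1) f + op_mult (pos_vars w) 1 f = 0"
      unfolding op_mult_add_left[symmetric] by simp
    then show ?thesis by (simp add: eq_neg_iff_add_eq_0)
  qed
  show "- f \<in> op_gr C w" if "f \<in> op_gr C w" for f using *[OF that] unfolding neg .
qed

subsection \<open>Explicit description of the graded rings\<close>

lemma ser_part_idem [simp]: "ser_part u m (ser_part u m f) = ser_part u m f"
  by (simp add: mps_eq_iff)

lemma ser_part_sum_id:
  assumes "finite V" "\<And>\<alpha>. coeff f \<alpha> \<noteq> 0 \<Longrightarrow> wt u \<alpha> \<in> V"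
  shows "(\<Sum>m\<in>V. ser_part u m f) = f"
  using assms by (auto simp: mps_eq_iff coeff_sum sum.delta)

lemma ser_part_in_piece:
  assumes "u \<in> U_loc" "ser_part u m f \<in> C"
  shows "ser_part u m f \<in> ser_part u m ` ser_filt C u m"
  by (rule image_eqI[of _ _ "ser_part u m f"]) (use assms in \<open>auto simp: mem_ser_filt\<close>)

lemma ser_gr_I:
  assumes u: "u \<in> U_loc" and C: "cring (series_ring C)" and "finite V"
    "\<And>\<alpha>. coeff f \<alpha> \<noteq> 0 \<Longrightarrow> wt u \<alpha> \<in> V" "\<And>m. ser_part u m f \<in> C"
  shows "f \<in> ser_gr C u"
proof -
  have "(\<Sum>m\<in>V. ser_part u m f) \<in> ser_gr C u"
    unfolding ser_gr_def
    by (intro graded_sum_sum ser_pieces[OF u C] graded_sum_piece[OF ser_part_in_piece[OF u assms(5)]])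
  then show ?thesis using ser_part_sum_id[OF assms(3), of f u] assms(4) by simp
qed

lemma cring_UNIV: "cring (series_ring UNIV)"
  by (rule cring_series_ring) auto

lemma finite_wt_bounded:
  assumes "u \<in> U_loc"
  shows "finite {wt u \<alpha> | \<alpha>. \<forall>i\<in>neg_vars u. \<alpha> $ i \<le> d}"
proof (rule finite_subset)
  show "{wt u \<alpha> | \<alpha>. \<forall>i\<in>neg_vars u. \<alpha> $ i \<le> d} \<subseteq> wt u ` {\<alpha>. \<forall>i. \<alpha> $ i \<le> d}"
  proof clarify
    fix \<alpha> assume d: "\<forall>i\<in>neg_vars u. \<alpha> $ i \<le> d"
    define \<beta> :: "nat^'a" where "\<beta> = (\<chi> i. if u $ i = 0 then 0 else \<alpha> $ i)"
    have "wt u \<alpha> = wt u \<beta>" unfolding wt_def \<beta>_def by (rule sum.cong) auto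
    moreover have "\<beta> $ i \<le> d" for i
      using d assms by (auto simp: \<beta>_def neg_vars_def U_loc_def less_le)
    ultimately show "wt u \<alpha> \<in> wt u ` {\<alpha>. \<forall>i. \<alpha> $ i \<le> d}" by (intro image_eqI[of _ _ \<beta>]) auto
  qed
qed (intro finite_imageI finite_le_multi)

lemma wt_le_component:
  assumes "u \<in> U_loc"
  shows "wt u \<alpha> \<le> u $ i * real (\<alpha> $ i)"
proof -
  have "wt u \<alpha> = u $ i * real (\<alpha> $ i) + (\<Sum>j\<in>UNIV - {i}. u $ j * real (\<alpha> $ j))"
    unfolding wt_def by (simp add: sum.remove[of _ i])
  also have "\<dots> \<le> u $ i * real (\<alpha> $ i)"
    using assms by (simp add: U_loc_def sum_nonpos mult_nonpos_nonneg)
  finally show ?thesis .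
qed

lemma ser_gr_UNIV:
  assumes u: "u \<in> U_loc"
  shows "ser_gr (UNIV :: ('n::finite, 'k::field) mps set) u = {f. \<exists>d. \<forall>\<alpha>. coeff f \<alpha> \<noteq> 0 \<longrightarrow> (\<forall>i\<in>neg_vars u. \<alpha> $ i \<le> d)}"
proof safe
  fix f :: "('n, 'k) mps" assume "f \<in> ser_gr UNIV u"
  then show "\<exists>d. \<forall>\<alpha>. coeff f \<alpha> \<noteq> 0 \<longrightarrow> (\<forall>i\<in>neg_vars u. \<alpha> $ i \<le> d)"
    unfolding ser_gr_def
  proof (induction rule: graded_sum_induct)
    case (piece m h)
    let ?d = "\<Sum>i\<in>UNIV. nat \<lceil>m / u $ i\<rceil>"
    have "\<alpha> $ i \<le> ?d" if "coeff h \<alpha> \<noteq> 0" "i \<in> neg_vars u" for \<alpha> i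
    proof -
      have "wt u \<alpha> = m" using that(1) piece by (auto split: if_splits)
      then have "real (\<alpha> $ i) \<le> m / u $ i"
        using wt_le_component[OF u, of \<alpha> i] that(2) by (simp add: neg_vars_def field_simps)
      then have "\<alpha> $ i \<le> nat \<lceil>m / u $ i\<rceil>" by linarith
      also have "\<dots> \<le> ?d" by (rule member_le_sum) auto
      finally show ?thesis .
    qed
    then show ?case by blast
  next
    case (add a b)
    then obtain d d' where "\<forall>\<alpha>. coeff a \<alpha> \<noteq> 0 \<longrightarrow> (\<forall>i\<in>neg_vars u. \<alpha> $ i \<le> d)"
      "\<forall>\<alpha>. coeff b \<alpha> \<noteq> 0 \<longrightarrow> (\<forall>i\<in>neg_vars u. \<alpha> $ i \<le> d')" by blast
    then show ?case
      by (intro exI[of _ "max d d'"]) (metis add_0 le_max_iff_disj plus_mps.rep_eq)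
  qed auto
next
  fix f :: "('n, 'k) mps" and d assume "\<forall>\<alpha>. coeff f \<alpha> \<noteq> 0 \<longrightarrow> (\<forall>i\<in>neg_vars u. \<alpha> $ i \<le> d)"
  then show "f \<in> ser_gr UNIV u"
    by (intro ser_gr_I[OF u cring_UNIV finite_wt_bounded[OF u, of d]]) auto
qed

lemma ser_part_conv: "f \<in> conv_series \<Longrightarrow> ser_part u m f \<in> conv_series"
proof -
  assume "f \<in> conv_series"
  then obtain r where r: "r > 0" "(\<lambda>\<alpha>. cmod (coeff f \<alpha>) * r ^ total_deg \<alpha>) summable_on UNIV"
    unfolding conv_series_def by blast
  have "(\<lambda>\<alpha>. cmod (coeff (ser_part u m f) \<alpha>) * r ^ total_deg \<alpha>) summable_on UNIV"
    by (rule summable_on_comparison_test[OF r(2)]) (use r(1) in auto)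
  then show ?thesis unfolding conv_series_def using r(1) by blast
qed

lemma ser_gr_conv_series:
  assumes u: "u \<in> U_loc"
  shows "ser_gr conv_series u =
    conv_series \<inter> {f. \<exists>d. \<forall>\<alpha>. coeff f \<alpha> \<noteq> 0 \<longrightarrow> (\<forall>i\<in>neg_vars u. \<alpha> $ i \<le> d)}"
proof safe
  fix f assume f: "f \<in> ser_gr conv_series u"
  then show "f \<in> conv_series"
    unfolding ser_gr_def
    by (induction rule: graded_sum_induct)
       (auto simp: series_ring_closed[OF conv_series_cring] ser_filt_def ser_part_conv)
  have "ser_part u m ` ser_filt conv_series u m \<subseteq> ser_part u m ` ser_filt UNIV u m" for m
    by (auto simp: ser_filt_def)
  then have "f \<in> ser_gr UNIV u" using f unfolding ser_gr_def by (rule graded_sum_mono)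
  then show "\<exists>d. \<forall>\<alpha>. coeff f \<alpha> \<noteq> 0 \<longrightarrow> (\<forall>i\<in>neg_vars u. \<alpha> $ i \<le> d)"
    using ser_gr_UNIV[OF u] by blast
next
  fix f d assume "f \<in> conv_series" "\<forall>\<alpha>. coeff f \<alpha> \<noteq> 0 \<longrightarrow> (\<forall>i\<in>neg_vars u. \<alpha> $ i \<le> d)"
  then show "f \<in> ser_gr conv_series u"
    by (intro ser_gr_I[OF u conv_series_cring finite_wt_bounded[OF u, of d]]) (auto simp: ser_part_conv)
qed

lemma mps_mult_eq_0:
  fixes g h :: "('n::finite, 'k::field) mps"
  assumes "coeff g 0 \<noteq> 0" "g * h = 0"
  shows "h = 0"
proof (rule ccontr)
  assume "h \<noteq> 0"
  then obtain \<alpha>1 where "coeff h \<alpha>1 \<noteq> 0" by (auto simp: mps_eq_iff)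
  then obtain \<alpha> where \<alpha>: "coeff h \<alpha> \<noteq> 0" "\<And>\<beta>. coeff h \<beta> \<noteq> 0 \<Longrightarrow> total_deg \<alpha> \<le> total_deg \<beta>"
    using ex_has_least_nat[of "\<lambda>\<alpha>. coeff h \<alpha> \<noteq> 0" \<alpha>1 total_deg] by blast
  have "coeff (g * h) \<alpha> = (\<Sum>(\<mu>, \<nu>)\<in>{(0, \<alpha>)}. coeff g \<mu> * coeff h \<nu>)"
    unfolding coeff_mult
  proof (rule sum.mono_neutral_right)
    show "\<forall>p\<in>{(\<mu>, \<nu>). \<mu> + \<nu> = \<alpha>} - {(0, \<alpha>)}. (case p of (\<mu>, \<nu>) \<Rightarrow> coeff g \<mu> * coeff h \<nu>) = 0"
    proof
      fix p assume "p \<in> {(\<mu>, \<nu>). \<mu> + \<nu> = \<alpha>} - {(0, \<alpha>)}"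
      then obtain \<mu> \<nu> where p: "p = (\<mu>, \<nu>)" "\<alpha> = \<mu> + \<nu>" "(\<mu>, \<nu>) \<noteq> (0, \<alpha>)"
        by (cases p) auto
      then have "\<mu> \<noteq> 0" by auto
      with p have *: "p = (\<mu>, \<nu>)" "\<alpha> = \<mu> + \<nu>" "\<mu> \<noteq> 0" by blast+
      from *(3) obtain i where "\<mu> $ i \<noteq> 0" by (auto simp: vec_eq_iff)
      then have "total_deg \<mu> > 0" unfolding total_deg_def by (intro sum_pos2[of UNIV i]) auto
      then have "total_deg \<nu> < total_deg \<alpha>" using * by simp
      then have "coeff h \<nu> = 0" using \<alpha>(2) by force
      then show "(case p of (\<mu>, \<nu>) \<Rightarrow> coeff g \<mu> * coeff h \<nu>) = 0" using * by simp
    qed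
  qed auto
  then show False using assms \<alpha>(1) by simp
qed

lemma ser_gr_loc_polys:
  assumes u: "u \<in> U_loc"
  shows "ser_gr (loc_polys :: ('n::finite, 'k::field) mps set) u =
    {h. \<exists>f\<in>polys. \<exists>g\<in>polys. (\<forall>\<alpha>. coeff g \<alpha> \<noteq> 0 \<longrightarrow> (\<forall>i\<in>neg_vars u. \<alpha> $ i = 0)) \<and>
      coeff g 0 \<noteq> 0 \<and> g * h = f}" (is "_ = ?R")
proof -
  have wt0: "wt u \<alpha> = 0 \<longleftrightarrow> (\<forall>i\<in>neg_vars u. \<alpha> $ i = 0)" for \<alpha>
  proof -
    have "- wt u \<alpha> = (\<Sum>i\<in>UNIV. - (u $ i) * real (\<alpha> $ i))" by (simp add: wt_def sum_negf)
    also have "\<dots> = 0 \<longleftrightarrow> (\<forall>i\<in>UNIV. - (u $ i) * real (\<alpha> $ i) = 0)"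
      using u by (intro sum_nonneg_eq_0_iff) (auto simp: U_loc_def mult_nonpos_nonneg)
    finally have "wt u \<alpha> = 0 \<longleftrightarrow> (\<forall>i. u $ i \<noteq> 0 \<longrightarrow> \<alpha> $ i = 0)" by auto
    moreover have "i \<in> neg_vars u \<longleftrightarrow> u $ i \<noteq> 0" for i
      using u by (simp add: neg_vars_def U_loc_def order_less_le)
    ultimately show ?thesis by (simp add: Ball_def)
  qed
  have le0: "wt u \<alpha> \<le> 0" for \<alpha>
    unfolding wt_def using u by (intro sum_nonpos) (auto simp: U_loc_def mult_nonpos_nonneg)
  have part_polys: "f \<in> polys \<Longrightarrow> ser_part u m f \<in> polys" for f :: "('n, 'k) mps" and m
    unfolding polys_def by (auto elim!: rev_finite_subset)
  have hom: "ser_part u 0 g = g \<longleftrightarrow> (\<forall>\<alpha>. coeff g \<alpha> \<noteq> 0 \<longrightarrow> (\<forall>i\<in>neg_vars u. \<alpha> $ i = 0))"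
    for g :: "('n, 'k) mps"
    by (simp only: mps_eq_iff coeff_ser_part wt0) metis
  have R: "h \<in> ?R \<longleftrightarrow> (\<exists>g\<in>polys. ser_part u 0 g = g \<and> coeff g 0 \<noteq> 0 \<and> g * h \<in> polys)" for h :: "('n, 'k) mps"
    unfolding hom by auto
  have UNIV_filt: "g \<in> ser_filt UNIV u 0" for g :: "('n, 'k) mps"
    using le0 by (auto simp: mem_ser_filt[OF u])
  show ?thesis
  proof safe
    fix h :: "('n, 'k) mps" assume "h \<in> ser_gr loc_polys u"
    then have "\<exists>g\<in>polys. ser_part u 0 g = g \<and> coeff g 0 \<noteq> 0 \<and> g * h \<in> polys"
      unfolding ser_gr_def
    proof (induction rule: graded_sum_induct)
      case zero
      show ?case by (intro bexI[of _ 1]) (auto simp: polys_closed mps_eq_iff)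
    next
      case (piece m h)
      then obtain k where k: "h = ser_part u m k" "k \<in> ser_filt loc_polys u m" by blast
      then obtain g where g: "g \<in> polys" "coeff g 0 \<noteq> 0" "g * k \<in> polys"
        by (auto simp: ser_filt_def loc_polys_def)
      have "k \<in> ser_filt UNIV u m" using k by (auto simp: ser_filt_def)
      then have "ser_part u 0 g * h = ser_part u m (g * k)"
        using ser_part_mult[OF u UNIV_filt, of k m g] k by simp
      then show ?case using g by (intro bexI[of _ "ser_part u 0 g"]) (auto simp: part_polys)
    next
      case (add a b)
      then obtain g g' where g: "g \<in> polys" "ser_part u 0 g = g" "coeff g 0 \<noteq> 0" "g * a \<in> polys"
        "g' \<in> polys" "ser_part u 0 g' = g'" "coeff g' 0 \<noteq> 0" "g' * b \<in> polys" by blast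
      have "ser_part u 0 (g * g') = g * g'"
        using ser_part_mult[OF u UNIV_filt UNIV_filt, of g g'] g by simp
      moreover have "g * g' * (a + b) = g' * (g * a) + g * (g' * b)" by (simp add: algebra_simps)
      then have "g * g' * (a + b) \<in> polys" using g by (simp add: polys_closed)
      ultimately show ?case using g by (intro bexI[of _ "g * g'"]) (auto simp: polys_closed)
    qed
    then show "\<exists>f\<in>polys. \<exists>g\<in>polys. (\<forall>\<alpha>. coeff g \<alpha> \<noteq> 0 \<longrightarrow> (\<forall>i\<in>neg_vars u. \<alpha> $ i = 0)) \<and>
      coeff g 0 \<noteq> 0 \<and> g * h = f" using R[of h] by simp
  next
    fix g h :: "('n, 'k) mps"
    assume g: "g \<in> polys" "\<forall>\<alpha>. coeff g \<alpha> \<noteq> 0 \<longrightarrow> (\<forall>i\<in>neg_vars u. \<alpha> $ i = 0)"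
      "coeff g 0 \<noteq> 0" "g * h \<in> polys"
    have gp: "ser_part u m (g * h) = g * ser_part u m h" for m
    proof (rule mps_eqI)
      fix \<gamma>
      have "coeff (ser_part u m (g * h)) \<gamma> =
          (\<Sum>(\<mu>, \<nu>) | \<mu> + \<nu> = \<gamma>. if wt u \<gamma> = m then coeff g \<mu> * coeff h \<nu> else 0)"
        by (simp add: coeff_mult)
      also have "\<dots> = (\<Sum>(\<mu>, \<nu>) | \<mu> + \<nu> = \<gamma>. coeff g \<mu> * coeff (ser_part u m h) \<nu>)"
      proof (rule sum.cong[OF refl], clarify)
        fix \<mu> \<nu> assume "\<gamma> = \<mu> + \<nu>"
        then show "(if wt u (\<mu> + \<nu>) = m then coeff g \<mu> * coeff h \<nu> else 0) = coeff g \<mu> * coeff (ser_part u m h) \<nu>"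
          using g(2) wt0[of \<mu>] by (cases "coeff g \<mu> = 0") auto
      qed
      also have "\<dots> = coeff (g * ser_part u m h) \<gamma>" by (simp only: coeff_mult)
      finally show "coeff (ser_part u m (g * h)) \<gamma> = coeff (g * ser_part u m h) \<gamma>" .
    qed
    let ?V = "wt u ` {\<alpha>. coeff (g * h) \<alpha> \<noteq> 0}"
    show "h \<in> ser_gr loc_polys u"
    proof (rule ser_gr_I[OF u loc_polys_cring, of ?V])
      show "finite ?V" using g(4) by (simp add: polys_def)
      show "ser_part u m h \<in> loc_polys" for m
        unfolding loc_polys_def using g gp[of m] part_polys[OF g(4), of m] by auto
      show "wt u \<alpha> \<in> ?V" if "coeff h \<alpha> \<noteq> 0" for \<alpha>
      proof (rule ccontr)
        assume "wt u \<alpha> \<notin> ?V"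
        then have "coeff (g * h) \<alpha>' = 0" if "wt u \<alpha>' = wt u \<alpha>" for \<alpha>'
          using that by (metis (mono_tags, lifting) image_eqI mem_Collect_eq)
        then have "ser_part u (wt u \<alpha>) (g * h) = 0" by (simp add: mps_eq_iff)
        then have "ser_part u (wt u \<alpha>) h = 0" using gp mps_mult_eq_0[OF g(3)] by metis
        then have "coeff (ser_part u (wt u \<alpha>) h) \<alpha> = 0" by simp
        then show False using that by simp
      qed
    qed
  qed
qed

lemma op_gr_coeffs:
  assumes w: "w \<in> W_loc" and C: "cring (series_ring C)"
  shows "op_gr C w = ops (ser_gr C (fst w))"
proof -
  note u = fst_W_loc[OF w]
  note pc = ser_pieces[OF u C] and pc' = op_pieces[OF w C]
  show ?thesis
  proof safe
    fix A assume "A \<in> op_gr C w"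
    then show "A \<in> ops (ser_gr C (fst w))"
      unfolding op_gr_def
    proof (induction rule: graded_sum_induct)
      case zero
      show ?case by (simp add: ops_def ser_gr_def graded_sum_0)
    next
      case (piece m h)
      then obtain B where "h = op_part w m B" "B \<in> op_filt C w m" by blast
      then show ?case unfolding ops_def ser_gr_def op_filt_coeffs[OF w]
        by (auto intro!: graded_sum_piece)
    next
      case (add a b)
      then show ?case unfolding ops_def ser_gr_def
        by (auto simp: lookup_add intro!: graded_sum_add[OF pc])
    qed
  next
    fix A assume A: "A \<in> ops (ser_gr C (fst w))"
    have s: "sgl \<beta> f \<in> op_gr C w" if "f \<in> ser_gr C (fst w)" for \<beta> f
      using that unfolding ser_gr_def
    proof (induction rule: graded_sum_induct)
      case zero
      show ?case by (simp add: op_gr_def graded_sum_0)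
    next
      case (piece m h)
      then obtain f where f: "h = ser_part (fst w) m f" "f \<in> ser_filt C (fst w) m" by blast
      have "sgl \<beta> h = op_part w (m + wt (snd w) \<beta>) (sgl \<beta> f)"
        by (rule poly_mapping_eqI) (simp add: lookup_single when_def f)
      moreover have "sgl \<beta> f \<in> op_filt C w (m + wt (snd w) \<beta>)"
        unfolding op_filt_coeffs[OF w] using f series_ring_closed(2)[OF C]
        by (simp add: lookup_single when_def ser_filt_def)
      ultimately show ?case unfolding op_gr_def by (intro graded_sum_piece) auto
    next
      case (add a b)
      then show ?case unfolding op_gr_def single_add by (intro graded_sum_add pc')
    qed
    have "(\<Sum>\<beta>\<in>Poly_Mapping.keys A. sgl \<beta> (lkp A \<beta>)) \<in> op_gr C w"
      unfolding op_gr_def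
      by (intro graded_sum_sum pc' s[unfolded op_gr_def]) (use A in \<open>auto simp: ops_def\<close>)
    then show "A \<in> op_gr C w" by (simp add: sum_sgl)
  qed
qed

end

theory Submission
  imports Defs "HOL-Computational_Algebra.Primes"
begin

text \<open>
  Two weights with the same graded ring are equivalent iff their initial ideals agree. So it has to be
  shown that agreement of the initial ideals over the small coefficient ring \<open>C\<close> (localised
  polynomials or convergent series) is the same as agreement over all formal power series.

  Ideals are replaced by modules. A left ideal is stable under the derivations, so the left ideal it
  generates over the power series is merely its span over the power series, and initial ideals are
  spans over the graded coefficient ring (\<open>gen_left_ideal_eq_lspan\<close>, \<open>op_in_ideal_eq_in_module\<close>); an
  ideal of series consists of operators of order \<open>0\<close> (\<open>in_module_sgl\<close>). All four claims thus become one
  statement \<open>in_module_eq_iff\<close> about a \<open>C\<close>-submodule \<open>L\<close> of the free module of operators and its span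
  \<open>M\<close> over the power series.

  Two facts carry the proof. Submodules of free modules of finite rank over the power series are
  closed in the topology defined by the powers of the maximal ideal (\<open>lspan_closed\<close>). And \<open>L\<close>
  consists of all vectors of \<open>M\<close> with entries in \<open>C\<close> (the predicate \<open>descent\<close>, a part of the
  faithful flatness of the power series over \<open>C\<close>). Together they show that every step of the
  filtration of \<open>M\<close> is spanned by the same step of the filtration of \<open>L\<close> (\<open>lspan_filt\<close>). Hence the
  initial module of \<open>M\<close> is spanned by the one of \<open>L\<close> (\<open>in_module_hat\<close>), while descent, applied to the
  span of the initial forms, recovers the initial module of \<open>L\<close> from the one of \<open>M\<close>
  (\<open>in_module_descent\<close>).

  Closedness and the convergent case of descent both come from one division algorithm (\<open>division\<close>).
  Its divisors are finitely many by Dickson's lemma. It determines the coefficients of the quotients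
  by a triangular recursion, and the recursion yields an a priori estimate in the norms
  \<open>\<Sum>\<^sub>j \<bar>c\<^sub>j\<bar> / j\<^sup>t\<close>, in which the leading terms dominate for large \<open>t\<close>; so quotients of convergent
  data converge (\<open>descent_conv_series\<close>). For localised polynomials descent is Krull's intersection
  theorem, proved following Perdry from the Noetherianity of a Rees module (\<open>rees_stationary\<close>,
  \<open>descent_loc_polys\<close>).
\<close>

section \<open>Modules of vectors of power series\<close>

text \<open>
  An operator is regarded as the vector of its coefficients. Multiplying it by a coefficient from the
  left acts entrywise, for every choice of the variables that commute with the coefficients
  (see \<open>op_mult_const\<close>).
\<close>

definition scl :: "('n::finite, 'k::field) mps \<Rightarrow> ('n, 'k) dop \<Rightarrow> ('n, 'k) dop" (infixr "\<odot>" 70)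
  where "a \<odot> F = sgl 0 a * F"

lemma lookup_scl [simp]: "lkp (a \<odot> F) \<beta> = a * lkp F \<beta>"
  by (simp add: scl_def lookup_sgl0_mult)

lemma scl_simps [simp]: "1 \<odot> F = F" "0 \<odot> F = 0" "a \<odot> 0 = 0" "(- a) \<odot> F = - (a \<odot> F)"
  by (rule poly_mapping_eqI, simp)+

lemma scl_algebra:
  "(a * b) \<odot> F = a \<odot> b \<odot> F" "(a + b) \<odot> F = a \<odot> F + b \<odot> F" "(a - b) \<odot> F = a \<odot> F - b \<odot> F"
  "a \<odot> (F + G) = a \<odot> F + a \<odot> G" "a \<odot> (F - G) = a \<odot> F - a \<odot> G"
  by (rule poly_mapping_eqI, simp add: lookup_add lookup_minus algebra_simps)+

inductive_set lspan :: "('n::finite, 'k::field) mps set \<Rightarrow> ('n, 'k) dop set \<Rightarrow> ('n, 'k) dop set"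
  for C S where
  lspan_0: "0 \<in> lspan C S"
| lspan_step: "a \<in> C \<Longrightarrow> f \<in> S \<Longrightarrow> g \<in> lspan C S \<Longrightarrow> a \<odot> f + g \<in> lspan C S"

definition submod :: "('n::finite, 'k::field) mps set \<Rightarrow> ('n, 'k) dop set \<Rightarrow> bool"
  where "submod C L \<longleftrightarrow> 0 \<in> L \<and> (\<forall>f\<in>L. \<forall>g\<in>L. f + g \<in> L) \<and> (\<forall>a\<in>C. \<forall>f\<in>L. a \<odot> f \<in> L)"

lemma submodD:
  assumes "submod C L"
  shows "0 \<in> L" "f \<in> L \<Longrightarrow> g \<in> L \<Longrightarrow> f + g \<in> L" "a \<in> C \<Longrightarrow> f \<in> L \<Longrightarrow> a \<odot> f \<in> L"
  using assms by (auto simp: submod_def)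

lemma submod_sum: "submod C L \<Longrightarrow> (\<And>x. x \<in> S \<Longrightarrow> f x \<in> L) \<Longrightarrow> sum f S \<in> L"
  by (induction S rule: infinite_finite_induct) (auto dest: submodD)

lemma submod_minus:
  assumes "submod C L" "- 1 \<in> C"
  shows "f \<in> L \<Longrightarrow> - f \<in> L" "f \<in> L \<Longrightarrow> g \<in> L \<Longrightarrow> f - g \<in> L"
proof -
  have n: "- f \<in> L" if "f \<in> L" for f
    using submodD(3)[OF assms that] by simp
  show "f \<in> L \<Longrightarrow> - f \<in> L" "f \<in> L \<Longrightarrow> g \<in> L \<Longrightarrow> f - g \<in> L"
    using n submodD(2)[OF assms(1), of f "- g"] by auto
qed

lemma submod_mono: "submod C L \<Longrightarrow> D \<subseteq> C \<Longrightarrow> submod D L"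
  by (auto simp: submod_def)

lemma submod_Int: "submod C L \<Longrightarrow> submod C L' \<Longrightarrow> submod C (L \<inter> L')"
  by (auto simp: submod_def)

lemma lspan_least: "submod C L \<Longrightarrow> S \<subseteq> L \<Longrightarrow> lspan C S \<subseteq> L"
proof
  fix f assume "submod C L" "S \<subseteq> L" "f \<in> lspan C S"
  from this(3,1,2) show "f \<in> L" by induction (auto dest: submodD)
qed

lemma lspan_mono: "C \<subseteq> D \<Longrightarrow> S \<subseteq> T \<Longrightarrow> lspan C S \<subseteq> lspan D T"
proof
  fix f assume "C \<subseteq> D" "S \<subseteq> T" "f \<in> lspan C S"
  from this(3,1,2) show "f \<in> lspan D T" by induction (auto intro: lspan.intros)
qed

lemma lspan_add: "f \<in> lspan C S \<Longrightarrow> g \<in> lspan C S \<Longrightarrow> f + g \<in> lspan C S"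
  by (induction rule: lspan.induct) (auto simp: add.assoc intro: lspan.intros)

lemma lspan_gen: "a \<in> C \<Longrightarrow> f \<in> S \<Longrightarrow> a \<odot> f \<in> lspan C S"
  using lspan_step[OF _ _ lspan_0] by fastforce

lemma lspan_base: "1 \<in> C \<Longrightarrow> f \<in> S \<Longrightarrow> f \<in> lspan C S"
  using lspan_gen[of 1 C f S] by simp

lemma lspan_sum: "(\<And>x. x \<in> T \<Longrightarrow> f x \<in> lspan C S) \<Longrightarrow> sum f T \<in> lspan C S"
  by (induction T rule: infinite_finite_induct) (auto intro: lspan_add lspan_0)

lemma submod_lspan:
  assumes "\<And>a b. a \<in> C \<Longrightarrow> b \<in> C \<Longrightarrow> a * b \<in> C"
  shows "submod C (lspan C S)"
proof -
  have "a \<odot> f \<in> lspan C S" if "a \<in> C" "f \<in> lspan C S" for a f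
    using that(2)
  proof induction
    case (lspan_step b f g)
    then show ?case
      using lspan.lspan_step[OF assms[OF that(1) lspan_step(1)], of f S "a \<odot> g"]
      by (simp add: scl_algebra)
  qed (auto intro: lspan.intros)
  then show ?thesis by (auto simp: submod_def lspan_0 lspan_add)
qed

lemmas submod_lspan_UNIV = submod_lspan[of UNIV, simplified]

lemma lspan_finite:
  assumes "f \<in> lspan C L"
  shows "\<exists>T. finite T \<and> T \<subseteq> L \<and> f \<in> lspan C T"
  using assms
proof induction
  case lspan_0
  show ?case by (intro exI[of _ "{}"]) (auto intro: lspan.intros)
next
  case (lspan_step a f g)
  then obtain T where "finite T" "T \<subseteq> L" "g \<in> lspan C T" by blast
  moreover from this have "g \<in> lspan C (insert f T)" using lspan_mono[of C C T "insert f T"] by auto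
  ultimately show ?case using lspan_step by (intro exI[of _ "insert f T"]) (auto intro: lspan.intros)
qed

definition supp_in :: "(nat^'n) set \<Rightarrow> ('n::finite, 'k::field) dop set"
  where "supp_in B = {F. \<forall>\<beta>. \<beta> \<notin> B \<longrightarrow> lkp F \<beta> = 0}"

lemma submod_supp_in: "submod C (supp_in B)"
  by (auto simp: submod_def supp_in_def lookup_add)

text \<open>
  This reduces statements about spans to free modules of finite rank, where Dickson's lemma yields
  finitely many leading terms.
\<close>

lemma lspan_finite_supp:
  assumes "f \<in> lspan C L"
  shows "\<exists>B. finite B \<and> f \<in> lspan C (L \<inter> supp_in B)"
proof -
  obtain T where T: "finite T" "T \<subseteq> L" "f \<in> lspan C T" using lspan_finite[OF assms] by blast
  let ?B = "\<Union>(Poly_Mapping.keys ` T)"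
  have "T \<subseteq> L \<inter> supp_in ?B" using T(2) by (auto simp: supp_in_def in_keys_iff)
  then show ?thesis using T lspan_mono[of C C T "L \<inter> supp_in ?B"]
    by (intro exI[of _ ?B]) auto
qed

lemma submod_ops: "cring (series_ring C) \<Longrightarrow> submod C (ops C)"
  by (auto simp: submod_def ops_def lookup_add series_ring_closed)

section \<open>The order filtration\<close>

text \<open>
  The powers of the maximal ideal of the ring of power series, and the corresponding submodules of
  vectors.
\<close>

definition mpow :: "nat \<Rightarrow> ('n::finite, 'k::field) mps set"
  where "mpow N = {a. \<forall>\<alpha>. coeff a \<alpha> \<noteq> 0 \<longrightarrow> N \<le> total_deg \<alpha>}"

definition vpow :: "nat \<Rightarrow> ('n::finite, 'k::field) dop set"
  where "vpow N = {F. \<forall>\<beta>. lkp F \<beta> \<in> mpow N}"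

lemma coeff_mult_nonzero:
  assumes "coeff (f * g) \<gamma> \<noteq> 0"
  obtains \<alpha> \<beta> where "\<alpha> + \<beta> = \<gamma>" "coeff f \<alpha> \<noteq> 0" "coeff g \<beta> \<noteq> 0"
proof -
  from assms have "\<exists>p\<in>{(\<alpha>, \<beta>). \<alpha> + \<beta> = \<gamma>}. (case p of (\<alpha>, \<beta>) \<Rightarrow> coeff f \<alpha> * coeff g \<beta>) \<noteq> 0"
    unfolding coeff_mult by (meson sum.neutral)
  then show thesis using that by fastforce
qed

lemma mpow_mult: "a \<in> mpow M \<Longrightarrow> b \<in> mpow N \<Longrightarrow> a * b \<in> mpow (M + N)"
  unfolding mpow_def by (auto elim!: coeff_mult_nonzero) (metis add_mono)

lemma mpow_0 [simp]: "mpow 0 = UNIV" and zero_mpow [simp]: "0 \<in> mpow N"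
  by (auto simp: mpow_def)

lemma mpow_add: "a \<in> mpow N \<Longrightarrow> b \<in> mpow N \<Longrightarrow> a + b \<in> mpow N"
  by (auto simp: mpow_def) (metis add.right_neutral)

lemma mpow_antimono: "M \<le> N \<Longrightarrow> mpow N \<subseteq> mpow M"
  by (force simp: mpow_def)

lemma mpow_mult_left: "b \<in> mpow N \<Longrightarrow> a * b \<in> mpow N"
  using mpow_mult[of a 0 b N] by simp

lemma submod_vpow: "submod UNIV (vpow N)"
  by (auto simp: submod_def vpow_def lookup_add mpow_add mpow_mult_left)

lemma scl_vpow: "a \<in> mpow N \<Longrightarrow> a \<odot> F \<in> vpow N"
  using mpow_mult[of a N _ 0] by (auto simp: vpow_def)

lemma vpow_coeff: "F \<in> vpow N \<Longrightarrow> total_deg \<alpha> < N \<Longrightarrow> coeff (lkp F \<beta>) \<alpha> = 0"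
  by (force simp: vpow_def mpow_def)

lemma finite_total_deg: "finite {\<alpha> :: nat^'n::finite. total_deg \<alpha> < N}"
proof (rule finite_subset[OF _ finite_le_multi[of "\<lambda>_. N"]])
  have "\<alpha> $ i \<le> total_deg \<alpha>" for \<alpha> :: "nat^'n" and i
    unfolding total_deg_def by (rule member_le_sum) auto
  then show "{\<alpha> :: nat^'n. total_deg \<alpha> < N} \<subseteq> {\<alpha>. \<forall>i. \<alpha> $ i \<le> N}"
    by (blast intro: le_trans less_imp_le)
qed

lift_definition trunc :: "nat \<Rightarrow> ('n::finite, 'k::field) mps \<Rightarrow> ('n, 'k) mps"
  is "\<lambda>N f \<alpha>. if total_deg \<alpha> < N then f \<alpha> else 0" .

lemmas coeff_trunc [simp] = trunc.rep_eq

lemma trunc_0 [simp]: "trunc N 0 = 0"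
  by (simp add: mps_eq_iff)

lemma trunc_polys: "trunc N f \<in> polys"
  unfolding polys_def by (rule CollectI, rule finite_subset[OF _ finite_total_deg[of N]]) auto

lemma diff_trunc: "f - trunc N f \<in> mpow N"
  by (auto simp: mpow_def)

definition vtrunc :: "nat \<Rightarrow> ('n::finite, 'k::field) dop \<Rightarrow> ('n, 'k) dop"
  where "vtrunc N F = mapd (trunc N) F"

lemma lookup_vtrunc [simp]: "lkp (vtrunc N F) \<beta> = trunc N (lkp F \<beta>)"
  by (simp add: vtrunc_def)

lemma diff_vtrunc: "F - vtrunc N F \<in> vpow N"
  by (auto simp: vpow_def lookup_minus diff_trunc)

text \<open>
  Cutting off the coefficients of a combination over the power series turns it into a combination
  over \<open>C\<close>. The error is recorded as a combination of \<open>L\<close> with coefficients of order at least \<open>N\<close>,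
  which says more than that the error has order at least \<open>N\<close>.
\<close>

lemma lspan_approx:
  assumes L: "submod C L" and C: "polys \<subseteq> C" and F: "F \<in> lspan UNIV L"
  shows "\<exists>h\<in>L. F - h \<in> lspan (mpow N) L"
  using F
proof induction
  case lspan_0
  then show ?case using submodD(1)[OF L] by (intro bexI[of _ 0]) (auto intro: lspan.intros)
next
  case (lspan_step a f g)
  then obtain h where h: "h \<in> L" "g - h \<in> lspan (mpow N) L" by blast
  have "a \<odot> f + g - (trunc N a \<odot> f + h) = (a - trunc N a) \<odot> f + (g - h)"
    by (simp only: scl_algebra) (simp add: algebra_simps)
  moreover have "\<dots> \<in> lspan (mpow N) L"
    by (intro lspan.intros diff_trunc lspan_step(2) h)
  ultimately have "a \<odot> f + g - (trunc N a \<odot> f + h) \<in> lspan (mpow N) L" by (simp only:)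
  moreover have "trunc N a \<odot> f + h \<in> L"
    using lspan_step(2) h(1) trunc_polys C by (intro submodD[OF L]) auto
  ultimately show ?case by (rule rev_bexI[rotated])
qed

lemma lspan_mpow: "lspan (mpow N) L \<subseteq> vpow N"
proof
  fix f assume "f \<in> lspan (mpow N) L"
  then show "f \<in> vpow N"
    by induction (auto intro: submodD[OF submod_vpow] scl_vpow)
qed

lift_definition mterm :: "nat^'n::finite \<Rightarrow> 'k::field \<Rightarrow> ('n, 'k) mps"
  is "\<lambda>\<gamma> c \<alpha>. if \<alpha> = \<gamma> then c else 0" .

lemmas coeff_mterm [simp] = mterm.rep_eq

lemma coeff_mterm_mult:
  "coeff (mterm \<gamma> c * f) \<alpha> = (if \<gamma> \<le> \<alpha> then c * coeff f (\<alpha> - \<gamma>) else 0)"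
proof -
  have "coeff (mterm \<gamma> c * f) \<alpha> = (\<Sum>(\<mu>, \<nu>)\<in>{(\<mu>, \<nu>). \<mu> + \<nu> = \<alpha> \<and> \<mu> = \<gamma>}. c * coeff f \<nu>)"
    unfolding coeff_mult
    by (intro sum.mono_neutral_cong_right) (auto split: if_splits)
  also have "\<dots> = (if \<gamma> \<le> \<alpha> then c * coeff f (\<alpha> - \<gamma>) else 0)"
  proof (cases "\<gamma> \<le> \<alpha>")
    case True
    then have "{(\<mu>, \<nu>). \<mu> + \<nu> = \<alpha> \<and> \<mu> = \<gamma>} = {(\<gamma>, \<alpha> - \<gamma>)}"
      by (auto simp: vec_eq_iff less_eq_vec_def) (metis add_diff_cancel_left')
    then show ?thesis using True by simp
  next
    case False
    then have *: "{(\<mu>, \<nu>). \<mu> + \<nu> = \<alpha> \<and> \<mu> = \<gamma>} = {}" by (auto simp: less_eq_vec_def)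
    show ?thesis unfolding * using False by simp
  qed
  finally show ?thesis .
qed

lemma mterm_polys: "mterm \<gamma> c \<in> polys"
  unfolding polys_def by (rule CollectI, rule finite_subset[of _ "{\<gamma>}"]) auto

lemma mterm_mpow: "N \<le> total_deg \<gamma> \<Longrightarrow> mterm \<gamma> c \<in> mpow N"
  by (auto simp: mpow_def)

section \<open>Dickson's lemma\<close>

lemma monotone_subsequence:
  fixes s :: "nat \<Rightarrow> 'a" and f :: "'i \<Rightarrow> 'a \<Rightarrow> nat"
  assumes "finite I"
  shows "\<exists>r. strict_mono r \<and> (\<forall>i\<in>I. mono (\<lambda>n::nat. f i (s (r n))))"
  using assms
proof induction
  case empty
  show ?case by (rule exI[of _ id]) (auto simp: strict_mono_def)
next
  case (insert i I)
  then obtain r where r: "strict_mono r" "\<forall>i\<in>I. mono (\<lambda>n::nat. f i (s (r n)))" by blast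
  obtain q where q: "strict_mono q" "monoseq (\<lambda>n. f i (s (r (q n))))"
    using seq_monosub[of "\<lambda>n. f i (s (r n))"] by blast
  have "\<exists>p::nat \<Rightarrow> nat. strict_mono p \<and> mono (\<lambda>n. f i (s (r (q (p n)))))"
  proof (cases "mono (\<lambda>n. f i (s (r (q n))))")
    case True
    then show ?thesis by (intro exI[of _ "\<lambda>n. n"]) (auto simp: strict_mono_def)
  next
    case False
    then have dec: "decseq (\<lambda>n. f i (s (r (q n))))"
      using q(2) unfolding monoseq_iff incseq_def mono_def by blast
    define m where "m = (LEAST m. \<exists>n. m = f i (s (r (q n))))"
    have "\<exists>n. m = f i (s (r (q n)))" unfolding m_def by (rule LeastI_ex) blast
    then obtain n0 where n0: "m = f i (s (r (q n0)))" ..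
    have ge: "m \<le> f i (s (r (q n)))" for n unfolding m_def by (rule Least_le) blast
    have "f i (s (r (q (n + n0)))) = m" for n
      using decseqD[OF dec, of n0 "n + n0"] ge[of "n + n0"] n0 by simp
    then show ?thesis
      by (intro exI[of _ "\<lambda>n. n + n0"]) (auto simp: strict_mono_def mono_def)
  qed
  then obtain p :: "nat \<Rightarrow> nat" where p: "strict_mono p" "mono (\<lambda>n. f i (s (r (q (p n)))))" by blast
  have qp: "strict_mono (\<lambda>n. q (p n))" using q(1) p(1) by (auto simp: strict_mono_def)
  have "mono (\<lambda>n. f j (s (r (q (p n)))))" if "j \<in> I" for j
    using r(2) that strict_mono_mono[OF qp] by (fastforce simp: mono_def)
  then show ?case using p(2) r(1) qp
    by (intro exI[of _ "\<lambda>n. r (q (p n))"]) (auto simp: strict_mono_def)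
qed

text \<open>
  Otherwise one could choose a sequence in \<open>E\<close> none of whose members lies above an earlier one, in
  contradiction to a subsequence along which all \<open>f i\<close> increase.
\<close>

lemma dickson:
  fixes f :: "'i \<Rightarrow> 'a \<Rightarrow> nat"
  assumes I: "finite I"
  shows "\<exists>G. finite G \<and> G \<subseteq> E \<and> (\<forall>e\<in>E. \<exists>g\<in>G. \<forall>i\<in>I. f i g \<le> f i e)"
proof (rule ccontr)
  assume neg: "\<not> ?thesis"
  have "\<exists>e. e \<in> E \<and> (\<forall>g\<in>G. \<exists>i\<in>I. \<not> f i g \<le> f i e)" if "finite G" "G \<subseteq> E" for G
  proof (rule ccontr)
    assume "\<nexists>e. e \<in> E \<and> (\<forall>g\<in>G. \<exists>i\<in>I. \<not> f i g \<le> f i e)"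
    then have "\<forall>e\<in>E. \<exists>g\<in>G. \<forall>i\<in>I. f i g \<le> f i e" by blast
    then show False using neg that by (metis (no_types, lifting))
  qed
  then obtain e where e: "\<And>G. finite G \<Longrightarrow> G \<subseteq> E \<Longrightarrow> e G \<in> E \<and> (\<forall>g\<in>G. \<exists>i\<in>I. \<not> f i g \<le> f i (e G))"
    by metis
  define s where "s = rec_nat {} (\<lambda>_ G. insert (e G) G)"
  have s: "s 0 = {}" "s (Suc n) = insert (e (s n)) (s n)" for n by (simp_all add: s_def)
  have fs: "finite (s n) \<and> s n \<subseteq> E" for n by (induction n) (auto simp: s e)
  have mem: "e (s m) \<in> s n" if "m < n" for m n using that
    by (induction n) (auto simp: s less_Suc_eq)
  obtain r where r: "strict_mono r" "\<forall>i\<in>I. mono (\<lambda>n::nat. f i (e (s (r n))))"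
    using monotone_subsequence[OF I, of f "\<lambda>n. e (s n)"] by blast
  have "e (s (r 0)) \<in> s (r 1)" using r(1) by (intro mem) (auto simp: strict_mono_def)
  then obtain i where "i \<in> I" "\<not> f i (e (s (r 0))) \<le> f i (e (s (r 1)))"
    using e[of "s (r 1)"] fs by blast
  then show False using r(2) by (auto simp: mono_def)
qed

section \<open>Ordering the exponents by products of primes\<close>

text \<open>
  The term \<open>x\<^sup>\<alpha> \<partial>\<^sup>\<beta>\<close> is encoded by a number with one prime for every \<open>x\<^sub>i\<close> and for every \<open>\<partial>\<^sub>i\<close>. By unique
  factorisation the encoding is injective, and multiplication by \<open>x\<^sup>\<gamma>\<close> multiplies codes by a constant
  factor. So comparing codes is a monomial ordering of order type \<open>\<omega>\<close> on the terms of all vectors,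
  and \<open>1 / j\<^sup>t\<close> is a weight that is multiplicative in the series variables.
\<close>

definition var_prime :: "'n::finite + 'n \<Rightarrow> nat"
  where "var_prime = (SOME p. inj p \<and> (\<forall>i. prime (p i)))"

lemma var_prime:
  fixes i :: "'n::finite + 'n"
  shows "inj (var_prime :: 'n + 'n \<Rightarrow> nat)" "prime (var_prime i)"
proof -
  obtain P where P: "finite P" "card P = card (UNIV :: ('n + 'n) set)" "P \<subseteq> {p::nat. prime p}"
    using infinite_arbitrarily_large[OF primes_infinite] by metis
  then obtain h where "bij_betw h (UNIV :: ('n + 'n) set) P"
    using finite_same_card_bij[of "UNIV :: ('n + 'n) set" P] by auto
  then have "inj h \<and> (\<forall>i. prime (h i))" using P(3) by (auto simp: bij_betw_def)
  then have "inj (var_prime :: 'n + 'n \<Rightarrow> nat) \<and> (\<forall>i :: 'n + 'n. prime (var_prime i))"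
    unfolding var_prime_def by (rule someI[where P = "\<lambda>p. inj p \<and> (\<forall>i. prime (p i))"])
  then show "inj (var_prime :: 'n + 'n \<Rightarrow> nat)" "prime (var_prime i)" by auto
qed

definition ecode :: "nat^'n::finite \<Rightarrow> nat"
  where "ecode \<alpha> = (\<Prod>i\<in>UNIV. var_prime (Inl i) ^ (\<alpha> $ i))"

definition code :: "nat^'n::finite \<Rightarrow> nat^'n \<Rightarrow> nat"
  where "code \<alpha> \<beta> = ecode \<alpha> * (\<Prod>i\<in>UNIV. var_prime (Inr i) ^ (\<beta> $ i))"

lemma ecode_add: "ecode (\<alpha> + \<beta>) = ecode \<alpha> * ecode \<beta>"
  by (simp add: ecode_def power_add prod.distrib)

lemma code_add: "code (\<gamma> + \<alpha>) \<beta> = ecode \<gamma> * code \<alpha> \<beta>"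
  by (simp add: code_def ecode_add)

lemma code_inj:
  fixes \<alpha> \<beta> :: "nat^'a::finite"
  shows "code \<alpha> \<beta> = code \<alpha>' \<beta>' \<longleftrightarrow> \<alpha> = \<alpha>' \<and> \<beta> = \<beta>'"
proof
  have inj: "inj (var_prime :: 'a + 'a \<Rightarrow> nat)" by (rule var_prime)
  define ex where "ex \<alpha> \<beta> = case_sum (vec_nth \<alpha>) (vec_nth \<beta>)" for \<alpha> \<beta> :: "nat^'a"
  have code: "code \<alpha> \<beta> = (\<Prod>p\<in>range (var_prime :: 'a + 'a \<Rightarrow> nat). p ^ ex \<alpha> \<beta> (inv_into UNIV var_prime p))" for \<alpha> \<beta>
  proof -
    have "(\<Prod>p\<in>range (var_prime :: 'a + 'a \<Rightarrow> nat). p ^ ex \<alpha> \<beta> (inv_into UNIV var_prime p)) = (\<Prod>x\<in>UNIV. var_prime x ^ ex \<alpha> \<beta> x)"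
      by (subst prod.reindex[OF inj]) (simp add: inv_f_f[OF inj])
    also have "\<dots> = (\<Prod>x\<in>Inl ` UNIV \<union> Inr ` UNIV. var_prime x ^ ex \<alpha> \<beta> x)"
      by (rule prod.cong) (auto simp: UNIV_sum)
    also have "\<dots> = code \<alpha> \<beta>"
      by (subst prod.union_disjoint) (auto simp: code_def ecode_def ex_def prod.reindex)
    finally show ?thesis by simp
  qed
  assume eq: "code \<alpha> \<beta> = code \<alpha>' \<beta>'"
  have "ex \<alpha> \<beta> x = multiplicity (var_prime x) (code \<alpha> \<beta>)" for \<alpha> \<beta> x
    unfolding code
    by (subst multiplicity_prod_prime_powers) (auto simp: var_prime inv_f_f[OF inj])
  then have "ex \<alpha> \<beta> x = ex \<alpha>' \<beta>' x" for x using eq by simp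
  from this[of "Inl i" for i] this[of "Inr i" for i] show "\<alpha> = \<alpha>' \<and> \<beta> = \<beta>'"
    by (simp add: ex_def vec_eq_iff)
qed auto

lemma ecode_pos: "ecode \<alpha> > 0" and code_pos: "code \<alpha> \<beta> > 0"
  by (auto simp: ecode_def code_def intro!: prod_pos prime_gt_0_nat var_prime)

text \<open>
  Because of these bounds, weights that decrease geometrically with the total degree and negative
  powers of the codes define the same notion of convergence.
\<close>

lemma ecode_bounds:
  fixes \<alpha> :: "nat^'n::finite"
  defines "P \<equiv> Max (range (var_prime :: 'n + 'n \<Rightarrow> nat))"
  shows "2 ^ total_deg \<alpha> \<le> ecode \<alpha>" "ecode \<alpha> \<le> P ^ total_deg \<alpha>"
proof -
  have 2: "2 \<le> var_prime (Inl i :: 'n + 'n)" for i by (rule prime_ge_2_nat, rule var_prime)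
  have P: "var_prime (Inl i :: 'n + 'n) \<le> P" for i unfolding P_def by (rule Max_ge) auto
  show "2 ^ total_deg \<alpha> \<le> ecode \<alpha>" "ecode \<alpha> \<le> P ^ total_deg \<alpha>"
    unfolding ecode_def total_deg_def power_sum using 2 P by (intro prod_mono conjI power_mono; simp)+
qed

lemma ecode_le_code: "ecode \<alpha> \<le> code \<alpha> \<beta>"
proof -
  have "0 < (\<Prod>i\<in>UNIV. var_prime (Inr i) ^ (\<beta> $ i))"
    by (intro prod_pos) (auto intro!: prime_gt_0_nat var_prime)
  then show ?thesis by (simp del: prod_pos prod_zero_iff zero_less_power add: code_def Suc_le_eq)
qed

lemma total_deg_le_code: "total_deg \<alpha> < code \<alpha> \<beta>"
proof -
  have "total_deg \<alpha> < 2 ^ total_deg \<alpha>" by (rule less_exp)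
  also have "\<dots> \<le> ecode \<alpha>" by (rule ecode_bounds)
  also have "\<dots> \<le> code \<alpha> \<beta>" by (rule ecode_le_code)
  finally show ?thesis .
qed

lemma inj_code: "inj (\<lambda>(\<alpha>, \<beta>). code \<alpha> \<beta>)"
  by (auto simp: inj_def code_inj)

text \<open>
  The entries of a vector of power series as one sequence of coefficients, like those of a Dirichlet
  series.
\<close>

definition vcoef :: "('n::finite, 'k::field) dop \<Rightarrow> nat \<Rightarrow> 'k"
  where "vcoef F j = (if j \<in> range (\<lambda>(\<alpha>, \<beta>). code \<alpha> (\<beta> :: nat^'n))
    then case inv_into UNIV (\<lambda>(\<alpha>, \<beta>). code \<alpha> \<beta>) j of (\<alpha>, \<beta>) \<Rightarrow> coeff (lkp F \<beta>) \<alpha> else 0)"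

lemma vcoef_code [simp]:
  fixes \<alpha> \<beta> :: "nat^'n::finite"
  shows "vcoef F (code \<alpha> \<beta>) = coeff (lkp F \<beta>) \<alpha>"
proof -
  have "inv_into UNIV (\<lambda>(\<alpha>, \<beta>). code \<alpha> \<beta>) (code \<alpha> \<beta>) = (\<alpha>, \<beta>)"
    using inv_into_f_f[OF inj_code, of "(\<alpha>, \<beta>)"] by simp
  moreover have "code \<alpha> \<beta> \<in> range (\<lambda>(\<alpha>, \<beta>). code \<alpha> (\<beta> :: nat^'n))" by (rule range_eqI[of _ _ "(\<alpha>, \<beta>)"]) simp
  ultimately show ?thesis by (simp only: vcoef_def if_True prod.case)
qed

lemma vcoef_out: "(\<And>\<alpha> \<beta> :: nat^'n::finite. j \<noteq> code \<alpha> \<beta>) \<Longrightarrow> vcoef (F :: ('n, 'k::field) dop) j = 0"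
  unfolding vcoef_def by (rule if_not_P) fastforce

lemma vcoef_nonzeroE:
  assumes "vcoef (F :: ('n::finite, 'k::field) dop) j \<noteq> 0"
  obtains \<alpha> \<beta> :: "nat^'n" where "j = code \<alpha> \<beta>"
  using vcoef_out[of j F] assms by blast

lemma vcoef_eqI:
  assumes "\<And>j. vcoef F j = vcoef G j"
  shows "F = G"
proof (rule poly_mapping_eqI, rule mps_eqI)
  fix \<alpha> \<beta>
  show "coeff (lkp F \<beta>) \<alpha> = coeff (lkp G \<beta>) \<alpha>" using assms[of "code \<alpha> \<beta>"] by simp
qed

lemma vcoef_simps [simp]:
  fixes F G :: "('n::finite, 'k::field) dop"
  shows "vcoef (0 :: ('n, 'k) dop) j = 0" "vcoef (F + G) j = vcoef F j + vcoef G j"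
    "vcoef (F - G) j = vcoef F j - vcoef G j" "vcoef (mterm 0 c \<odot> F) j = c * vcoef F j"
proof -
  have 0: "0 \<le> \<alpha> \<and> \<alpha> - 0 = \<alpha>" for \<alpha> :: "nat^'n" by (auto simp: less_eq_vec_def vec_eq_iff)
  have "vcoef (0 :: ('n, 'k) dop) j = 0 \<and> vcoef (F + G) j = vcoef F j + vcoef G j \<and>
    vcoef (F - G) j = vcoef F j - vcoef G j \<and> vcoef (mterm 0 c \<odot> F) j = c * vcoef F j"
  proof (cases "\<exists>\<alpha> \<beta> :: nat^'n. j = code \<alpha> \<beta>")
    case True
    then obtain \<alpha> \<beta> :: "nat^'n" where j: "j = code \<alpha> \<beta>" by blast
    show ?thesis unfolding j vcoef_code by (simp add: lookup_add lookup_minus coeff_mterm_mult 0)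
  next
    case False
    then have "vcoef H j = 0" for H :: "('n, 'k) dop" by (intro vcoef_out) blast
    then show ?thesis by simp
  qed
  then show "vcoef (0 :: ('n, 'k) dop) j = 0" "vcoef (F + G) j = vcoef F j + vcoef G j"
    "vcoef (F - G) j = vcoef F j - vcoef G j" "vcoef (mterm 0 c \<odot> F) j = c * vcoef F j" by blast+
qed

section \<open>Formal division\<close>

text \<open>
  Leading terms of vectors of power series are lowest terms, here normalised to the coefficient \<open>1\<close>.
\<close>

definition has_lead :: "('n::finite, 'k::field) dop \<Rightarrow> nat \<Rightarrow> bool"
  where "has_lead F j \<longleftrightarrow> vcoef F j = 1 \<and> (\<forall>i<j. vcoef F i = 0)"

lemma vpow_vcoef:
  assumes "F \<in> vpow N" "i \<le> N"
  shows "vcoef (F :: ('n::finite, 'k::field) dop) i = 0"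
proof (cases "\<exists>\<alpha> \<beta> :: nat^'n. i = code \<alpha> \<beta>")
  case True
  then obtain \<alpha> \<beta> :: "nat^'n" where i: "i = code \<alpha> \<beta>" by blast
  then have "total_deg \<alpha> < N" using total_deg_le_code[of \<alpha> \<beta>] assms(2) by simp
  then show ?thesis unfolding i using vpow_coeff[OF assms(1)] by simp
next
  case False
  then show ?thesis by (intro vcoef_out) blast
qed

lemma vcoef_shift:
  fixes g :: "('n::finite, 'k::field) dop"
  shows "vcoef (mterm \<gamma> 1 \<odot> g) (code (\<gamma> + \<alpha>) \<beta>) = vcoef g (code \<alpha> \<beta>)"
    and "vcoef (mterm \<gamma> 1 \<odot> g) j \<noteq> 0 \<Longrightarrow>
      \<exists>i. j = ecode \<gamma> * i \<and> vcoef (mterm \<gamma> 1 \<odot> g) j = vcoef g i"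
proof -
  have "\<gamma> \<le> \<gamma> + \<alpha>" "\<gamma> + \<alpha> - \<gamma> = \<alpha>" for \<alpha> by (auto simp: less_eq_vec_def vec_eq_iff)
  then show 1: "vcoef (mterm \<gamma> 1 \<odot> g) (code (\<gamma> + \<alpha>) \<beta>) = vcoef g (code \<alpha> \<beta>)" for \<alpha> \<beta>
    by (simp add: coeff_mterm_mult)
  assume nz: "vcoef (mterm \<gamma> 1 \<odot> g) j \<noteq> 0"
  then obtain \<alpha> \<beta> :: "nat^'n" where j: "j = code \<alpha> \<beta>" by (rule vcoef_nonzeroE)
  then have "\<gamma> \<le> \<alpha>" using nz by (auto simp: coeff_mterm_mult split: if_splits)
  then have "\<alpha> = \<gamma> + (\<alpha> - \<gamma>)" by (simp add: less_eq_vec_def vec_eq_iff)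
  then show "\<exists>i. j = ecode \<gamma> * i \<and> vcoef (mterm \<gamma> 1 \<odot> g) j = vcoef g i"
    unfolding j using 1 code_add by metis
qed

lemma has_lead_shift:
  assumes "has_lead g (code \<alpha> \<beta>)"
  shows "has_lead (mterm \<gamma> 1 \<odot> g) (code (\<gamma> + \<alpha>) \<beta>)"
proof -
  have "vcoef (mterm \<gamma> 1 \<odot> g) i = 0" if "i < code (\<gamma> + \<alpha>) \<beta>" for i
  proof (rule ccontr)
    assume "vcoef (mterm \<gamma> 1 \<odot> g) i \<noteq> 0"
    then obtain i' where "i = ecode \<gamma> * i'" "vcoef g i' \<noteq> 0" using vcoef_shift(2) by metis
    then show False using assms that by (auto simp: has_lead_def code_add)
  qed
  then show ?thesis using assms unfolding has_lead_def vcoef_shift by blast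
qed

text \<open>
  Subtracting multiples of the \<open>h j\<close> removes the terms of \<open>F\<close> one after the other. At a position \<open>j\<close>
  outside \<open>E\<close> there is nothing to remove: like \<open>F\<close>, the intermediate remainder \<open>R j\<close> is approximated by
  elements of \<open>K\<close>, so its lowest term would be a leading term of \<open>K\<close>.
\<close>

lemma lead_expansion:
  fixes F :: "('n::finite, 'k::field) dop"
  assumes K: "submod UNIV K"
    and h: "\<And>j. j \<in> E \<Longrightarrow> h j \<in> K" "\<And>j. j \<in> E \<Longrightarrow> has_lead (h j) j"
    and E: "\<And>k j. k \<in> K \<Longrightarrow> has_lead k j \<Longrightarrow> j \<in> E"
    and F: "\<And>N. \<exists>k\<in>K. F - k \<in> vpow N"
  obtains c where "\<And>j. j \<notin> E \<Longrightarrow> c j = 0" "\<And>i. vcoef F i = (\<Sum>j\<le>i. c j * vcoef (h j) i)"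
proof -
  \<comment> \<open>\<open>R j\<close> is the remainder after the steps \<open>0, \<dots>, j - 1\<close>.\<close>
  define R where "R = rec_nat F (\<lambda>j R. R - mterm 0 (if j \<in> E then vcoef R j else 0) \<odot> h j)"
  define c where "c j = (if j \<in> E then vcoef (R j) j else 0)" for j
  have R0: "R 0 = F" and RS: "R (Suc j) = R j - mterm 0 (c j) \<odot> h j" for j
    by (simp_all add: R_def c_def)
  have clos: "\<exists>k\<in>K. R j - k \<in> vpow N" for j N
  proof (induction j)
    case (Suc j)
    then obtain k where k: "k \<in> K" "R j - k \<in> vpow N" by blast
    have "mterm 0 (c j) \<odot> h j \<in> K"
    proof (cases "j \<in> E")
      case False
      then have "mterm 0 (c j) = (0 :: ('n, 'k) mps)" by (simp add: c_def mps_eq_iff)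
      then show ?thesis using submodD(1)[OF K] by simp
    qed (auto intro: submodD(3)[OF K] h)
    then have "k - mterm 0 (c j) \<odot> h j \<in> K" using submod_minus(2)[OF K _ k(1)] by blast
    moreover have "R (Suc j) - (k - mterm 0 (c j) \<odot> h j) = R j - k" by (simp add: RS)
    ultimately show ?case using k(2) by metis
  qed (simp add: R0 F)
  have zero: "vcoef (R j) i = 0" if "i < j" for i j
    using that
  proof (induction j arbitrary: i)
    case (Suc j)
    show ?case
    proof (cases "i = j")
      case False
      then have "i < j" using Suc.prems by simp
      moreover have "c j * vcoef (h j) i = 0"
        using h(2)[of j] \<open>i < j\<close> by (cases "j \<in> E") (auto simp: has_lead_def c_def)
      ultimately show ?thesis using Suc.IH by (simp add: RS)
    next
      case True
      have "vcoef (R j) j = 0" if j: "j \<notin> E"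
      proof (rule ccontr)
        assume nz: "vcoef (R j) j \<noteq> 0"
        \<comment> \<open>Agreement up to order \<open>j\<close> suffices: a code exceeds the degree of its term.\<close>
        obtain k where k: "k \<in> K" "R j - k \<in> vpow j" using clos by blast
        have eq: "vcoef k i = vcoef (R j) i" if "i \<le> j" for i
          using vpow_vcoef[OF k(2) that] by simp
        have "has_lead (mterm 0 (1 / vcoef (R j) j) \<odot> k) j"
          using nz eq Suc.IH by (auto simp: has_lead_def)
        then show False using E j submodD(3)[OF K _ k(1)] by blast
      qed
      moreover have "vcoef (h j) j = 1" if "j \<in> E" using h(2)[OF that] by (simp add: has_lead_def)
      ultimately show ?thesis using True by (auto simp: RS c_def)
    qed
  qed simp
  have sum: "vcoef F i = vcoef (R n) i + (\<Sum>j<n. c j * vcoef (h j) i)" for i n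
    by (induction n) (simp_all add: R0 RS)
  show thesis
  proof (rule that[of c])
    show "vcoef F i = (\<Sum>j\<le>i. c j * vcoef (h j) i)" for i
      using sum[of i "Suc i"] zero[of i "Suc i"] by (simp add: lessThan_Suc_atMost)
  qed (simp add: c_def)
qed

lemma coeff_mult_le:
  fixes f g :: "('n::finite, 'k::field) mps"
  shows "coeff (f * g) \<alpha> = (\<Sum>\<gamma> | \<gamma> \<le> \<alpha>. coeff f \<gamma> * coeff g (\<alpha> - \<gamma>))"
  unfolding coeff_mult
proof (rule sum.reindex_bij_witness[where i = "\<lambda>\<gamma>. (\<gamma>, \<alpha> - \<gamma>)" and j = fst])
  have 1: "\<mu> + \<nu> - \<mu> = \<nu>" for \<mu> \<nu> :: "nat^'n" by (simp add: vec_eq_iff)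
  fix p assume "p \<in> {(\<mu>, \<nu>). \<mu> + \<nu> = \<alpha>}"
  then show "(fst p, \<alpha> - fst p) = p" "fst p \<in> {\<gamma>. \<gamma> \<le> \<alpha>}"
    "coeff f (fst p) * coeff g (\<alpha> - fst p) = (case p of (\<mu>, \<nu>) \<Rightarrow> coeff f \<mu> * coeff g \<nu>)"
    by (auto simp: 1 less_eq_vec_def)
qed (auto simp: vec_eq_iff less_eq_vec_def)

lemma finite_le_vec: "finite {\<gamma>. \<gamma> \<le> (\<alpha> :: nat^'n::finite)}"
  using finite_le_multi[of "vec_nth \<alpha>"] by (simp add: less_eq_vec_def)

lift_definition series_of :: "(nat^'n::finite \<Rightarrow> 'k::field) \<Rightarrow> ('n, 'k) mps" is "\<lambda>f. f" .

lemmas coeff_series_of [simp] = series_of.rep_eq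

text \<open>
  A triple \<open>(g, \<alpha>, \<beta>)\<close> in \<open>S\<close> is a divisor \<open>g\<close> with its leading exponent. By Dickson's lemma finitely
  many of them suffice to have, for every leading term \<open>j\<close> of \<open>K\<close>, a divisor \<open>sel j\<close> and a monomial
  with exponent \<open>\<gamma> j\<close> whose product has the leading term \<open>j\<close>. Sorting the expansion into these products
  by divisors gives the quotients \<open>a\<close>. The scalars \<open>c\<close> and their recursion are part of the conclusion
  because the convergence of the quotients is read off from them.
\<close>

lemma division:
  fixes F :: "('n::finite, 'k::field) dop"
  assumes K: "submod UNIV K" and B: "finite B" "K \<subseteq> supp_in B"
    and D: "D \<subseteq> K" "\<And>k j. k \<in> K \<Longrightarrow> has_lead k j \<Longrightarrow> \<exists>d\<in>D. has_lead d j"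
    and F: "\<And>N. \<exists>k\<in>K. F - k \<in> vpow N"
  obtains S :: "(('n, 'k) dop \<times> (nat^'n) \<times> (nat^'n)) set" and E sel \<gamma> c a where
    "finite S" "\<And>g \<alpha> \<beta>. (g, \<alpha>, \<beta>) \<in> S \<Longrightarrow> g \<in> D" "\<And>g \<alpha> \<beta>. (g, \<alpha>, \<beta>) \<in> S \<Longrightarrow> has_lead g (code \<alpha> \<beta>)"
    "\<And>j. j \<in> E \<Longrightarrow> sel j \<in> S" "\<And>j g \<alpha> \<beta>. j \<in> E \<Longrightarrow> sel j = (g, \<alpha>, \<beta>) \<Longrightarrow> j = code (\<gamma> j + \<alpha>) \<beta>"
    "\<And>j. j \<notin> E \<Longrightarrow> c j = 0"
    "\<And>i. vcoef F i = (\<Sum>j\<le>i. c j * vcoef (mterm (\<gamma> j) 1 \<odot> fst (sel j)) i)"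
    "\<And>g \<alpha> \<beta> \<mu>. (g, \<alpha>, \<beta>) \<in> S \<Longrightarrow> coeff (a (g, \<alpha>, \<beta>)) \<mu> =
       (if code (\<mu> + \<alpha>) \<beta> \<in> E \<and> sel (code (\<mu> + \<alpha>) \<beta>) = (g, \<alpha>, \<beta>) then c (code (\<mu> + \<alpha>) \<beta>) else 0)"
    "F = (\<Sum>s\<in>S. a s \<odot> fst s)"
proof -
  define T where "T \<beta> = {(g, \<alpha>, \<beta>'). g \<in> D \<and> has_lead g (code \<alpha> \<beta>') \<and> \<beta>' = \<beta>}"
    for \<beta> :: "nat^'n"
  have "\<exists>G. finite G \<and> G \<subseteq> T \<beta> \<and> (\<forall>e\<in>T \<beta>. \<exists>g\<in>G. \<forall>i\<in>UNIV. fst (snd g) $ i \<le> fst (snd e) $ i)" for \<beta>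
    by (rule dickson) simp
  then obtain G where G: "\<And>\<beta>. finite (G \<beta>)" "\<And>\<beta>. G \<beta> \<subseteq> T \<beta>"
    "\<And>\<beta> e. e \<in> T \<beta> \<Longrightarrow> \<exists>g\<in>G \<beta>. \<forall>i\<in>UNIV. fst (snd g) $ i \<le> fst (snd e) $ i"
    by metis
  define S where "S = (\<Union>\<beta>\<in>B. G \<beta>)"
  have finS: "finite S" using B(1) G(1) by (simp add: S_def)
  have S: "g \<in> D \<and> has_lead g (code \<alpha> \<beta>)" if "(g, \<alpha>, \<beta>) \<in> S" for g \<alpha> \<beta>
    using that G(2) unfolding S_def T_def by blast
  define E where "E = {j. \<exists>k\<in>K. has_lead k j}"
  have "\<exists>s \<gamma>. s \<in> S \<and> j = code (\<gamma> + fst (snd s)) (snd (snd s))" if "j \<in> E" for j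
  proof -
    have "\<exists>k\<in>K. has_lead k j" using that unfolding E_def by simp
    then have "\<exists>d\<in>D. has_lead d j" using D(2) by blast
    then obtain d where d: "d \<in> D" "has_lead d j" by blast
    then have "vcoef d j \<noteq> 0" by (simp add: has_lead_def)
    then obtain \<alpha> \<beta> :: "nat^'n" where j: "j = code \<alpha> \<beta>" using vcoef_out by blast
    have "coeff (lkp d \<beta>) \<alpha> = 1" using d(2) unfolding has_lead_def j by simp
    then have "\<beta> \<in> B" using d(1) D(1) B(2) by (force simp: supp_in_def)
    have "(d, \<alpha>, \<beta>) \<in> T \<beta>" using d by (simp add: T_def j)
    then obtain s where s: "s \<in> G \<beta>" "\<forall>i. fst (snd s) $ i \<le> \<alpha> $ i" using G(3)[of "(d, \<alpha>, \<beta>)" \<beta>] by auto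
    have "s \<in> T \<beta>" using s(1) G(2) by blast
    then have "snd (snd s) = \<beta>" by (auto simp: T_def)
    moreover have "\<alpha> = \<alpha> - fst (snd s) + fst (snd s)" using s(2) by (simp add: vec_eq_iff)
    moreover have "s \<in> S" using s(1) \<open>\<beta> \<in> B\<close> by (auto simp: S_def)
    ultimately show ?thesis using j by metis
  qed
  then obtain sel \<gamma> where sel: "\<And>j. j \<in> E \<Longrightarrow> sel j \<in> S"
    "\<And>j. j \<in> E \<Longrightarrow> j = code (\<gamma> j + fst (snd (sel j))) (snd (snd (sel j)))"
    by metis
  let ?h = "\<lambda>j. mterm (\<gamma> j) 1 \<odot> fst (sel j)"
  have hK: "?h j \<in> K" and hl: "has_lead (?h j) j" if "j \<in> E" for j
  proof -
    obtain g \<alpha> \<beta> where s: "sel j = (g, \<alpha>, \<beta>)" by (cases "sel j") auto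
    then have g: "g \<in> D" "has_lead g (code \<alpha> \<beta>)" using S sel(1)[OF that] by auto
    show "?h j \<in> K" using g(1) D(1) s by (auto intro!: submodD(3)[OF K])
    have "has_lead (?h j) (code (\<gamma> j + \<alpha>) \<beta>)" using has_lead_shift[OF g(2)] s by simp
    then show "has_lead (?h j) j" using sel(2)[OF that] s by simp
  qed
  have EK: "j \<in> E" if "k \<in> K" "has_lead k j" for k j
    using that by (auto simp: E_def)
  obtain c where c: "\<And>j. j \<notin> E \<Longrightarrow> c j = 0" "\<And>i. vcoef F i = (\<Sum>j\<le>i. c j * vcoef (?h j) i)"
    using lead_expansion[of K E ?h F] K hK hl EK F by blast
  define q where "q s \<mu> = code (\<mu> + fst (snd s)) (snd (snd s))" for s :: "('n, 'k) dop \<times> (nat^'n) \<times> (nat^'n)" and \<mu>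
  define a where "a s = series_of (\<lambda>\<mu>. if q s \<mu> \<in> E \<and> sel (q s \<mu>) = s then c (q s \<mu>) else 0)" for s
  have "F = (\<Sum>s\<in>S. a s \<odot> fst s)"
  proof (rule poly_mapping_eqI, rule mps_eqI)
    fix \<alpha> \<beta>
    \<comment> \<open>The products of divisors and monomials that meet the term \<open>(\<alpha>, \<beta>)\<close>, indexed by their leading terms and by divisor and monomial.\<close>
    let ?J = "{j \<in> E. \<gamma> j \<le> \<alpha>}" and ?W = "{(s, \<mu>). s \<in> S \<and> \<mu> \<le> \<alpha> \<and> q s \<mu> \<in> E \<and> sel (q s \<mu>) = s}"
    let ?t = "\<lambda>j. c j * vcoef (?h j) (code \<alpha> \<beta>)"
    have W: "finite ?W"
      by (rule finite_subset[of _ "S \<times> {\<mu>. \<mu> \<le> \<alpha>}"]) (auto simp: finS finite_le_vec)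
    have qsel: "q (sel j) (\<gamma> j) = j" if "j \<in> E" for j using sel(2)[OF that] by (simp add: q_def)
    have q\<gamma>: "\<gamma> (q s \<mu>) = \<mu>" if "q s \<mu> \<in> E" "sel (q s \<mu>) = s" for s \<mu>
      using qsel[OF that(1)] that(2) unfolding q_def code_inj by simp
    have J: "finite ?J"
    proof (rule finite_subset[OF _ finite_imageI[OF W, of "\<lambda>(s, \<mu>). q s \<mu>"]], rule subsetI)
      fix j assume "j \<in> ?J"
      then show "j \<in> (\<lambda>(s, \<mu>). q s \<mu>) ` ?W"
        using qsel sel(1) by (intro image_eqI[of _ _ "(sel j, \<gamma> j)"]) auto
    qed
    have "coeff (lkp (\<Sum>s\<in>S. a s \<odot> fst s) \<beta>) \<alpha> =
      (\<Sum>s\<in>S. \<Sum>\<mu> | \<mu> \<le> \<alpha>. coeff (a s) \<mu> * coeff (lkp (fst s) \<beta>) (\<alpha> - \<mu>))"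
      by (simp add: lookup_sum coeff_sum coeff_mult_le)
    also have "\<dots> = (\<Sum>(s, \<mu>)\<in>S \<times> {\<mu>. \<mu> \<le> \<alpha>}. coeff (a s) \<mu> * coeff (lkp (fst s) \<beta>) (\<alpha> - \<mu>))"
      by (simp add: sum.cartesian_product)
    also have "\<dots> = (\<Sum>(s, \<mu>)\<in>?W. c (q s \<mu>) * coeff (lkp (fst s) \<beta>) (\<alpha> - \<mu>))"
      by (rule sum.mono_neutral_cong_right) (auto simp: finS finite_le_vec a_def split: if_splits)
    also have "\<dots> = (\<Sum>j\<in>?J. ?t j)"
    proof (rule sum.reindex_bij_witness[where i = "\<lambda>j. (sel j, \<gamma> j)" and j = "\<lambda>(s, \<mu>). q s \<mu>"])
      fix p assume p: "p \<in> ?W"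
      then obtain s \<mu> where s: "p = (s, \<mu>)" "s \<in> S" "\<mu> \<le> \<alpha>" "q s \<mu> \<in> E" "sel (q s \<mu>) = s" by blast
      show "(sel (case p of (s, \<mu>) \<Rightarrow> q s \<mu>), \<gamma> (case p of (s, \<mu>) \<Rightarrow> q s \<mu>)) = p"
        using s q\<gamma> by simp
      show "(case p of (s, \<mu>) \<Rightarrow> q s \<mu>) \<in> ?J" using s q\<gamma> by simp
      show "?t (case p of (s, \<mu>) \<Rightarrow> q s \<mu>) =
         (case p of (s, \<mu>) \<Rightarrow> c (q s \<mu>) * coeff (lkp (fst s) \<beta>) (\<alpha> - \<mu>))"
        using s q\<gamma>[OF s(4,5)] by (simp add: coeff_mterm_mult)
    qed (auto simp: qsel sel(1))
    also have "\<dots> = (\<Sum>j\<in>?J \<inter> {..code \<alpha> \<beta>}. ?t j)"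
    proof (rule sum.mono_neutral_right[OF J])
      have z: "?t j = 0" if "j \<in> E" "code \<alpha> \<beta> < j" for j
        using hl[OF that(1)] that(2) unfolding has_lead_def by (metis mult_zero_right)
      show "\<forall>j\<in>?J - ?J \<inter> {..code \<alpha> \<beta>}. ?t j = 0"
      proof
        fix j assume "j \<in> ?J - ?J \<inter> {..code \<alpha> \<beta>}"
        then have "j \<in> E" "code \<alpha> \<beta> < j" by (simp_all add: not_le)
        then show "?t j = 0" by (rule z)
      qed
    qed auto
    also have "\<dots> = (\<Sum>j\<le>code \<alpha> \<beta>. ?t j)"
    proof (rule sum.mono_neutral_left)
      have "?t j = 0" if "j \<notin> E \<or> \<not> \<gamma> j \<le> \<alpha>" for j
        using that c(1) by (auto simp: coeff_mterm_mult)
      then show "\<forall>j\<in>{..code \<alpha> \<beta>} - ?J \<inter> {..code \<alpha> \<beta>}. ?t j = 0" by blast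
    qed auto
    also have "\<dots> = vcoef F (code \<alpha> \<beta>)" by (simp only: c(2))
    finally show "coeff (lkp F \<beta>) \<alpha> = coeff (lkp (\<Sum>s\<in>S. a s \<odot> fst s) \<beta>) \<alpha>" by simp
  qed
  moreover have "coeff (a (g, \<alpha>, \<beta>)) \<mu> =
       (if code (\<mu> + \<alpha>) \<beta> \<in> E \<and> sel (code (\<mu> + \<alpha>) \<beta>) = (g, \<alpha>, \<beta>) then c (code (\<mu> + \<alpha>) \<beta>) else 0)"
    for g \<alpha> \<beta> \<mu> by (simp add: a_def q_def)
  moreover have "j = code (\<gamma> j + \<alpha>) \<beta>" if "j \<in> E" "sel j = (g, \<alpha>, \<beta>)" for j g \<alpha> \<beta>
    using sel(2)[OF that(1)] that(2) by simp
  ultimately show thesis using S by (intro that[of S E sel \<gamma> c a] finS sel(1) c) blast+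
qed

text \<open>
  Division with the module itself as supply of divisors writes every limit of elements as an element.
\<close>

lemma lspan_closed:
  fixes F :: "('n::finite, 'k::field) dop"
  assumes "finite B" "L \<subseteq> supp_in B" and F: "\<And>N. \<exists>k\<in>lspan UNIV L. F - k \<in> vpow N"
  shows "F \<in> lspan UNIV L"
proof -
  let ?K = "lspan UNIV L"
  have K: "submod UNIV ?K" by (rule submod_lspan_UNIV)
  have "?K \<subseteq> supp_in B" by (rule lspan_least[OF submod_supp_in assms(2)])
  then show ?thesis
  proof (rule division[OF K assms(1) _ subset_refl _ F])
    fix S :: "(('n, 'k) dop \<times> (nat^'n) \<times> (nat^'n)) set" and a
    assume S: "\<And>g \<alpha> \<beta>. (g, \<alpha>, \<beta>) \<in> S \<Longrightarrow> g \<in> ?K" "F = (\<Sum>s\<in>S. a s \<odot> fst s)"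
    show "F \<in> ?K" unfolding S(2)
      by (rule submod_sum[OF K], rule submodD(3)[OF K]) (use S(1) in auto)
  qed blast
qed

section \<open>Descent from formal power series\<close>

text \<open>
  The support condition restricts to free modules of finite rank. In this form the condition says
  that the power series are a pure extension of \<open>C\<close>.
\<close>

definition descent :: "('n::finite, 'k::field) mps set \<Rightarrow> bool"
  where "descent C \<longleftrightarrow> (\<forall>L B F. finite B \<and> L \<subseteq> ops C \<and> L \<subseteq> supp_in B \<and> submod C L \<and>
    F \<in> lspan UNIV L \<and> F \<in> ops C \<longrightarrow> F \<in> L)"

text \<open>
  The normalised leading term depends on finitely many coefficients only, and these are unchanged
  when the coefficients of a combination are cut off in high degree.
\<close>

lemma lead_in_submodule:
  assumes "submod C L" "polys \<subseteq> C" "k \<in> lspan UNIV L" "has_lead k j"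
  shows "\<exists>d\<in>L. has_lead d j"
proof -
  obtain h where h: "h \<in> L" "k - h \<in> lspan (mpow j) L" using lspan_approx[OF assms(1-3)] by blast
  then have "k - h \<in> vpow j" using lspan_mpow by blast
  then have "vcoef h i = vcoef k i" if "i \<le> j" for i using vpow_vcoef[of "k - h" j i] that by simp
  then have "has_lead h j" using assms(4) by (simp add: has_lead_def)
  then show ?thesis using h(1) by blast
qed

section \<open>Descent for convergent power series\<close>

text \<open>
  A term \<open>x\<^sup>\<alpha> \<partial>\<^sup>\<beta>\<close> has a code of at least \<open>2\<^sup>n\<close>, where \<open>n\<close> is the total degree of \<open>\<alpha>\<close>. So for large \<open>t\<close>
  the weights \<open>1 / j\<^sup>t\<close> are below \<open>r\<^sup>n\<close> for radii \<open>r\<close> at which the finitely many nonzero entries converge.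
\<close>

lemma sum_norm_bound:
  fixes F :: "('n::finite, complex) dop"
  assumes F: "F \<in> ops conv_series"
  shows "\<exists>t M. \<forall>t'\<ge>t. \<forall>J. (\<Sum>j\<le>J. cmod (vcoef F j) / real j ^ t') \<le> M"
proof -
  let ?K = "Poly_Mapping.keys F"
  have "\<forall>\<beta>. \<exists>r>0. (\<lambda>\<alpha>. cmod (coeff (lkp F \<beta>) \<alpha>) * r ^ total_deg \<alpha>) summable_on UNIV"
    using F by (auto simp: ops_def conv_series_def)
  then obtain r where r: "\<And>\<beta>. r \<beta> > 0"
    "\<And>\<beta>. (\<lambda>\<alpha>. cmod (coeff (lkp F \<beta>) \<alpha>) * r \<beta> ^ total_deg \<alpha>) summable_on UNIV"
    by metis
  have "\<exists>n. (1 / 2 :: real) ^ n < r \<beta>" for \<beta> using real_arch_pow_inv[OF r(1), of "1 / 2"] by simp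
  then obtain n where n: "\<And>\<beta>. (1 / 2 :: real) ^ n \<beta> < r \<beta>" by metis
  define t where "t = (\<Sum>\<beta>\<in>?K. n \<beta>)"
  define M where "M = (\<Sum>\<beta>\<in>?K. \<Sum>\<^sub>\<infinity>\<alpha>. cmod (coeff (lkp F \<beta>) \<alpha>) * r \<beta> ^ total_deg \<alpha>)"
  have "(\<Sum>j\<le>J. cmod (vcoef F j) / real j ^ t') \<le> M" if "t' \<ge> t" for t' J
  proof -
    let ?P = "{(\<alpha>, \<beta>). \<beta> \<in> ?K \<and> code \<alpha> \<beta> \<le> J}" and ?c = "\<lambda>(\<alpha>, \<beta>). code \<alpha> (\<beta> :: nat^'n)"
    have inj: "inj_on ?c ?P" by (rule inj_on_subset[OF inj_code]) simp
    have "finite ?P" by (rule finite_imageD[OF _ inj]) (rule finite_subset[of _ "{..J}"], auto)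
    then have fin: "finite (fst ` ?P)" "finite ?P" by auto
    have "(\<Sum>j\<le>J. cmod (vcoef F j) / real j ^ t') = (\<Sum>j\<in>?c ` ?P. cmod (vcoef F j) / real j ^ t')"
    proof (rule sum.mono_neutral_right)
      have "j \<in> ?c ` ?P" if j: "j \<le> J" "vcoef F j \<noteq> 0" for j
      proof -
        obtain \<alpha> \<beta> :: "nat^'n" where ab: "j = code \<alpha> \<beta>" using j(2) by (rule vcoef_nonzeroE)
        then have "\<beta> \<in> ?K" using j(2) by (auto simp: in_keys_iff)
        then show ?thesis using j(1) ab by (intro image_eqI[of _ _ "(\<alpha>, \<beta>)"]) auto
      qed
      then show "\<forall>j\<in>{..J} - ?c ` ?P. cmod (vcoef F j) / real j ^ t' = 0" by auto
    qed auto
    also have "\<dots> = (\<Sum>(\<alpha>, \<beta>)\<in>?P. cmod (coeff (lkp F \<beta>) \<alpha>) / real (code \<alpha> \<beta>) ^ t')"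
      by (subst sum.reindex[OF inj]) (simp add: case_prod_unfold)
    also have "\<dots> \<le> (\<Sum>(\<alpha>, \<beta>)\<in>?P. cmod (coeff (lkp F \<beta>) \<alpha>) * r \<beta> ^ total_deg \<alpha>)"
    proof (rule sum_mono, clarify)
      fix \<alpha> \<beta> :: "nat^'n" assume b: "\<beta> \<in> ?K"
      have "n \<beta> \<le> t'" using member_le_sum[OF b, of n] that by (simp add: t_def)
      then have "(1 / 2 :: real) ^ t' \<le> r \<beta>"
        using n[of \<beta>] power_decreasing[of "n \<beta>" t' "1 / 2 :: real"] by linarith
      then have "((1 / 2 :: real) ^ t') ^ total_deg \<alpha> \<le> r \<beta> ^ total_deg \<alpha>" by (intro power_mono) auto
      moreover have "(2 :: real) ^ total_deg \<alpha> \<le> real (code \<alpha> \<beta>)"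
      proof -
        have "2 ^ total_deg \<alpha> \<le> ecode \<alpha>" by (rule ecode_bounds)
        also have "\<dots> \<le> code \<alpha> \<beta>" by (rule ecode_le_code)
        finally show ?thesis by (metis of_nat_le_iff of_nat_numeral of_nat_power)
      qed
      then have "((2 :: real) ^ total_deg \<alpha>) ^ t' \<le> real (code \<alpha> \<beta>) ^ t'" by (intro power_mono) auto
      then have "1 / real (code \<alpha> \<beta>) ^ t' \<le> 1 / ((2 :: real) ^ total_deg \<alpha>) ^ t'"
        by (intro divide_left_mono) (auto intro!: mult_pos_pos simp: code_pos)
      then have "1 / real (code \<alpha> \<beta>) ^ t' \<le> ((1 / 2 :: real) ^ t') ^ total_deg \<alpha>"
        by (simp add: power_divide power_mult[symmetric] mult.commute)
      ultimately have "1 / real (code \<alpha> \<beta>) ^ t' \<le> r \<beta> ^ total_deg \<alpha>" by linarith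
      then show "cmod (coeff (lkp F \<beta>) \<alpha>) / real (code \<alpha> \<beta>) ^ t'
          \<le> cmod (coeff (lkp F \<beta>) \<alpha>) * r \<beta> ^ total_deg \<alpha>"
        using mult_left_mono[of "1 / real (code \<alpha> \<beta>) ^ t'" "r \<beta> ^ total_deg \<alpha>" "cmod (coeff (lkp F \<beta>) \<alpha>)"]
        by simp
    qed
    also have "\<dots> \<le> (\<Sum>(\<alpha>, \<beta>)\<in>fst ` ?P \<times> ?K. cmod (coeff (lkp F \<beta>) \<alpha>) * r \<beta> ^ total_deg \<alpha>)"
      by (rule sum_mono2) (use fin r(1) in \<open>force simp: less_imp_le\<close>)+
    also have "\<dots> = (\<Sum>\<beta>\<in>?K. \<Sum>\<alpha>\<in>fst ` ?P. cmod (coeff (lkp F \<beta>) \<alpha>) * r \<beta> ^ total_deg \<alpha>)"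
      by (subst sum.swap) (simp add: sum.cartesian_product)
    also have "\<dots> \<le> M" unfolding M_def
      by (intro sum_mono finite_sum_le_infsum r(2) fin) (auto intro!: mult_nonneg_nonneg zero_le_power less_imp_le[OF r(1)])
    finally show ?thesis .
  qed
  then show ?thesis by blast
qed

text \<open>
  Raising the exponent by \<open>s\<close> divides the weight of the leading term by \<open>l\<^sup>s\<close> and the weights of all
  other terms of \<open>F\<close> by at least \<open>(l + 1)\<^sup>s\<close>. So the leading term dominates the rest eventually.
\<close>

lemma tail_bound:
  fixes F :: "('n::finite, complex) dop"
  assumes F: "F \<in> ops conv_series" and l: "has_lead F l"
  shows "\<exists>t. \<forall>t'\<ge>t. \<forall>J. (\<Sum>j | j \<le> J \<and> j \<noteq> l. cmod (vcoef F j) / real j ^ t') \<le> 1 / 2 / real l ^ t'"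
proof -
  obtain t0 M where M: "\<And>J. (\<Sum>j\<le>J. cmod (vcoef F j) / real j ^ t0) \<le> M"
    using sum_norm_bound[OF F] by blast
  have "l > 0"
  proof -
    have "vcoef F l \<noteq> 0" using l by (simp add: has_lead_def)
    then obtain \<alpha> \<beta> :: "nat^'n" where "l = code \<alpha> \<beta>" by (rule vcoef_nonzeroE)
    then show ?thesis by (simp add: code_pos)
  qed
  define q where "q = real l / real (l + 1)"
  have q: "0 < q" "q < 1" using \<open>l > 0\<close> by (auto simp: q_def)
  define M' where "M' = max M 1"
  have M': "M' > 0" "M \<le> M'" by (auto simp: M'_def)
  have pos: "0 < 1 / (2 * (M' * real l ^ t0))" using M' \<open>l > 0\<close> by simp
  obtain n where n: "q ^ n < 1 / (2 * (M' * real l ^ t0))" using real_arch_pow_inv[OF pos q(2)] by blast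
  have "(\<Sum>j | j \<le> J \<and> j \<noteq> l. cmod (vcoef F j) / real j ^ t) \<le> 1 / 2 / real l ^ t" if t: "t \<ge> t0 + n" for t J
  proof -
    define s where "s = t - t0"
    have ts: "t = t0 + s" "s \<ge> n" using t by (auto simp: s_def)
    have "(\<Sum>j | j \<le> J \<and> j \<noteq> l. cmod (vcoef F j) / real j ^ t)
      \<le> (\<Sum>j | j \<le> J \<and> j \<noteq> l. cmod (vcoef F j) / real j ^ t0 * (1 / real (l + 1) ^ s))"
    proof (rule sum_mono)
      fix j assume j: "j \<in> {j. j \<le> J \<and> j \<noteq> l}"
      show "cmod (vcoef F j) / real j ^ t \<le> cmod (vcoef F j) / real j ^ t0 * (1 / real (l + 1) ^ s)"
      proof (cases "j < l")
        case True
        then show ?thesis using l by (simp add: has_lead_def)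
      next
        case False
        then have "l + 1 \<le> j" using j by simp
        then have "real (l + 1) ^ s \<le> real j ^ s" by (intro power_mono) auto
        then have "1 / real j ^ s \<le> 1 / real (l + 1) ^ s"
          using \<open>l + 1 \<le> j\<close> by (intro divide_left_mono) (auto intro!: mult_pos_pos)
        then have "cmod (vcoef F j) / real j ^ t0 * (1 / real j ^ s)
          \<le> cmod (vcoef F j) / real j ^ t0 * (1 / real (l + 1) ^ s)"
          by (intro mult_left_mono) auto
        then show ?thesis by (simp add: ts power_add)
      qed
    qed
    also have "\<dots> = (\<Sum>j | j \<le> J \<and> j \<noteq> l. cmod (vcoef F j) / real j ^ t0) * (1 / real (l + 1) ^ s)"
      by (simp only: sum_distrib_right)
    also have "\<dots> \<le> M' * (1 / real (l + 1) ^ s)"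
    proof (rule mult_right_mono)
      have "(\<Sum>j | j \<le> J \<and> j \<noteq> l. cmod (vcoef F j) / real j ^ t0) \<le> (\<Sum>j\<le>J. cmod (vcoef F j) / real j ^ t0)"
        by (rule sum_mono2) auto
      then show "(\<Sum>j | j \<le> J \<and> j \<noteq> l. cmod (vcoef F j) / real j ^ t0) \<le> M'" using M[of J] M' by simp
    qed simp
    also have "\<dots> = M' * real l ^ t0 * q ^ s / real l ^ t"
      using \<open>l > 0\<close> by (simp add: q_def ts power_add power_divide field_simps)
    also have "\<dots> \<le> M' * real l ^ t0 * (1 / (2 * (M' * real l ^ t0))) / real l ^ t"
    proof -
      have "q ^ s \<le> 1 / (2 * (M' * real l ^ t0))"
        using power_decreasing[OF ts(2), of q] q n by linarith
      then show ?thesis using M' by (intro divide_right_mono mult_left_mono) auto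
    qed
    also have "\<dots> = 1 / 2 / real l ^ t" using M' \<open>l > 0\<close> by (simp add: field_simps)
    finally show ?thesis .
  qed
  then show ?thesis by blast
qed

text \<open>
  The estimate of \<open>tail_bound\<close> holds for all monomial multiples with the same \<open>t\<close>, because
  multiplication by \<open>x\<^sup>\<gamma>\<close> multiplies all codes, and hence all weights, by a common factor.
\<close>

lemma tail_shift:
  fixes g :: "('n::finite, complex) dop"
  assumes "\<And>J. (\<Sum>i | i \<le> J \<and> i \<noteq> l. cmod (vcoef g i) / real i ^ t) \<le> b"
  shows "(\<Sum>j | j \<le> J \<and> j \<noteq> ecode \<gamma> * l. cmod (vcoef (mterm \<gamma> 1 \<odot> g) j) / real j ^ t) \<le> b / real (ecode \<gamma>) ^ t"
proof -
  let ?e = "ecode \<gamma>" and ?g = "mterm \<gamma> 1 \<odot> g"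
  let ?N = "{j. j \<le> J \<and> j \<noteq> ?e * l \<and> vcoef ?g j \<noteq> 0}"
  have e: "?e > 0" by (rule ecode_pos)
  note N = vcoef_shift(2)[of \<gamma> g]
  have "(\<Sum>j | j \<le> J \<and> j \<noteq> ?e * l. cmod (vcoef ?g j) / real j ^ t) = (\<Sum>j\<in>?N. cmod (vcoef ?g j) / real j ^ t)"
    by (rule sum.mono_neutral_right) auto
  also have "\<dots> = (\<Sum>j\<in>?N. cmod (vcoef g (j div ?e)) / real (j div ?e) ^ t / real ?e ^ t)"
  proof (rule sum.cong[OF refl])
    fix j assume "j \<in> ?N"
    then obtain i where "j = ?e * i" "vcoef ?g j = vcoef g i" using N by blast
    then show "cmod (vcoef ?g j) / real j ^ t = cmod (vcoef g (j div ?e)) / real (j div ?e) ^ t / real ?e ^ t"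
      using e by (simp add: power_mult_distrib mult.commute)
  qed
  also have "\<dots> = (\<Sum>i\<in>(\<lambda>j. j div ?e) ` ?N. cmod (vcoef g i) / real i ^ t / real ?e ^ t)"
  proof (subst sum.reindex)
    show "inj_on (\<lambda>j. j div ?e) ?N"
    proof (rule inj_onI)
      fix j j' assume "j \<in> ?N" "j' \<in> ?N" "j div ?e = j' div ?e"
      moreover from this obtain i i' where "j = ?e * i" "j' = ?e * i'" using N by blast
      ultimately show "j = j'" using e by simp
    qed
  qed simp
  also have "\<dots> \<le> (\<Sum>i | i \<le> J \<and> i \<noteq> l. cmod (vcoef g i) / real i ^ t / real ?e ^ t)"
  proof (rule sum_mono2)
    show "(\<lambda>j. j div ?e) ` ?N \<subseteq> {i. i \<le> J \<and> i \<noteq> l}"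
    proof clarify
      fix j assume j: "j \<le> J" "j \<noteq> ?e * l" "vcoef ?g j \<noteq> 0"
      then obtain i where i: "j = ?e * i" using N by blast
      have "i \<le> j" using e i by simp
      moreover have "j div ?e = i" using e i by simp
      ultimately show "j div ?e \<le> J \<and> j div ?e \<noteq> l" using j(1,2) i by (metis le_trans)
    qed
  qed auto
  also have "\<dots> = (\<Sum>i | i \<le> J \<and> i \<noteq> l. cmod (vcoef g i) / real i ^ t) / real ?e ^ t"
    by (simp add: sum_divide_distrib)
  also have "\<dots> \<le> b / real ?e ^ t" by (intro divide_right_mono assms) simp
  finally show ?thesis .
qed

text \<open>
  Solve the recursion for \<open>c i\<close> and sum up. The contribution of the off-diagonal terms is at most half
  of the sum to be estimated; this sum is finite, so it can be subtracted.
\<close>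

lemma triangular_bound:
  fixes x c :: "nat \<Rightarrow> complex" and y :: "nat \<Rightarrow> nat \<Rightarrow> complex" and w :: "nat \<Rightarrow> real"
  assumes w: "\<And>i. w i \<ge> 0"
    and x: "\<And>i. x i = (\<Sum>j\<le>i. c j * y j i)" and y: "\<And>j. c j \<noteq> 0 \<Longrightarrow> y j j = 1"
    and tail: "\<And>j J. c j \<noteq> 0 \<Longrightarrow> (\<Sum>i | i \<le> J \<and> i \<noteq> j. cmod (y j i) * w i) \<le> 1 / 2 * w j"
    and M: "(\<Sum>i\<le>J. cmod (x i) * w i) \<le> M"
  shows "(\<Sum>j\<le>J. cmod (c j) * w j) \<le> 2 * M"
proof -
  let ?A = "\<Sum>j\<le>J. cmod (c j) * w j"
  let ?d = "\<lambda>j i. if j < i then cmod (c j) * (cmod (y j i) * w i) else 0"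
  have "?A \<le> (\<Sum>i\<le>J. cmod (x i) * w i + (\<Sum>j\<le>J. ?d j i))"
  proof (rule sum_mono)
    fix i assume i: "i \<in> {..J}"
    have "x i = c i + (\<Sum>j<i. c j * y j i)"
    proof -
      have "c i * y i i = c i" using y[of i] by (cases "c i = 0") auto
      then show ?thesis unfolding x[of i] lessThan_Suc_atMost[symmetric] by simp
    qed
    then have "c i = x i - (\<Sum>j<i. c j * y j i)" by simp
    then have "cmod (c i) \<le> cmod (x i) + cmod (\<Sum>j<i. c j * y j i)" by (metis norm_triangle_ineq4)
    also have "\<dots> \<le> cmod (x i) + (\<Sum>j<i. cmod (c j) * cmod (y j i))"
      by (intro add_left_mono sum_norm_le) (simp add: norm_mult)
    finally have "cmod (c i) * w i \<le> (cmod (x i) + (\<Sum>j<i. cmod (c j) * cmod (y j i))) * w i"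
      by (intro mult_right_mono w)
    also have "\<dots> = cmod (x i) * w i + (\<Sum>j<i. cmod (c j) * (cmod (y j i) * w i))"
      by (simp add: distrib_right sum_distrib_right mult.assoc)
    also have "(\<Sum>j<i. cmod (c j) * (cmod (y j i) * w i)) = (\<Sum>j\<le>J. ?d j i)"
      using i by (intro sum.mono_neutral_cong_left) auto
    finally show "cmod (c i) * w i \<le> cmod (x i) * w i + (\<Sum>j\<le>J. ?d j i)" .
  qed
  also have "\<dots> = (\<Sum>i\<le>J. cmod (x i) * w i) + (\<Sum>j\<le>J. \<Sum>i\<le>J. ?d j i)"
    unfolding sum.distrib by (subst sum.swap) simp
  also have "\<dots> \<le> M + (\<Sum>j\<le>J. cmod (c j) * (1 / 2 * w j))"
  proof (intro add_mono M sum_mono)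
    fix j
    have "(\<Sum>i\<le>J. ?d j i) = cmod (c j) * (\<Sum>i | i \<le> J \<and> j < i. cmod (y j i) * w i)"
      unfolding sum_distrib_left by (intro sum.mono_neutral_cong_right) auto
    also have "\<dots> \<le> cmod (c j) * (\<Sum>i | i \<le> J \<and> i \<noteq> j. cmod (y j i) * w i)"
      by (intro mult_left_mono sum_mono2) (auto simp: w)
    also have "\<dots> \<le> cmod (c j) * (1 / 2 * w j)"
      by (cases "c j = 0") (auto intro!: mult_left_mono tail[simplified])
    finally show "(\<Sum>i\<le>J. ?d j i) \<le> cmod (c j) * (1 / 2 * w j)" .
  qed
  also have "\<dots> = M + ?A / 2" by (simp add: sum_divide_distrib)
  finally show ?thesis by simp
qed

lemma polys_conv: "polys \<subseteq> (conv_series :: ('n::finite, complex) mps set)"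
proof
  fix f :: "('n, complex) mps" assume "f \<in> polys"
  then have "finite {\<alpha>. coeff f \<alpha> \<noteq> 0}" by (simp add: polys_def)
  then have "(\<lambda>\<alpha>. cmod (coeff f \<alpha>) * 1 ^ total_deg \<alpha>) summable_on {\<alpha>. coeff f \<alpha> \<noteq> 0}"
    by (rule summable_on_finite)
  moreover have "(\<lambda>\<alpha>. cmod (coeff f \<alpha>) * 1 ^ total_deg \<alpha>) summable_on UNIV \<longleftrightarrow>
      (\<lambda>\<alpha>. cmod (coeff f \<alpha>) * 1 ^ total_deg \<alpha>) summable_on {\<alpha>. coeff f \<alpha> \<noteq> 0}"
    by (rule summable_on_cong_neutral) auto
  ultimately have "(\<lambda>\<alpha>. cmod (coeff f \<alpha>) * 1 ^ total_deg \<alpha>) summable_on UNIV" by blast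
  then show "f \<in> conv_series" unfolding conv_series_def by (intro CollectI exI[of _ 1]) auto
qed

text \<open>
  Divide \<open>F\<close> by elements of \<open>L\<close>, which suffice because \<open>L\<close> has the same leading terms as its span over
  the power series. The divisors and \<open>F\<close> are convergent, so for one common large \<open>t\<close> the scalars \<open>c\<close> of
  the division have a finite norm by \<open>triangular_bound\<close>. Therefore the quotients converge.
\<close>

lemma descent_conv_series: "descent (conv_series :: ('n::finite, complex) mps set)"
  unfolding descent_def
proof (intro allI impI, elim conjE)
  fix L B and F :: "('n, complex) dop"
  assume B: "finite B" "L \<subseteq> ops conv_series" "L \<subseteq> supp_in B" and L: "submod conv_series L"
    and F: "F \<in> lspan UNIV L" "F \<in> ops conv_series"
  let ?K = "lspan UNIV L"
  have K: "submod UNIV ?K" by (rule submod_lspan_UNIV)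
  have KB: "?K \<subseteq> supp_in B" by (rule lspan_least[OF submod_supp_in B(3)])
  have LK: "L \<subseteq> ?K" by (auto intro: lspan_base)
  have pc: "polys \<subseteq> (conv_series :: ('n, complex) mps set)" by (rule polys_conv)
  have lead: "\<exists>d\<in>L. has_lead d j" if "k \<in> ?K" "has_lead k j" for k j
    by (rule lead_in_submodule[OF L pc that])
  have clos: "\<exists>k\<in>?K. F - k \<in> vpow N" for N
    using F(1) submodD(1)[OF submod_vpow] by (intro bexI[of _ F]) auto
  show "F \<in> L"
  proof (rule division[OF K B(1) KB LK lead clos])
    fix S :: "(('n, complex) dop \<times> (nat^'n) \<times> (nat^'n)) set" and E sel \<gamma> c a
    assume S: "finite S" "\<And>g \<alpha> \<beta>. (g, \<alpha>, \<beta>) \<in> S \<Longrightarrow> g \<in> L"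
        "\<And>g \<alpha> \<beta>. (g, \<alpha>, \<beta>) \<in> S \<Longrightarrow> has_lead g (code \<alpha> \<beta>)"
      and sel: "\<And>j. j \<in> E \<Longrightarrow> sel j \<in> S"
        "\<And>j g \<alpha> \<beta>. j \<in> E \<Longrightarrow> sel j = (g, \<alpha>, \<beta>) \<Longrightarrow> j = code (\<gamma> j + \<alpha>) \<beta>"
      and c: "\<And>j. j \<notin> E \<Longrightarrow> c j = 0"
        "\<And>i. vcoef F i = (\<Sum>j\<le>i. c j * vcoef (mterm (\<gamma> j) 1 \<odot> fst (sel j)) i)"
      and a: "\<And>g \<alpha> \<beta> \<mu>. (g, \<alpha>, \<beta>) \<in> S \<Longrightarrow> coeff (a (g, \<alpha>, \<beta>)) \<mu> =
          (if code (\<mu> + \<alpha>) \<beta> \<in> E \<and> sel (code (\<mu> + \<alpha>) \<beta>) = (g, \<alpha>, \<beta>) then c (code (\<mu> + \<alpha>) \<beta>) else 0)"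
      and Fa: "F = (\<Sum>s\<in>S. a s \<odot> fst s)"
    define tb where "tb s t' \<longleftrightarrow> (\<forall>J. (\<Sum>j | j \<le> J \<and> j \<noteq> code (fst (snd s)) (snd (snd s)).
        cmod (vcoef (fst s) j) / real j ^ t') \<le> 1 / 2 / real (code (fst (snd s)) (snd (snd s))) ^ t')"
      for s :: "('n, complex) dop \<times> (nat^'n) \<times> (nat^'n)" and t' :: nat
    have "\<forall>s\<in>S. \<exists>t. \<forall>t'\<ge>t. tb s t'"
    proof
      fix s assume s: "s \<in> S"
      have "fst s \<in> L" "has_lead (fst s) (code (fst (snd s)) (snd (snd s)))"
        using S(2,3)[of "fst s" "fst (snd s)" "snd (snd s)"] s by simp_all
      then show "\<exists>t. \<forall>t'\<ge>t. tb s t'" unfolding tb_def using B(2) by (intro tail_bound) blast+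
    qed
    from bchoice[OF this] obtain T where T: "\<forall>s\<in>S. \<forall>t'\<ge>T s. tb s t'" by blast
    \<comment> \<open>A common exponent for the finitely many divisors.\<close>
    define t1 where "t1 = sum T S"
    have T1: "T s \<le> t1" if "s \<in> S" for s
      unfolding t1_def using member_le_sum[OF that, of T] S(1) by simp
    have t1: "tb s t" if "s \<in> S" "t1 \<le> t" for s t
      using T T1 that by (meson order_trans)
    obtain t2 M where M: "\<And>t J. t \<ge> t2 \<Longrightarrow> (\<Sum>j\<le>J. cmod (vcoef F j) / real j ^ t) \<le> M"
      using sum_norm_bound[OF F(2)] by blast
    define t where "t = max t1 t2"
    have t: "t \<ge> t1" "t \<ge> t2" by (auto simp: t_def)
    have bound: "(\<Sum>j\<le>J. cmod (c j) * (1 / real j ^ t)) \<le> 2 * M" for J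
    proof (rule triangular_bound[OF _ c(2)])
      show "(\<Sum>i\<le>J. cmod (vcoef F i) * (1 / real i ^ t)) \<le> M" using M[OF t(2), of J] by simp
      fix j assume "c j \<noteq> 0"
      then have j: "j \<in> E" using c(1) by blast
      obtain g \<alpha> \<beta> where s: "sel j = (g, \<alpha>, \<beta>)" by (cases "sel j") auto
      then have gS: "(g, \<alpha>, \<beta>) \<in> S" using sel(1)[OF j] by simp
      have jc: "j = code (\<gamma> j + \<alpha>) \<beta>" by (rule sel(2)[OF j s])
      show "vcoef (mterm (\<gamma> j) 1 \<odot> fst (sel j)) j = 1"
        using has_lead_shift[OF S(3)[OF gS], of "\<gamma> j"] jc s by (simp add: has_lead_def)
      have je: "j = ecode (\<gamma> j) * code \<alpha> \<beta>" using jc by (simp add: code_add)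
      fix J
      have "(\<Sum>i | i \<le> J \<and> i \<noteq> ecode (\<gamma> j) * code \<alpha> \<beta>. cmod (vcoef (mterm (\<gamma> j) 1 \<odot> g) i) / real i ^ t)
        \<le> (1 / 2 / real (code \<alpha> \<beta>) ^ t) / real (ecode (\<gamma> j)) ^ t"
        by (rule tail_shift) (use t1[OF gS t(1)] in \<open>simp add: tb_def\<close>)
      also have "\<dots> = 1 / 2 * (1 / real j ^ t)"
        by (subst (2) je) (simp add: power_mult_distrib)
      finally show "(\<Sum>i | i \<le> J \<and> i \<noteq> j. cmod (vcoef (mterm (\<gamma> j) 1 \<odot> fst (sel j)) i) * (1 / real i ^ t))
        \<le> 1 / 2 * (1 / real j ^ t)"
        unfolding je[symmetric] by (simp add: s)
    qed simp
    have "a s \<in> conv_series" if sS: "s \<in> S" for s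
    proof -
      obtain g \<alpha> \<beta> where s: "s = (g, \<alpha>, \<beta>)" by (cases s) auto
      define P where "P = Max (range (var_prime :: 'n + 'n \<Rightarrow> nat))"
      \<comment> \<open>A radius of convergence: \<open>r\<close> to the total degree of \<open>\<mu>\<close> is at most \<open>1 / (ecode \<mu>)\<^sup>t\<close>.\<close>
      define r where "r = 1 / real P ^ t"
      let ?l = "code \<alpha> \<beta>"
      have "prime (var_prime (Inl undefined :: 'n + 'n))" by (rule var_prime)
      then have "0 < var_prime (Inl undefined :: 'n + 'n)" by (rule prime_gt_0_nat)
      also have "\<dots> \<le> P" unfolding P_def by (rule Max_ge) auto
      finally have P: "P > 0" .
      then have r: "r > 0" by (simp add: r_def)
      have "(\<lambda>\<mu>. cmod (coeff (a s) \<mu>) * r ^ total_deg \<mu>) summable_on UNIV"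
      proof (rule nonneg_bdd_above_summable_on)
        show "bdd_above (sum (\<lambda>\<mu>. cmod (coeff (a s) \<mu>) * r ^ total_deg \<mu>) ` {U. U \<subseteq> UNIV \<and> finite U})"
        proof (rule bdd_aboveI2)
          fix U :: "(nat^'n) set" assume "U \<in> {U. U \<subseteq> UNIV \<and> finite U}"
          then have U: "finite U" by auto
          let ?q = "\<lambda>\<mu>. code (\<mu> + \<alpha>) \<beta>"
          have inj: "inj_on ?q U" by (auto simp: inj_on_def code_inj)
          have "(\<Sum>\<mu>\<in>U. cmod (coeff (a s) \<mu>) * r ^ total_deg \<mu>)
            \<le> (\<Sum>\<mu>\<in>U. real ?l ^ t * (cmod (c (?q \<mu>)) * (1 / real (?q \<mu>) ^ t)))"
          proof (rule sum_mono)
            fix \<mu> :: "nat^'n"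
            have "real (ecode \<mu>) \<le> real P ^ total_deg \<mu>"
              using ecode_bounds(2)[of \<mu>] unfolding P_def[symmetric] by (metis of_nat_le_iff of_nat_power)
            then have "real (ecode \<mu>) ^ t \<le> (real P ^ total_deg \<mu>) ^ t" by (intro power_mono) auto
            then have "1 / (real P ^ total_deg \<mu>) ^ t \<le> 1 / real (ecode \<mu>) ^ t"
              using ecode_pos[of \<mu>] P by (intro divide_left_mono) auto
            then have "r ^ total_deg \<mu> \<le> 1 / real (ecode \<mu>) ^ t"
              by (simp add: r_def power_divide power_mult[symmetric] mult.commute)
            also have "\<dots> = real ?l ^ t * (1 / real (?q \<mu>) ^ t)"
              using code_pos[of \<alpha> \<beta>] by (simp add: code_add power_mult_distrib)
            finally have *: "r ^ total_deg \<mu> \<le> real ?l ^ t * (1 / real (?q \<mu>) ^ t)" .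
            have "cmod (coeff (a s) \<mu>) \<le> cmod (c (?q \<mu>))" using a sS by (simp add: s)
            then have "cmod (coeff (a s) \<mu>) * r ^ total_deg \<mu>
              \<le> cmod (c (?q \<mu>)) * (real ?l ^ t * (1 / real (?q \<mu>) ^ t))"
              using * r by (intro mult_mono) auto
            then show "cmod (coeff (a s) \<mu>) * r ^ total_deg \<mu>
              \<le> real ?l ^ t * (cmod (c (?q \<mu>)) * (1 / real (?q \<mu>) ^ t))"
              by (simp add: mult_ac)
          qed
          also have "\<dots> = real ?l ^ t * (\<Sum>j\<in>?q ` U. cmod (c j) * (1 / real j ^ t))"
            by (simp add: sum_distrib_left sum.reindex[OF inj])
          also have "\<dots> \<le> real ?l ^ t * (\<Sum>j\<le>Max (insert 0 (?q ` U)). cmod (c j) * (1 / real j ^ t))"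
            using U by (intro mult_left_mono sum_mono2) auto
          also have "\<dots> \<le> real ?l ^ t * (2 * M)" by (intro mult_left_mono bound) simp
          finally show "(\<Sum>\<mu>\<in>U. cmod (coeff (a s) \<mu>) * r ^ total_deg \<mu>) \<le> real ?l ^ t * (2 * M)" .
        qed
      qed (use r in auto)
      then show ?thesis unfolding conv_series_def using r by blast
    qed
    then show "F \<in> L" unfolding Fa
      using S(2) by (intro submod_sum[OF L] submodD(3)[OF L]) auto
  qed
qed

section \<open>Descent for the localised polynomial ring\<close>

text \<open>
  A variant of the geometric series: after scaling, \<open>g = 1 - y\<close> with \<open>y\<close> in the maximal ideal, and
  \<open>g\<close> divides \<open>1 - y\<^sup>N\<close>. So \<open>1\<close> is a limit of multiples of \<open>g\<close>, and the multiples of \<open>g\<close> form a closed set.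
\<close>

lemma mps_inverse:
  fixes g :: "('n::finite, 'k::field) mps"
  assumes "coeff g 0 \<noteq> 0"
  shows "\<exists>h. h * g = 1"
proof -
  define b :: "('n, 'k) mps" where "b = mterm 0 (1 / coeff g 0)"
  define y where "y = 1 - b * g"
  have "0 \<le> (0 :: nat^'n)" "0 - 0 = (0 :: nat^'n)" by (auto simp: less_eq_vec_def)
  then have y0: "coeff y 0 = 0" using assms by (simp add: y_def b_def)
  have "y \<in> mpow 1"
    unfolding mpow_def
  proof (intro CollectI allI impI)
    fix \<alpha> :: "nat^'n" assume "coeff y \<alpha> \<noteq> 0"
    then have "\<alpha> \<noteq> 0" using y0 by auto
    then obtain i where "\<alpha> $ i > 0" by (auto simp: vec_eq_iff)
    then show "1 \<le> total_deg \<alpha>" using member_le_sum[of i UNIV "vec_nth \<alpha>"] by (simp add: total_deg_def)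
  qed
  then have yN: "y ^ N \<in> mpow N" for N
    using mpow_mult[of y 1] by (induction N) auto
  let ?L = "{sgl 0 g} :: ('n, 'k) dop set"
  have "sgl 0 1 \<in> lspan UNIV ?L"
  proof (rule lspan_closed[of "{0}"])
    fix N
    let ?k = "((\<Sum>i<N. y ^ i) * b) \<odot> sgl 0 g"
    have "((\<Sum>i<N. y ^ i) * b) * g = (1 - y) * (\<Sum>i<N. y ^ i)"
      by (simp add: y_def mult_ac)
    also have "\<dots> = 1 - y ^ N" by (simp add: one_diff_power_eq)
    finally have "sgl 0 1 - ?k = sgl 0 (y ^ N)"
      by (intro poly_mapping_eqI) (auto simp: lookup_single lookup_minus lookup_one when_def)
    then have "sgl 0 1 - ?k \<in> vpow N" using yN[of N] by (simp add: vpow_def lookup_single when_def)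
    moreover have "?k \<in> lspan UNIV ?L" by (rule lspan_gen) auto
    ultimately show "\<exists>k\<in>lspan UNIV ?L. sgl 0 1 - k \<in> vpow N" by blast
  qed (auto simp: supp_in_def lookup_single when_def)
  moreover have "\<exists>h. F = h \<odot> sgl 0 g" if "F \<in> lspan UNIV ?L" for F
    using that
  proof induction
    case lspan_0
    show ?case by (rule exI[of _ 0]) simp
  next
    case (lspan_step a f G)
    then show ?case by (metis scl_algebra(2) singletonD)
  qed
  ultimately obtain h where "sgl 0 1 = h \<odot> sgl 0 g" by blast
  then have "lkp (sgl 0 1) 0 = lkp (h \<odot> sgl 0 g) 0" by simp
  then have "h * g = 1" by simp
  then show ?thesis ..
qed

lemma polys_loc_polys: "polys \<subseteq> (loc_polys :: ('n::finite, 'k::field) mps set)"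
proof
  fix f :: "('n, 'k) mps" assume "f \<in> polys"
  then show "f \<in> loc_polys"
    unfolding loc_polys_def by (intro CollectI bexI[of _ f] bexI[of _ 1]) (auto simp: polys_closed)
qed

lemma loc_polys_unit:
  fixes q :: "('n::finite, 'k::field) mps"
  assumes "q \<in> polys" "coeff q 0 \<noteq> 0"
  shows "\<exists>e\<in>loc_polys. e * q = 1"
proof -
  obtain e where "e * q = 1" using mps_inverse[OF assms(2)] by blast
  moreover from this have "e \<in> loc_polys"
    unfolding loc_polys_def using assms polys_closed(1) by (auto simp: mult.commute)
  ultimately show ?thesis by blast
qed

text \<open>
  For vectors of polynomials the leading term is the highest one, so that reduction terminates.
\<close>

definition top_lead :: "('n::finite, 'k::field) dop \<Rightarrow> nat \<Rightarrow> bool"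
  where "top_lead F j \<longleftrightarrow> vcoef F j = 1 \<and> (\<forall>i>j. vcoef F i = 0)"

lemma top_lead_shift:
  assumes "top_lead g (code \<alpha> \<beta>)"
  shows "top_lead (mterm \<gamma> 1 \<odot> g) (code (\<gamma> + \<alpha>) \<beta>)"
proof -
  have "vcoef (mterm \<gamma> 1 \<odot> g) i = 0" if "i > code (\<gamma> + \<alpha>) \<beta>" for i
  proof (rule ccontr)
    assume "vcoef (mterm \<gamma> 1 \<odot> g) i \<noteq> 0"
    then obtain i' where "i = ecode \<gamma> * i'" "vcoef g i' \<noteq> 0" using vcoef_shift(2) by metis
    then show False using assms that by (auto simp: top_lead_def code_add)
  qed
  then show ?thesis using assms unfolding top_lead_def vcoef_shift by blast
qed

lemma finite_vcoef_support:
  assumes "F \<in> ops polys"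
  shows "finite {j. vcoef (F :: ('n::finite, 'k::field) dop) j \<noteq> 0}"
proof (rule finite_subset)
  show "{j. vcoef F j \<noteq> 0} \<subseteq> (\<Union>\<beta>\<in>Poly_Mapping.keys F. (\<lambda>\<alpha>. code \<alpha> \<beta>) ` {\<alpha>. coeff (lkp F \<beta>) \<alpha> \<noteq> 0})"
  proof
    fix j assume j: "j \<in> {j. vcoef F j \<noteq> 0}"
    then have "vcoef F j \<noteq> 0" by simp
    then obtain \<alpha> \<beta> :: "nat^'n" where ab: "j = code \<alpha> \<beta>" by (rule vcoef_nonzeroE)
    then have "coeff (lkp F \<beta>) \<alpha> \<noteq> 0" using j by simp
    moreover from this have "\<beta> \<in> Poly_Mapping.keys F" by (auto simp: in_keys_iff)
    ultimately show "j \<in> (\<Union>\<beta>\<in>Poly_Mapping.keys F. (\<lambda>\<alpha>. code \<alpha> \<beta>) ` {\<alpha>. coeff (lkp F \<beta>) \<alpha> \<noteq> 0})"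
      using ab by blast
  qed
  show "finite (\<Union>\<beta>\<in>Poly_Mapping.keys F. (\<lambda>\<alpha>. code \<alpha> \<beta>) ` {\<alpha>. coeff (lkp F \<beta>) \<alpha> \<noteq> 0})"
    using assms by (auto simp: ops_def polys_def)
qed

text \<open>
  Let \<open>m\<close> be the maximal ideal of the polynomials at the origin. The Rees algebra \<open>\<Oplus>\<^sub>N m\<^sup>N T\<^sup>N\<close> acts on
  graded families of vectors, and \<open>rees P N\<close> is the part of degree \<open>N\<close> of the submodule generated by
  the \<open>P j\<close> in the degrees \<open>j\<close>.
\<close>

inductive_set rees :: "(nat \<Rightarrow> ('n::finite, 'k::field) dop) \<Rightarrow> nat \<Rightarrow> ('n, 'k) dop set"
  for P N where
  rees_0: "0 \<in> rees P N"
| rees_step: "j \<le> N \<Longrightarrow> Q \<in> polys \<Longrightarrow> Q \<in> mpow (N - j) \<Longrightarrow> h \<in> rees P N \<Longrightarrow> Q \<odot> P j + h \<in> rees P N"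

lemma rees_add: "f \<in> rees P N \<Longrightarrow> h \<in> rees P N \<Longrightarrow> f + h \<in> rees P N"
  by (induction rule: rees.induct) (auto simp: add.assoc intro: rees.intros)

lemma rees_mult:
  assumes "h \<in> rees P N" and Q: "Q \<in> polys" "Q \<in> mpow k" "N \<le> N'" "N' \<le> N + k"
  shows "Q \<odot> h \<in> rees P N'"
  using assms(1)
proof induction
  case (rees_step j R h)
  have "N' - j \<le> k + (N - j)" using Q(4) rees_step(1) by simp
  then have "Q * R \<in> mpow (N' - j)" using mpow_mult[OF Q(2) rees_step(3)] mpow_antimono by blast
  then have "(Q * R) \<odot> P j + Q \<odot> h \<in> rees P N'"
    using rees_step Q by (intro rees.rees_step polys_closed) auto
  then show ?case by (simp add: scl_algebra)
qed (auto intro: rees.intros)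

lemma rees_in:
  assumes "h \<in> rees P N" "\<And>j. P j \<in> vpow j" "\<And>j. P j \<in> ops polys" "\<And>j. P j \<in> supp_in B"
  shows "h \<in> vpow N" "h \<in> ops polys" "h \<in> supp_in B"
proof -
  have p: "submod polys (ops polys)"
    by (auto simp: submod_def ops_def lookup_add polys_closed)
  have "h \<in> vpow N \<and> h \<in> ops polys \<and> h \<in> supp_in B"
    using assms(1)
  proof induction
    case rees_0
    show ?case using submodD(1) submod_vpow p submod_supp_in by blast
  next
    case (rees_step j Q h)
    have "Q \<odot> P j \<in> vpow N"
      unfolding vpow_def
    proof (intro CollectI allI)
      fix \<beta>
      have "lkp (P j) \<beta> \<in> mpow j" using assms(2) by (simp add: vpow_def)
      then show "lkp (Q \<odot> P j) \<beta> \<in> mpow N" using mpow_mult[OF rees_step(3)] rees_step(1) by fastforce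
    qed
    then show ?case
      using rees_step assms(3,4)[of j] submodD(2)[OF submod_vpow] submodD(2,3)[OF p]
        submodD(2,3)[OF submod_supp_in[of UNIV B]]
      by blast
  qed
  then show "h \<in> vpow N" "h \<in> ops polys" "h \<in> supp_in B" by auto
qed

text \<open>
  The Rees module generated by the \<open>P j\<close> is finitely generated. Indeed \<open>x\<^sup>\<gamma> T\<^sup>k\<close> belongs to the Rees
  algebra iff \<open>k\<close> is at most the degree of \<open>\<gamma>\<close>, so divisibility of a leading term \<open>x\<^sup>\<alpha> T\<^sup>N\<close> by another
  one amounts to comparing all \<open>\<alpha>\<^sub>i\<close>, \<open>N\<close> and the difference of the degree of \<open>\<alpha>\<close> and \<open>N\<close>. Dickson's lemma
  applies to these numbers. In a degree \<open>N\<close> above the degrees of all the divisors found in this way, reduction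
  multiplies divisors by monomials of positive degree only, whence the coefficients in \<open>mpow 1\<close>.
\<close>

lemma rees_stationary:
  fixes P :: "nat \<Rightarrow> ('n::finite, 'k::field) dop"
  assumes B: "finite B" "\<And>j. P j \<in> supp_in B" and P: "\<And>j. P j \<in> vpow j" "\<And>j. P j \<in> ops polys"
  shows "\<exists>N. P N \<in> lspan (polys \<inter> mpow 1) (P ` {..<N})"
proof -
  note ri = rees_in[OF _ P B(2)]
  define E where "E \<beta> = {(h, \<alpha>, N). h \<in> rees P N \<and> top_lead h (code \<alpha> \<beta>)}" for \<beta> :: "nat^'n"
  define f :: "'n + bool \<Rightarrow> ('n, 'k) dop \<times> (nat^'n) \<times> nat \<Rightarrow> nat" where
    "f = (\<lambda>x (h, \<alpha>, N). case x of Inl i \<Rightarrow> \<alpha> $ i | Inr b \<Rightarrow> if b then total_deg \<alpha> - N else N)"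
  have "\<forall>\<beta>. \<exists>G. finite G \<and> G \<subseteq> E \<beta> \<and> (\<forall>e\<in>E \<beta>. \<exists>g\<in>G. \<forall>x\<in>UNIV. f x g \<le> f x e)"
    by (intro allI dickson) simp
  then obtain G where G: "\<And>\<beta>. finite (G \<beta>)" "\<And>\<beta>. G \<beta> \<subseteq> E \<beta>"
    "\<And>\<beta>. \<forall>e\<in>E \<beta>. \<exists>g\<in>G \<beta>. \<forall>x\<in>UNIV. f x g \<le> f x e"
    by metis
  have "finite ((\<lambda>g. snd (snd g)) ` (\<Union>\<beta>\<in>B. G \<beta>))" using B(1) G(1) by auto
  then obtain N1 where N1: "\<And>g \<beta>. \<beta> \<in> B \<Longrightarrow> g \<in> G \<beta> \<Longrightarrow> snd (snd g) < N1"
    unfolding finite_nat_set_iff_bounded by blast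
  let ?W = "lspan (polys \<inter> mpow 1) (P ` {..<N1})"
  have W: "Q \<odot> h \<in> ?W" if h: "h \<in> rees P N0" and Q: "Q \<in> polys" "Q \<in> mpow 1" "N0 < N1" for Q h N0
    using h
  proof induction
    case (rees_step j R h)
    have "(Q * R) \<odot> P j + Q \<odot> h \<in> ?W"
      using rees_step Q mpow_mult_left[of Q 1 R]
      by (intro lspan.lspan_step) (auto simp: mult.commute intro: polys_closed)
    then show ?case by (simp add: scl_algebra)
  qed (auto intro: lspan.intros)
  have main: "h \<in> ?W" if "h \<in> rees P N1" "\<And>i. i \<ge> n \<Longrightarrow> vcoef h i = 0" for n h
    using that
  proof (induction n arbitrary: h)
    case 0
    then have "h = 0" by (intro vcoef_eqI) simp
    then show ?case by (simp add: lspan_0)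
  next
    case (Suc n)
    show ?case
    proof (cases "vcoef h n = 0")
      case True
      then have "vcoef h i = 0" if "i \<ge> n" for i
        using Suc.prems(2)[of i] that by (cases "i = n") auto
      then show ?thesis using Suc.IH[OF Suc.prems(1)] by blast
    next
      case False
      define c where "c = vcoef h n"
      have c: "c \<noteq> 0" using False by (simp add: c_def)
      from False obtain \<alpha> \<beta> :: "nat^'n" where n: "n = code \<alpha> \<beta>" by (rule vcoef_nonzeroE)
      have const: "mterm 0 b \<odot> g \<in> rees P N1" if "g \<in> rees P N1" for b g
        by (rule rees_mult[OF that mterm_polys, where k = 0]) auto
      have h': "mterm 0 (1 / c) \<odot> h \<in> rees P N1" by (rule const[OF Suc.prems(1)])
      have "top_lead (mterm 0 (1 / c) \<odot> h) (code \<alpha> \<beta>)"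
        using c Suc.prems(2) n unfolding top_lead_def vcoef_simps c_def by auto
      then have "(mterm 0 (1 / c) \<odot> h, \<alpha>, N1) \<in> E \<beta>" using h' by (simp add: E_def)
      then obtain g where g: "g \<in> G \<beta>" "\<forall>x. f x g \<le> f x (mterm 0 (1 / c) \<odot> h, \<alpha>, N1)" using G(3) by blast
      obtain h0 \<alpha>0 N0 where g0: "g = (h0, \<alpha>0, N0)" by (cases g) auto
      have nz: "coeff (lkp h \<beta>) \<alpha> \<noteq> 0" using False by (simp add: n)
      have "\<beta> \<in> B" using nz ri(3)[OF Suc.prems(1)] by (force simp: supp_in_def)
      then have N0: "N0 < N1" using N1 g(1) g0 by fastforce
      have h0: "h0 \<in> rees P N0" "top_lead h0 (code \<alpha>0 \<beta>)" using g(1) G(2) g0 by (auto simp: E_def)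
      have le: "\<alpha>0 $ i \<le> \<alpha> $ i" for i using g(2)[rule_format, of "Inl i"] by (simp add: f_def g0)
      \<comment> \<open>Since \<open>N0 < N1\<close>, this forces \<open>\<gamma>\<close> below to have positive degree.\<close>
      have td: "total_deg \<alpha>0 - N0 \<le> total_deg \<alpha> - N1" using g(2)[rule_format, of "Inr True"] by (simp add: f_def g0)
      define \<gamma> where "\<gamma> = \<alpha> - \<alpha>0"
      have \<alpha>: "\<alpha> = \<gamma> + \<alpha>0" using le by (simp add: \<gamma>_def vec_eq_iff)
      have "\<not> total_deg \<alpha> < N1" using vpow_coeff[OF ri(1)[OF Suc.prems(1)]] nz by blast
      moreover have "coeff (lkp h0 \<beta>) \<alpha>0 = 1" using h0(2) by (simp add: top_lead_def)
      then have "\<not> total_deg \<alpha>0 < N0" using vpow_coeff[OF ri(1)[OF h0(1)]] by fastforce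
      ultimately have deg: "N1 - N0 \<le> total_deg \<gamma>" using td N0 unfolding \<alpha> by simp
      let ?h1 = "mterm \<gamma> 1 \<odot> h0"
      have h1: "?h1 \<in> rees P N1"
        by (rule rees_mult[OF h0(1) mterm_polys mterm_mpow[OF deg]]) (use N0 in auto)
      have "(mterm 0 c * mterm \<gamma> 1) \<odot> h0 \<in> ?W"
        using deg N0 by (intro W[OF h0(1)] polys_closed mterm_polys mpow_mult_left mterm_mpow) auto
      then have cW: "mterm 0 c \<odot> ?h1 \<in> ?W" by (simp add: scl_algebra)
      have lead1: "top_lead ?h1 n" using top_lead_shift[OF h0(2), of \<gamma>] by (simp add: n \<alpha>)
      have "h + mterm 0 (- c) \<odot> ?h1 \<in> ?W"
      proof (rule Suc.IH)
        show "h + mterm 0 (- c) \<odot> ?h1 \<in> rees P N1" by (intro rees_add Suc.prems(1) const h1)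
        fix i assume "i \<ge> n"
        show "vcoef (h + mterm 0 (- c) \<odot> ?h1) i = 0"
        proof (cases "i = n")
          case True
          then show ?thesis using lead1 by (simp only: vcoef_simps top_lead_def c_def) simp
        next
          case False
          then have "n < i" "Suc n \<le> i" using \<open>i \<ge> n\<close> by auto
          then show ?thesis using lead1 Suc.prems(2) by (simp only: vcoef_simps top_lead_def) simp
        qed
      qed
      from lspan_add[OF this cW] have "h + mterm 0 (- c) \<odot> ?h1 + mterm 0 c \<odot> ?h1 \<in> ?W" .
      moreover have "mterm 0 (- c) = (- mterm 0 c :: ('n, 'k) mps)" by (simp add: mps_eq_iff)
      ultimately show ?thesis by (simp only: scl_simps) simp
    qed
  qed
  have "0 \<in> rees P N1" by (rule rees_0)
  then have PN: "P N1 \<in> rees P N1" using rees_step[of N1 N1 1 0 P] by (simp add: polys_closed)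
  obtain n where "\<forall>j\<in>{j. vcoef (P N1) j \<noteq> 0}. j < n"
    using finite_vcoef_support[OF P(2)[of N1]] unfolding finite_nat_set_iff_bounded by blast
  then have "vcoef (P N1) i = 0" if "i \<ge> n" for i using that by (auto simp: not_less[symmetric])
  then have "P N1 \<in> ?W" using main[OF PN] by blast
  then show ?thesis by blast
qed

lemma clear_denominators:
  assumes "F \<in> ops loc_polys"
  shows "\<exists>d\<in>polys. coeff d 0 \<noteq> 0 \<and> d \<odot> F \<in> ops (polys :: ('n::finite, 'k::field) mps set)"
proof -
  have "\<exists>d\<in>polys. coeff d 0 \<noteq> 0 \<and> (\<forall>\<beta>\<in>K. d * lkp F \<beta> \<in> polys)" if "finite K" for K
    using that
  proof induction
    case empty
    show ?case by (intro bexI[of _ 1]) (auto simp: polys_closed)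
  next
    case (insert \<beta> K)
    then obtain d where d: "d \<in> polys" "coeff d 0 \<noteq> 0" "\<forall>\<beta>\<in>K. d * lkp F \<beta> \<in> polys" by blast
    have "lkp F \<beta> \<in> loc_polys" using assms by (simp add: ops_def)
    then obtain g where g: "g \<in> polys" "coeff g 0 \<noteq> 0" "g * lkp F \<beta> \<in> polys"
      unfolding loc_polys_def by blast
    have "g * d * lkp F \<beta>' \<in> polys" if "\<beta>' \<in> insert \<beta> K" for \<beta>'
    proof (cases "\<beta>' = \<beta>")
      case True
      then show ?thesis using polys_closed(5)[OF d(1) g(3)] by (simp add: mult_ac)
    next
      case False
      then have "g * (d * lkp F \<beta>') \<in> polys" using d(3) that by (intro polys_closed(5)[OF g(1)]) auto
      then show ?thesis by (simp add: mult_ac)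
    qed
    then show ?case using d g by (intro bexI[of _ "g * d"]) (auto intro: polys_closed)
  qed
  then obtain d where d: "d \<in> polys" "coeff d 0 \<noteq> 0" "\<forall>\<beta>\<in>Poly_Mapping.keys F. d * lkp F \<beta> \<in> polys"
    using finite_keys by blast
  have "d \<odot> F \<in> ops polys"
    unfolding ops_def
  proof (intro CollectI allI)
    fix \<beta>
    show "lkp (d \<odot> F) \<beta> \<in> polys"
      using d(3) polys_closed(2) by (cases "\<beta> \<in> Poly_Mapping.keys F") (auto simp: in_keys_iff)
  qed
  then show ?thesis using d by blast
qed

text \<open>
  After clearing denominators, \<open>F\<close> and \<open>L\<close> are polynomial, and \<open>F\<close> is congruent modulo \<open>L\<close> to a vector
  \<open>P N\<close> of order at least \<open>N\<close>, for every \<open>N\<close>. By \<open>rees_stationary\<close> some \<open>P N\<close> is a combination of earlier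
  ones with coefficients in the maximal ideal. Modulo \<open>L\<close> this reads \<open>F = Q F\<close>, so \<open>(1 - Q) F\<close> lies in
  \<open>L\<close>, and \<open>1 - Q\<close> is a unit.
\<close>

lemma descent_loc_polys: "descent (loc_polys :: ('n::finite, 'k::field) mps set)"
  unfolding descent_def
proof (intro allI impI, elim conjE)
  fix L B and F :: "('n, 'k) dop"
  assume B: "finite B" "L \<subseteq> ops loc_polys" "L \<subseteq> supp_in B" and L: "submod loc_polys L"
    and F: "F \<in> lspan UNIV L" "F \<in> ops loc_polys"
  let ?Lp = "L \<inter> ops polys"
  have po: "submod polys (ops polys :: ('n, 'k) dop set)"
    by (auto simp: submod_def ops_def lookup_add polys_closed)
  have Lp: "submod polys ?Lp" by (intro submod_Int po submod_mono[OF L polys_loc_polys])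
  have m1: "- 1 \<in> (polys :: ('n, 'k) mps set)" by (intro polys_closed)
  have cancel: "f \<in> M" if "submod C M" "loc_polys \<subseteq> C" "d \<odot> f \<in> M" "d \<in> polys" "coeff d 0 \<noteq> 0" 
    for C M d and f :: "('n, 'k) dop"
  proof -
    obtain e where e: "e \<in> loc_polys" "e * d = 1" using loc_polys_unit[of d] \<open>d \<in> polys\<close> \<open>coeff d 0 \<noteq> 0\<close> by blast
    then have "e \<odot> d \<odot> f \<in> M" using that(2,3) by (auto intro: submodD(3)[OF that(1), of e "d \<odot> f"])
    moreover have "e \<odot> d \<odot> f = f" by (simp add: scl_algebra(1)[symmetric] e(2))
    ultimately show ?thesis by simp
  qed
  have "L \<subseteq> lspan UNIV ?Lp"
  proof
    fix f assume f: "f \<in> L"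
    then obtain d where d: "d \<in> polys" "coeff d 0 \<noteq> 0" "d \<odot> f \<in> ops polys"
      using clear_denominators B(2) by blast
    then have "d \<odot> f \<in> ?Lp" using submodD(3)[OF L _ f, of d] polys_loc_polys by blast
    then have "d \<odot> f \<in> lspan UNIV ?Lp" by (intro lspan_base) auto
    then show "f \<in> lspan UNIV ?Lp" by (rule cancel[OF submod_lspan_UNIV subset_UNIV _ d(1,2)])
  qed
  then have "lspan UNIV L \<subseteq> lspan UNIV ?Lp" by (intro lspan_least submod_lspan_UNIV)
  then have FL: "F \<in> lspan UNIV ?Lp" using F(1) by blast
  obtain d where d: "d \<in> polys" "coeff d 0 \<noteq> 0" "d \<odot> F \<in> ops polys"
    using clear_denominators[OF F(2)] by blast
  define F' where "F' = d \<odot> F"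
  have F': "F' \<in> lspan UNIV ?Lp" "F' \<in> ops polys"
    using submodD(3)[OF submod_lspan_UNIV _ FL] d(3) by (auto simp: F'_def)
  have LpB: "?Lp \<subseteq> supp_in B" using B(3) by blast
  then have F'B: "F' \<in> supp_in B" using lspan_least[OF submod_supp_in LpB] F'(1) by blast
  have "\<forall>N. \<exists>h. h \<in> ?Lp \<and> F' - h \<in> vpow N"
  proof
    fix N
    obtain h where "h \<in> ?Lp" "F' - h \<in> lspan (mpow N) ?Lp" using lspan_approx[OF Lp order_refl F'(1)] by blast
    then show "\<exists>h. h \<in> ?Lp \<and> F' - h \<in> vpow N" using lspan_mpow by blast
  qed
  then obtain h where h: "\<And>N. h N \<in> ?Lp" "\<And>N. F' - h N \<in> vpow N" by metis
  have P: "F' - h N \<in> ops polys" "F' - h N \<in> supp_in B" for N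
    using h(1)[of N] submod_minus(2)[OF po m1 F'(2)]
      submod_minus(2)[OF submod_supp_in[of UNIV B] _ F'B] LpB by auto
  obtain N where N: "F' - h N \<in> lspan (polys \<inter> mpow 1) ((\<lambda>N. F' - h N) ` {..<N})"
    using rees_stationary[of B "\<lambda>N. F' - h N"] B(1) P h(2) by blast
  have "\<exists>Q\<in>polys \<inter> mpow 1. X - Q \<odot> F' \<in> ?Lp"
    if "X \<in> lspan (polys \<inter> mpow 1) ((\<lambda>N. F' - h N) ` {..<N})" for X
    using that
  proof induction
    case lspan_0
    show ?case using submodD(1)[OF Lp] by (intro bexI[of _ 0]) (auto simp: polys_closed)
  next
    case (lspan_step a f g)
    then obtain Q where Q: "Q \<in> polys \<inter> mpow 1" "g - Q \<odot> F' \<in> ?Lp" by blast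
    obtain j where f: "f = F' - h j" using lspan_step(2) by blast
    have "a \<odot> h j \<in> ?Lp" using lspan_step(1) by (intro submodD(3)[OF Lp] h(1)) auto
    then have "g - Q \<odot> F' - a \<odot> h j \<in> ?Lp" by (rule submod_minus(2)[OF Lp m1 Q(2)])
    moreover have "a \<odot> f + g - (a + Q) \<odot> F' = g - Q \<odot> F' - a \<odot> h j"
      unfolding f scl_algebra by (simp add: algebra_simps)
    moreover have "a + Q \<in> polys \<inter> mpow 1" using Q lspan_step(1) by (auto intro: polys_closed mpow_add)
    ultimately show ?case by metis
  qed
  from this[OF N] obtain Q where Q: "Q \<in> polys" "Q \<in> mpow 1" "F' - h N - Q \<odot> F' \<in> ?Lp" by blast
  have "F' - h N - Q \<odot> F' + h N \<in> ?Lp" by (rule submodD(2)[OF Lp Q(3) h(1)])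
  moreover have "F' - h N - Q \<odot> F' + h N = (1 - Q) \<odot> F'" unfolding scl_algebra by simp
  ultimately have QF: "(1 - Q) \<odot> F' \<in> L" by simp
  have Qp: "1 - Q \<in> polys" using polys_closed(4)[OF polys_closed(1) polys_closed(3)[OF Q(1)]] by simp
  have "total_deg (0 :: nat^'n) = 0" by (simp add: total_deg_def)
  then have "coeff Q 0 = 0" using Q(2) unfolding mpow_def by (metis (mono_tags, lifting) mem_Collect_eq not_one_le_zero)
  then have Q0: "coeff (1 - Q) 0 \<noteq> 0" by simp
  have "F' \<in> L" by (rule cancel[OF L order_refl QF Qp Q0])
  then show "F \<in> L" unfolding F'_def by (rule cancel[OF L order_refl _ d(1,2)])
qed

section \<open>Initial modules\<close>

lemma wt_nonpos: "u \<in> U_loc \<Longrightarrow> wt u \<alpha> \<le> 0"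
  unfolding wt_def by (intro sum_nonpos) (auto simp: U_loc_def mult_nonpos_nonneg)

lemma ser_filt_UNIV_0: "u \<in> U_loc \<Longrightarrow> a \<in> ser_filt UNIV u 0"
  by (simp add: mem_ser_filt wt_nonpos)

lemma op_filt_mono: "w \<in> W_loc \<Longrightarrow> C \<subseteq> D \<Longrightarrow> A \<in> op_filt C w m \<Longrightarrow> A \<in> op_filt D w m"
  by (auto simp: mem_op_filt ops_def)

lemma submod_op_filt:
  assumes w: "w \<in> W_loc" and C: "cring (series_ring C)"
  shows "submod C (op_filt C w m)"
  unfolding submod_def
proof (intro conjI ballI)
  show "0 \<in> op_filt C w m" using submodD(1)[OF submod_ops[OF C]] by (simp add: op_filt_def)
  show "f + g \<in> op_filt C w m" if "f \<in> op_filt C w m" "g \<in> op_filt C w m" for f g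
    by (rule op_filt_add[OF w C that])
  fix a f assume a: "a \<in> C" and f: "f \<in> op_filt C w m"
  have "op_wt w \<alpha> \<beta> \<le> m" if nz: "coeff (a * lkp f \<beta>) \<alpha> \<noteq> 0" for \<alpha> \<beta>
  proof -
    obtain \<mu> \<nu> where "\<mu> + \<nu> = \<alpha>" "coeff (lkp f \<beta>) \<nu> \<noteq> 0" using nz by (rule coeff_mult_nonzero)
    then show ?thesis
      using f wt_nonpos[OF fst_W_loc[OF w], of \<mu>] by (force simp: mem_op_filt[OF w] op_wt_def)
  qed
  moreover have "a \<odot> f \<in> ops C" using a f submodD(3)[OF submod_ops[OF C]] by (auto simp: op_filt_def)
  ultimately show "a \<odot> f \<in> op_filt C w m" by (auto simp: mem_op_filt[OF w])
qed

text \<open>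
  A multiple of \<open>f\<close> by a series of order at least \<open>N\<close> is the limit of the multiples of \<open>f\<close> by its
  truncations, and these have order at least \<open>N\<close> as well.
\<close>

lemma lspan_truncated:
  assumes "polys \<subseteq> C" "finite B" "L \<subseteq> supp_in B"
  shows "lspan (mpow N) L \<subseteq> lspan UNIV (lspan (C \<inter> mpow N) L)"
proof
  let ?Y = "lspan (C \<inter> mpow N) L"
  fix F assume "F \<in> lspan (mpow N) L"
  then show "F \<in> lspan UNIV ?Y"
  proof induction
    case (lspan_step a f g)
    have "?Y \<subseteq> supp_in B" by (rule lspan_least[OF submod_supp_in assms(3)])
    moreover have "\<exists>k\<in>lspan UNIV ?Y. a \<odot> f - k \<in> vpow N'" for N'
    proof
      have "trunc N' a \<in> mpow N" using lspan_step(1) by (auto simp: mpow_def)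
      then have "trunc N' a \<odot> f \<in> ?Y"
        using lspan_step(2) assms(1) trunc_polys[of N' a] by (intro lspan_gen) auto
      then show "trunc N' a \<odot> f \<in> lspan UNIV ?Y" by (rule lspan_base[OF UNIV_I])
      have "a \<odot> f - trunc N' a \<odot> f = (a - trunc N' a) \<odot> f" by (simp only: scl_algebra)
      then show "a \<odot> f - trunc N' a \<odot> f \<in> vpow N'" by (simp only: scl_vpow[OF diff_trunc])
    qed
    ultimately have "a \<odot> f \<in> lspan UNIV ?Y" by (rule lspan_closed[OF assms(2)])
    then show ?case using lspan_step by (intro lspan_add)
  qed (rule lspan_0)
qed

text \<open>
  The properties shared by the two small coefficient rings. Each graded ring is a subring of \<open>C\<close> here
  since it consists of sums of homogeneous parts of elements of \<open>C\<close>, and these parts are again in \<open>C\<close>.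
\<close>

locale coefficient_ring =
  fixes C :: "('n::finite, 'k::field) mps set"
  assumes C: "cring (series_ring C)" and pdiff_C: "pdiff_closed C" and polys_C: "polys \<subseteq> C"
    and descent_C: "descent C"
    and gr_C: "u \<in> U_loc \<Longrightarrow> ser_gr C u \<subseteq> C"
    and gr_C_cong: "u \<in> U_loc \<Longrightarrow> u' \<in> U_loc \<Longrightarrow> neg_vars u = neg_vars u' \<Longrightarrow> ser_gr C u = ser_gr C u'"
begin

lemmas C_closed = series_ring_closed[OF C]

lemma minus_1_C: "- 1 \<in> C"
  by (intro C_closed)

text \<open>
  Write \<open>F\<^sub>m\<close> for the step \<open>m\<close> of the filtration. An approximation \<open>h\<close> of \<open>F\<close> by an element of \<open>L\<close> need not
  lie in \<open>F\<^sub>m\<close>, since variables of weight \<open>0\<close> prevent terms of high degree from having low weight. But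
  \<open>h\<close> is in the span of \<open>F\<^sub>m\<close> and of the multiples of \<open>L\<close> of order at least \<open>N\<close>. By descent it is a sum
  \<open>x + y\<close> of elements of these two modules over \<open>C\<close>. Then \<open>x\<close> is in \<open>L\<close> and in \<open>F\<^sub>m\<close> and still
  approximates \<open>F\<close>, and the span of such \<open>x\<close> is closed.
\<close>

lemma lspan_filt:
  assumes w: "w \<in> W_loc" and L: "L \<subseteq> ops C" "submod C L"
    and F: "F \<in> lspan UNIV L" "F \<in> op_filt UNIV w m"
  shows "F \<in> lspan UNIV (L \<inter> op_filt C w m)"
proof -
  obtain B where B: "finite B" "F \<in> lspan UNIV (L \<inter> supp_in B)" using lspan_finite_supp[OF F(1)] by blast
  define L1 where "L1 = L \<inter> supp_in B"
  have L1: "submod C L1" "L1 \<subseteq> supp_in B" "L1 \<subseteq> ops C"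
    using L by (auto simp: L1_def intro: submod_Int submod_supp_in)
  have FL1: "F \<in> lspan UNIV L1" using B(2) by (simp add: L1_def)
  have FB: "F \<in> supp_in B" using FL1 lspan_least[OF submod_supp_in L1(2)] by blast
  define K where "K = L1 \<inter> op_filt C w m"
  have "F \<in> lspan UNIV K"
  proof (rule lspan_closed[OF B(1)])
    show "K \<subseteq> supp_in B" using L1(2) by (auto simp: K_def)
    fix N
    obtain h where h: "h \<in> L1" "F - h \<in> lspan (mpow N) L1" using lspan_approx[OF L1(1) polys_C FL1] by blast
    define X where "X = op_filt C w m \<inter> supp_in B"
    define Y where "Y = lspan (C \<inter> mpow N) L1"
    \<comment> \<open>The sum of the two submodules over \<open>C\<close> to which descent is applied.\<close>
    define M where "M = {x + y | x y. x \<in> X \<and> y \<in> Y}"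
    have X: "submod C X" "X \<subseteq> ops C" "X \<subseteq> supp_in B"
      using submod_Int[OF submod_op_filt[OF w C] submod_supp_in] unfolding X_def by (auto simp: op_filt_def)
    have YL1: "Y \<subseteq> L1"
      unfolding Y_def by (rule lspan_least[OF submod_mono[OF L1(1)]]) auto
    have Yv: "Y \<subseteq> vpow N"
      unfolding Y_def using lspan_mono[of "C \<inter> mpow N" "mpow N" L1 L1] lspan_mpow by blast
    have Y: "submod C Y"
    proof -
      have "a \<odot> y \<in> Y" if "a \<in> C" "y \<in> Y" for a y
        using that(2) unfolding Y_def
      proof induction
        case (lspan_step b f g)
        have "(a * b) \<odot> f + a \<odot> g \<in> lspan (C \<inter> mpow N) L1"
          using lspan_step that(1) by (intro lspan.lspan_step) (auto intro: C_closed mpow_mult_left)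
        then show ?case by (simp add: scl_algebra)
      qed (auto intro: lspan.intros)
      then show ?thesis by (auto simp: submod_def Y_def lspan_0 lspan_add)
    qed
    have M: "submod C M"
      unfolding submod_def
    proof (intro conjI ballI)
      show "0 \<in> M" unfolding M_def using submodD(1)[OF X(1)] submodD(1)[OF Y] by force
      fix f assume "f \<in> M"
      then obtain x y where f: "f = x + y" "x \<in> X" "y \<in> Y" unfolding M_def by blast
      show "a \<odot> f \<in> M" if "a \<in> C" for a
        unfolding M_def f scl_algebra using submodD(3)[OF X(1) that f(2)] submodD(3)[OF Y that f(3)] by blast
      fix g assume "g \<in> M"
      then obtain x' y' where g: "g = x' + y'" "x' \<in> X" "y' \<in> Y" unfolding M_def by blast
      have "f + g = (x + x') + (y + y')" by (simp add: f g algebra_simps)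
      then show "f + g \<in> M"
        unfolding M_def using submodD(2)[OF X(1) f(2) g(2)] submodD(2)[OF Y f(3) g(3)] by blast
    qed
    have XM: "X \<subseteq> M" and YM: "Y \<subseteq> M"
      unfolding M_def using submodD(1)[OF X(1)] submodD(1)[OF Y] by force+
    have MB: "M \<subseteq> supp_in B" "M \<subseteq> ops C"
      unfolding M_def using X YL1 L1 submodD(2)[OF submod_supp_in[of C B]] submodD(2)[OF submod_ops[OF C]]
      by blast+
    have "F \<in> lspan UNIV X"
    proof (rule lspan_closed[OF B(1) X(3)])
      fix N'
      have "trunc N' a \<in> C" for a using polys_C trunc_polys by blast
      then have "vtrunc N' F \<in> X"
        using F(2) FB
        by (auto simp: X_def mem_op_filt[OF w] supp_in_def ops_def split: if_splits)
      then have "vtrunc N' F \<in> lspan UNIV X" by (intro lspan_base) auto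
      then show "\<exists>k\<in>lspan UNIV X. F - k \<in> vpow N'" using diff_vtrunc by blast
    qed
    then have FM: "F \<in> lspan UNIV M" using lspan_mono[OF order_refl XM] by blast
    have "F - h \<in> lspan UNIV Y" using lspan_truncated[OF polys_C B(1) L1(2)] h(2) unfolding Y_def by blast
    then have "F - h \<in> lspan UNIV M" using lspan_mono[OF order_refl YM] by blast
    then have "F - (F - h) \<in> lspan UNIV M" by (rule submod_minus(2)[OF submod_lspan_UNIV UNIV_I FM])
    then have hM: "h \<in> lspan UNIV M" by simp
    have "h \<in> ops C" using h(1) L1(3) by blast
    then have "h \<in> M" using descent_C[unfolded descent_def, rule_format, of B M h] B(1) M MB hM by blast
    then obtain x y where xy: "h = x + y" "x \<in> X" "y \<in> Y" unfolding M_def by blast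
    have "x = h - y" using xy(1) by simp
    moreover have "h - y \<in> L1" using submod_minus(2)[OF L1(1) minus_1_C h(1)] xy(3) YL1 by blast
    ultimately have "x \<in> K" using xy(2) by (auto simp: K_def X_def)
    then have "x \<in> lspan UNIV K" by (intro lspan_base) auto
    moreover have "F - x = (F - h) + y" by (simp add: xy(1))
    then have "F - x \<in> vpow N" using submodD(2)[OF submod_vpow] h(2) lspan_mpow Yv xy(3) by (metis subsetD)
    ultimately show "\<exists>k\<in>lspan UNIV K. F - k \<in> vpow N" by blast
  qed
  then show ?thesis using lspan_mono[of UNIV UNIV K "L \<inter> op_filt C w m"] by (auto simp: K_def L1_def)
qed

end

lemma op_part_scl:
  assumes "w \<in> W_loc" "A \<in> op_filt UNIV w m"
  shows "op_part w m (a \<odot> A) = ser_part (fst w) 0 a \<odot> op_part w m A"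
proof (rule poly_mapping_eqI)
  fix \<beta>
  note u = fst_W_loc[OF assms(1)]
  have "lkp A \<beta> \<in> ser_filt UNIV (fst w) (m - wt (snd w) \<beta>)" using assms op_filt_coeffs by blast
  from ser_part_mult[OF u ser_filt_UNIV_0[OF u, of a] this]
  show "lkp (op_part w m (a \<odot> A)) \<beta> = lkp (ser_part (fst w) 0 a \<odot> op_part w m A) \<beta>" by simp
qed

lemma op_part_cases:
  assumes w: "w \<in> W_loc" and A: "A \<in> op_filt C w m"
  shows "op_part w m A = 0 \<or> op_part w m A = op_in w A"
proof (cases "A = 0 \<or> op_ord w A < m")
  case True
  then have "A \<in> op_filt_less C w m" using A by (auto simp: op_filt_def op_filt_less_def)
  then show ?thesis using op_part_kernel[OF w A] by blast
next
  case False
  then show ?thesis using A by (auto simp: op_filt_def op_in_def)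
qed

lemma op_in_0 [simp]: "op_in w 0 = 0"
  by (simp add: op_in_def)

lemma op_in_gr: "w \<in> W_loc \<Longrightarrow> cring (series_ring C) \<Longrightarrow> f \<in> ops C \<Longrightarrow> op_in w f \<in> ops (ser_gr C (fst w))"
  unfolding op_gr_coeffs[symmetric] op_gr_def op_in_def
  by (rule graded_sum_piece) (auto simp: op_filt_def)

lemma ser_gr_mono: "C \<subseteq> D \<Longrightarrow> ser_gr C u \<subseteq> ser_gr D u"
  unfolding ser_gr_def by (rule subsetI, erule graded_sum_mono[rotated]) (auto simp: ser_filt_def)

lemma ser_part_mult_homogeneous: "ser_part u m (c * ser_part u m' f) = ser_part u (m - m') c * ser_part u m' f"
proof (rule mps_eqI)
  fix \<alpha>
  have "(if wt u \<alpha> = m then coeff c \<mu> * coeff (ser_part u m' f) (\<alpha> - \<mu>) else 0) =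
      coeff (ser_part u (m - m') c) \<mu> * coeff (ser_part u m' f) (\<alpha> - \<mu>)" if "\<mu> \<le> \<alpha>" for \<mu>
  proof -
    have "\<alpha> = \<mu> + (\<alpha> - \<mu>)" using that by (simp add: less_eq_vec_def vec_eq_iff)
    then have "wt u \<alpha> = wt u \<mu> + wt u (\<alpha> - \<mu>)" by (metis wt_add)
    then show ?thesis by auto
  qed
  then have "(\<Sum>\<mu> | \<mu> \<le> \<alpha>. if wt u \<alpha> = m then coeff c \<mu> * coeff (ser_part u m' f) (\<alpha> - \<mu>) else 0) =
      (\<Sum>\<mu> | \<mu> \<le> \<alpha>. coeff (ser_part u (m - m') c) \<mu> * coeff (ser_part u m' f) (\<alpha> - \<mu>))"
    by (intro sum.cong) auto
  then show "coeff (ser_part u m (c * ser_part u m' f)) \<alpha> = coeff (ser_part u (m - m') c * ser_part u m' f) \<alpha>"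
    unfolding coeff_mult_le[of _ "ser_part u m' f"] coeff_ser_part[of u m] by (cases "wt u \<alpha> = m") simp_all
qed

lemma op_part_sum: "op_part w m (sum f S) = (\<Sum>x\<in>S. op_part w m (f x))"
  by (induction S rule: infinite_finite_induct) (auto simp: op_part_add)

lemma op_part_op_part: "op_part w m' (op_part w m A) = (if m' = m then op_part w m A else 0)"
  by (rule poly_mapping_eqI) (auto simp: mps_eq_iff)

lemma op_gr_decompose:
  assumes "G \<in> op_gr C w"
  shows "\<exists>S. finite S \<and> G = (\<Sum>m\<in>S. op_part w m G)"
proof -
  obtain S h where S: "G = (\<Sum>m\<in>S. h m)" "finite S" "\<forall>m\<in>S. h m \<in> op_part w m ` op_filt C w m"
    using assms unfolding op_gr_def graded_sum_def by blast
  have "op_part w m G = h m" if "m \<in> S" for m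
  proof -
    have "op_part w m (h m') = (if m = m' then h m else 0)" if "m' \<in> S" for m'
      using S(3) that by (auto simp: op_part_op_part)
    then have "op_part w m G = (\<Sum>m'\<in>S. if m = m' then h m else 0)" unfolding S(1) op_part_sum by simp
    then show ?thesis using S(2) that by simp
  qed
  then show ?thesis using S by (intro exI[of _ S]) simp
qed

text \<open>
  The initial ideal as a module: see \<open>op_in_ideal_eq_in_module\<close> and \<open>in_module_sgl\<close>.
\<close>

definition in_module :: "('n::finite, 'k::field) mps set \<Rightarrow> (real^'n) \<times> (real^'n) \<Rightarrow> ('n, 'k) dop set \<Rightarrow> ('n, 'k) dop set"
  where "in_module C w L = lspan (ser_gr C (fst w)) (op_in w ` L)"

context coefficient_ring
begin

text \<open>
  The part of highest weight is in the graded ring, hence in \<open>C\<close>, and can be subtracted from \<open>c\<close>. Only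
  finitely many weights above \<open>m\<close> occur, so this leads to an element whose highest possible weight is
  \<open>m\<close>.
\<close>

lemma ser_part_gr:
  assumes u: "u \<in> U_loc" and "c \<in> C"
  shows "ser_part u m c \<in> ser_gr C u"
proof -
  let ?V = "\<lambda>c. {wt u \<alpha> | \<alpha>. coeff c \<alpha> \<noteq> 0 \<and> wt u \<alpha> > m}"
  have fin: "finite (?V c)" for c by (rule finite_subset[OF _ finite_wt_ge[OF u, of m]]) auto
  show ?thesis
    using assms(2)
  proof (induction "card (?V c)" arbitrary: c rule: less_induct)
    case less
    show ?case
    proof (cases "?V c = {}")
      case True
      then have "c \<in> ser_filt C u m" using less.prems by (auto simp: mem_ser_filt[OF u] not_less)
      then show ?thesis unfolding ser_gr_def by (intro graded_sum_piece) auto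
    next
      case False
      then have c0: "c \<noteq> 0" by auto
      define M where "M = ser_ord u c"
      obtain \<alpha>0 where \<alpha>0: "coeff c \<alpha>0 \<noteq> 0" "M = wt u \<alpha>0" using ser_ord_attained(1)[OF u c0] by (auto simp: M_def)
      have "M > m" using False ser_ord_attained(2)[OF u c0] by (force simp: M_def)
      have "c \<in> ser_filt C u M" using less.prems by (simp add: ser_filt_def M_def)
      then have "ser_part u M c \<in> ser_gr C u" unfolding ser_gr_def by (intro graded_sum_piece) auto
      then have pC: "ser_part u M c \<in> C" using gr_C[OF u] by blast
      let ?c = "c + - ser_part u M c"
      have "?c \<in> C" using less.prems pC by (intro C_closed)
      moreover have "card (?V ?c) < card (?V c)"
      proof (rule psubset_card_mono[OF fin])
        have "M \<in> ?V c" using \<alpha>0 \<open>M > m\<close> by auto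
        moreover have "M \<notin> ?V ?c" by auto
        moreover have "?V ?c \<subseteq> ?V c" by (auto split: if_splits)
        ultimately show "?V ?c \<subset> ?V c" by blast
      qed
      ultimately have "ser_part u m ?c \<in> ser_gr C u" by (rule less.hyps[rotated])
      moreover have "ser_part u m ?c = ser_part u m c" using \<open>M > m\<close> by (auto simp: mps_eq_iff)
      ultimately show ?thesis by simp
    qed
  qed
qed

text \<open>
  By \<open>lspan_filt\<close> an element of order \<open>m\<close> is a combination of elements \<open>f\<close> of \<open>L\<close> of order at most \<open>m\<close>.
  Passing to parts of weight \<open>m\<close> keeps the parts of weight \<open>0\<close> of the coefficients and replaces each
  \<open>f\<close> by its initial form or by \<open>0\<close>.
\<close>

lemma in_module_hat:
  assumes w: "w \<in> W_loc" and L: "L \<subseteq> ops C" "submod C L"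
  shows "in_module UNIV w (lspan UNIV L) = lspan (ser_gr UNIV (fst w)) (op_in w ` L)"
proof -
  note u = fst_W_loc[OF w]
  let ?H = "lspan (ser_gr UNIV (fst w)) (op_in w ` L)"
  have H: "submod (ser_gr UNIV (fst w)) ?H"
    by (rule submod_lspan) (rule series_ring_closed(5)[OF cring_ser_gr[OF u cring_UNIV]])
  have "op_in w F \<in> ?H" if F: "F \<in> lspan UNIV L" for F
  proof (cases "F = 0")
    case False
    define m where "m = op_ord w F"
    have "F \<in> op_filt UNIV w m" by (simp add: op_filt_def ops_def m_def)
    then have FL: "F \<in> lspan UNIV (L \<inter> op_filt C w m)" by (rule lspan_filt[OF w L F])
    have "op_part w m G \<in> ?H" if "G \<in> lspan UNIV (L \<inter> op_filt C w m)" for G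
      using that
    proof induction
      case (lspan_step a f g)
      then have f: "f \<in> op_filt C w m" "f \<in> op_filt UNIV w m" "f \<in> L"
        using op_filt_mono[OF w subset_UNIV, of f C m] by auto
      have "ser_part (fst w) 0 a \<in> ser_gr UNIV (fst w)"
        unfolding ser_gr_def using ser_filt_UNIV_0[OF u] by (intro graded_sum_piece) auto
      moreover have "op_part w m f \<in> insert 0 (op_in w ` L)" using op_part_cases[OF w f(1)] f(3) by auto
      ultimately have "ser_part (fst w) 0 a \<odot> op_part w m f \<in> ?H" by (auto intro: lspan_gen lspan_0)
      then show ?case using lspan_step(4) by (simp add: op_part_add op_part_scl[OF w f(2)] lspan_add)
    qed (simp add: lspan_0)
    from this[OF FL] show ?thesis by (simp add: op_in_def m_def)
  qed (simp add: lspan_0)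
  then have "in_module UNIV w (lspan UNIV L) \<subseteq> ?H"
    unfolding in_module_def by (intro lspan_least H) auto
  moreover have "?H \<subseteq> in_module UNIV w (lspan UNIV L)"
    unfolding in_module_def by (intro lspan_mono) (auto intro: lspan_base)
  ultimately show ?thesis by blast
qed

text \<open>
  Descent rewrites a combination of the initial forms with coefficients in the power series as one
  with coefficients in \<open>C\<close>. Its homogeneous parts have homogeneous coefficients, which lie in the
  graded ring of \<open>C\<close>.
\<close>

lemma in_module_descent:
  assumes w: "w \<in> W_loc" and L: "L \<subseteq> ops C"
  shows "in_module C w L = lspan (ser_gr UNIV (fst w)) (op_in w ` L) \<inter> ops (ser_gr C (fst w))"
proof
  note u = fst_W_loc[OF w]
  let ?g = "ser_gr C (fst w)"
  have opin: "op_in w ` L \<subseteq> ops ?g" using op_in_gr[OF w C] L by blast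
  have "in_module C w L \<subseteq> ops ?g"
    unfolding in_module_def by (rule lspan_least[OF submod_ops[OF cring_ser_gr[OF u C]] opin])
  moreover have "in_module C w L \<subseteq> lspan (ser_gr UNIV (fst w)) (op_in w ` L)"
    unfolding in_module_def by (intro lspan_mono ser_gr_mono) auto
  ultimately show "in_module C w L \<subseteq> lspan (ser_gr UNIV (fst w)) (op_in w ` L) \<inter> ops ?g" by blast
  show "lspan (ser_gr UNIV (fst w)) (op_in w ` L) \<inter> ops ?g \<subseteq> in_module C w L"
  proof
    fix G assume G: "G \<in> lspan (ser_gr UNIV (fst w)) (op_in w ` L) \<inter> ops ?g"
    let ?L = "lspan C (op_in w ` L)"
    have gC: "ops ?g \<subseteq> ops C" using gr_C[OF u] by (auto simp: ops_def)
    have L': "submod C ?L" by (rule submod_lspan) (rule C_closed)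
    have LC: "?L \<subseteq> ops C" using opin gC by (intro lspan_least submod_ops C) blast
    have "lspan (ser_gr UNIV (fst w)) (op_in w ` L) \<subseteq> lspan UNIV ?L"
      by (rule lspan_mono) (auto intro: lspan_base C_closed)
    then have "G \<in> lspan UNIV ?L" using G by blast
    then obtain B where B: "finite B" "G \<in> lspan UNIV (?L \<inter> supp_in B)" using lspan_finite_supp by blast
    have "G \<in> ops C" using G gC by blast
    moreover have "submod C (?L \<inter> supp_in B)" by (intro submod_Int L' submod_supp_in)
    ultimately have "G \<in> ?L \<inter> supp_in B"
      using descent_C[unfolded descent_def, rule_format, of B "?L \<inter> supp_in B" G] B LC by blast
    then have GL: "G \<in> ?L" by blast
    have part: "op_part w m X \<in> in_module C w L" if "X \<in> ?L" for X m
      using that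
    proof induction
      case (lspan_step c s g)
      then obtain f where s: "s = op_in w f" "f \<in> L" by blast
      have "op_part w m (c \<odot> s) = ser_part (fst w) (m - op_ord w f) c \<odot> s"
        unfolding s op_in_def
        by (rule poly_mapping_eqI) (simp add: ser_part_mult_homogeneous algebra_simps)
      moreover have "\<dots> \<in> in_module C w L"
        unfolding in_module_def using lspan_step by (intro lspan_gen ser_part_gr[OF u]) auto
      ultimately show ?case using lspan_step(4) unfolding in_module_def by (simp add: op_part_add lspan_add)
    qed (simp add: in_module_def lspan_0)
    have "G \<in> op_gr C w" using G by (simp add: op_gr_coeffs[OF w C])
    then obtain S where S: "finite S" "G = (\<Sum>m\<in>S. op_part w m G)" using op_gr_decompose by blast
    have "(\<Sum>m\<in>S. op_part w m G) \<in> in_module C w L"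
      using part[OF GL] unfolding in_module_def by (intro lspan_sum)
    then show "G \<in> in_module C w L" using S(2) by simp
  qed
qed

lemma gr_UNIV_cong:
  "u \<in> U_loc \<Longrightarrow> u' \<in> U_loc \<Longrightarrow> neg_vars u = neg_vars u' \<Longrightarrow>
    ser_gr (UNIV :: ('n, 'k) mps set) u = ser_gr UNIV u'"
  by (simp add: ser_gr_UNIV)

text \<open>
  By \<open>in_module_hat\<close> and \<open>in_module_descent\<close> each of the two initial modules determines the other one
  through constructions that depend only on the graded coefficient rings, which are the same for
  both weights.
\<close>

theorem in_module_eq_iff:
  assumes w: "w \<in> W_loc" "w' \<in> W_loc" "neg_vars (fst w) = neg_vars (fst w')"
    and L: "L \<subseteq> ops C" "submod C L"
  shows "in_module C w L = in_module C w' L \<longleftrightarrow>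
    in_module UNIV w (lspan UNIV L) = in_module UNIV w' (lspan UNIV L)"
proof -
  note u = fst_W_loc[OF w(1)] fst_W_loc[OF w(2)]
  let ?H = "\<lambda>w. lspan (ser_gr UNIV (fst w)) (op_in w ` L)"
  have H: "?H v = lspan (ser_gr UNIV (fst v)) (in_module C v L)" if v: "v \<in> W_loc" for v
  proof
    note u = fst_W_loc[OF v]
    have "1 \<in> ser_gr C (fst v)" by (rule series_ring_closed(1)[OF cring_ser_gr[OF u C]])
    then show "?H v \<subseteq> lspan (ser_gr UNIV (fst v)) (in_module C v L)"
      unfolding in_module_def by (intro lspan_mono) (auto intro: lspan_base)
    show "lspan (ser_gr UNIV (fst v)) (in_module C v L) \<subseteq> ?H v"
    proof (rule lspan_least)
      show "submod (ser_gr UNIV (fst v)) (?H v)"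
        by (rule submod_lspan) (rule series_ring_closed(5)[OF cring_ser_gr[OF u cring_UNIV]])
      show "in_module C v L \<subseteq> ?H v"
        unfolding in_module_def by (intro lspan_mono ser_gr_mono) auto
    qed
  qed
  show ?thesis
    unfolding in_module_hat[OF w(1) L] in_module_hat[OF w(2) L]
  proof
    assume "in_module C w L = in_module C w' L"
    then show "?H w = ?H w'" using H[OF w(1)] H[OF w(2)] gr_UNIV_cong[OF u w(3)] by simp
  next
    assume "?H w = ?H w'"
    then show "in_module C w L = in_module C w' L"
      unfolding in_module_descent[OF w(1) L(1)] in_module_descent[OF w(2) L(1)] gr_C_cong[OF u w(3)] by simp
  qed
qed

end

section \<open>Left ideals of operator rings as modules over the coefficients\<close>

lemma left_ideal_op_ringD:
  assumes "left_ideal J (op_ring P X)"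
  shows "0 \<in> J" "J \<subseteq> X" "a \<in> J \<Longrightarrow> b \<in> J \<Longrightarrow> a + b \<in> J" "A \<in> X \<Longrightarrow> a \<in> J \<Longrightarrow> op_mult P A a \<in> J"
proof -
  interpret additive_subgroup J "op_ring P X" using assms by (simp add: left_ideal_def)
  show "0 \<in> J" using zero_closed by simp
  show "J \<subseteq> X" using a_subset by simp
  show "a \<in> J \<Longrightarrow> b \<in> J \<Longrightarrow> a + b \<in> J" using a_closed by simp
  show "A \<in> X \<Longrightarrow> a \<in> J \<Longrightarrow> op_mult P A a \<in> J" using assms by (simp add: left_ideal_def)
qed

lemma left_ideal_op_ringI:
  assumes R: "ring (op_ring P X)" and J: "J \<subseteq> X" "0 \<in> J" "\<And>a b. a \<in> J \<Longrightarrow> b \<in> J \<Longrightarrow> a + b \<in> J"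
    "\<And>A a. A \<in> X \<Longrightarrow> a \<in> J \<Longrightarrow> op_mult P A a \<in> J"
  shows "left_ideal J (op_ring P X)"
proof -
  interpret ring "op_ring P X" by (rule R)
  have neg: "\<ominus>\<^bsub>op_ring P X\<^esub> a \<in> J" if "a \<in> J" for a
  proof -
    have a: "a \<in> carrier (op_ring P X)" using that J(1) by auto
    have "\<ominus>\<^bsub>op_ring P X\<^esub> a = (\<ominus>\<^bsub>op_ring P X\<^esub> \<one>\<^bsub>op_ring P X\<^esub>) \<otimes>\<^bsub>op_ring P X\<^esub> a"
      using l_minus[OF one_closed a] l_one[OF a] by simp
    moreover have "\<dots> \<in> J" using J(4)[OF _ that] a_inv_closed[OF one_closed] by simp
    ultimately show ?thesis by simp
  qed
  have "subgroup J (add_monoid (op_ring P X))"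
  proof (rule group.subgroupI)
    show "group (add_monoid (op_ring P X))" by (rule a_group)
    show "J \<subseteq> carrier (add_monoid (op_ring P X))" using J(1) by simp
    show "J \<noteq> {}" using J(2) by blast
    show "inv\<^bsub>add_monoid (op_ring P X)\<^esub> a \<in> J" if "a \<in> J" for a
      using neg[OF that] by (simp add: a_inv_def)
    show "a \<otimes>\<^bsub>add_monoid (op_ring P X)\<^esub> b \<in> J" if "a \<in> J" "b \<in> J" for a b
      using J(3)[OF that] by (simp add: op_ring_def)
  qed
  then show ?thesis using J(4) by (simp add: left_ideal_def additive_subgroup_def)
qed

lemma op_mult_const: "op_mult P (sgl 0 a) F = a \<odot> F"
  by (simp add: op_mult_single scl_def)

lemma op_mult_expand: "op_mult P A F = (\<Sum>\<beta>\<in>Poly_Mapping.keys A. lkp A \<beta> \<odot> op_mult P (sgl \<beta> 1) F)"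
  by (simp add: op_mult_act op_mult_single scl_def)

text \<open>
  If \<open>\<partial>\<^sup>\<beta> s\<close> is in the span for all generators \<open>s\<close>, then the span is stable under multiplication by all
  operators from the left, because coefficients are written to the left of the derivations.
\<close>

lemma gen_left_ideal_eq_lspan:
  assumes R: "cring (series_ring R)" "ring (op_ring P (ops R))"
    and S: "S \<subseteq> ops R" "\<And>\<beta> s. s \<in> S \<Longrightarrow> op_mult P (sgl \<beta> 1) s \<in> lspan R S"
  shows "gen_left_ideal (op_ring P (ops R)) S = lspan R S"
proof
  interpret ring "op_ring P (ops R)" by (rule R)
  note cl = series_ring_closed[OF R(1)]
  have const: "sgl 0 a \<in> ops R" if "a \<in> R" for a
    using that cl by (simp add: ops_def lookup_single when_def)
  have sp: "submod R (lspan R S)" by (rule submod_lspan) (rule cl)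
  have gen: "op_mult P A s \<in> lspan R S" if "A \<in> ops R" "s \<in> S" for A s
    unfolding op_mult_expand[of P A]
    by (rule submod_sum[OF sp], rule submodD(3)[OF sp]) (use that S(2) in \<open>auto simp: ops_def\<close>)
  have mult: "op_mult P A F \<in> lspan R S" if A: "A \<in> ops R" and "F \<in> lspan R S" for A F
    using that(2)
  proof induction
    case (lspan_step a f g)
    have "op_mult P A (a \<odot> f) = op_mult P (op_mult P A (sgl 0 a)) f"
      by (simp add: op_mult_assoc op_mult_const)
    moreover have "op_mult P A (sgl 0 a) \<in> ops R" using m_closed[of A "sgl 0 a"] A const[OF lspan_step(1)] by simp
    ultimately have "op_mult P A (a \<odot> f) \<in> lspan R S" using gen lspan_step(2) by simp
    then show ?case using lspan_step(4) by (simp add: op_mult_add_right lspan_add)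
  qed (simp add: lspan_0)
  have "left_ideal (lspan R S) (op_ring P (ops R))"
    by (rule left_ideal_op_ringI[OF R(2) lspan_least[OF submod_ops[OF R(1)] S(1)]])
      (auto intro: lspan_0 lspan_add mult)
  moreover have "S \<subseteq> lspan R S" by (auto intro: lspan_base cl)
  ultimately show "gen_left_ideal (op_ring P (ops R)) S \<subseteq> lspan R S" unfolding gen_left_ideal_def by blast
  show "lspan R S \<subseteq> gen_left_ideal (op_ring P (ops R)) S"
    unfolding gen_left_ideal_def
  proof (rule Inter_greatest, clarify)
    fix J F assume J: "left_ideal J (op_ring P (ops R))" "S \<subseteq> J" and F: "F \<in> lspan R S"
    note JD = left_ideal_op_ringD[OF J(1)]
    have "submod R J" unfolding submod_def using JD(1,3) JD(4)[OF const] by (simp add: op_mult_const)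
    then show "F \<in> J" using lspan_least J(2) F by blast
  qed
qed

text \<open>
  The product of \<open>\<partial>\<^sup>\<beta>\<close> with the initial form of \<open>f\<close> in the graded ring is a homogeneous part of \<open>\<partial>\<^sup>\<beta> f\<close>,
  hence \<open>0\<close> or the initial form of an element of \<open>I\<close>.
\<close>

lemma op_in_ideal_eq_in_module:
  fixes C :: "('n::finite, 'k::field) mps set"
  assumes w: "w \<in> W_loc" and C: "cring (series_ring C)" "pdiff_closed C"
    and I: "I \<subseteq> ops C" "\<And>\<beta> f. f \<in> I \<Longrightarrow> op_mult {} (sgl \<beta> 1) f \<in> I"
  shows "op_in_ideal C w I = in_module C w I"
  unfolding op_in_ideal_def in_module_def op_gr_coeffs[OF w C(1)]
proof (rule gen_left_ideal_eq_lspan)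
  note cg = cring_ser_gr[OF fst_W_loc[OF w] C(1)]
  show "cring (series_ring (ser_gr C (fst w)))" by (rule cg)
  show "ring (op_ring (pos_vars w) (ops (ser_gr C (fst w))))"
    using ring_op_gr[OF w C] by (simp add: op_gr_coeffs[OF w C(1)])
  show "op_in w ` I \<subseteq> ops (ser_gr C (fst w))" using op_in_gr[OF w C(1)] I(1) by blast
  fix \<beta> s assume "s \<in> op_in w ` I"
  then obtain f where f: "f \<in> I" "s = op_in w f" by blast
  let ?D = "sgl \<beta> 1 :: ('n, 'k) dop" and ?m = "wt (snd w) \<beta>" and ?n = "op_ord w f"
  have D: "?D \<in> op_filt C w ?m" "op_part w ?m ?D = ?D"
  proof -
    show "?D \<in> op_filt C w ?m"
      using series_ring_closed[OF C(1)]
      by (auto simp: mem_op_filt[OF w] ops_def lookup_single when_def op_wt_def split: if_splits)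
    show "op_part w ?m ?D = ?D"
      by (rule poly_mapping_eqI) (auto simp: lookup_single when_def mps_eq_iff)
  qed
  have fF: "f \<in> op_filt C w ?n" using f(1) I(1) by (auto simp: op_filt_def)
  have "op_mult (pos_vars w) ?D s = op_part w (?m + ?n) (op_mult {} ?D f)"
    using op_part_mult(1)[OF w C D(1) fF] D(2) by (simp add: f(2) op_in_def)
  moreover have "op_part w (?m + ?n) (op_mult {} ?D f) \<in> insert 0 (op_in w ` I)"
    using op_part_cases[OF w op_part_mult(2)[OF w C D(1) fF]] I(2)[OF f(1), of \<beta>] by auto
  ultimately show "op_mult (pos_vars w) ?D s \<in> lspan (ser_gr C (fst w)) (op_in w ` I)"
    using series_ring_closed(1)[OF cg] by (auto intro: lspan_0 lspan_base)
qed

lemma genideal_eq_lspan: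
  assumes R: "cring (series_ring R)" and S: "S \<subseteq> R"
  shows "lspan R (sgl 0 ` S) = sgl 0 ` genideal (series_ring R) (S :: ('n::finite, 'k::field) mps set)"
proof
  interpret cring "series_ring R" by (rule R)
  note cl = series_ring_closed[OF R]
  have scl_sgl: "a \<odot> sgl 0 f = sgl 0 (a * f)" for a f :: "('n, 'k) mps" by (simp add: scl_def mult_single)
  let ?J = "{g. sgl 0 g \<in> lspan R (sgl 0 ` S)}"
  have sp: "submod R (lspan R (sgl 0 ` S))" by (rule submod_lspan) (rule cl)
  have sub: "lspan R (sgl 0 ` S) \<subseteq> sgl 0 ` ?J" "?J \<subseteq> R"
  proof -
    have "F \<in> sgl 0 ` R" if "F \<in> lspan R (sgl 0 ` S)" for F
      using that
    proof induction
      case lspan_0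
      show ?case using cl(2) by (intro image_eqI[of _ _ 0]) auto
    next
      case (lspan_step a f g)
      then obtain s g' where "f = sgl 0 s" "s \<in> R" "g = sgl 0 g'" "g' \<in> R" using S by blast
      then show ?case using lspan_step(1) by (intro image_eqI[of _ _ "a * s + g'"]) (auto simp: scl_sgl single_add intro: cl)
    qed
    then show "lspan R (sgl 0 ` S) \<subseteq> sgl 0 ` ?J" "?J \<subseteq> R"
      by (auto simp: image_iff) (metis lookup_single_eq)
  qed
  have "ideal ?J (series_ring R)"
  proof (rule idealI)
    show "ring (series_ring R)" by (rule ring_axioms)
    show "subgroup ?J (add_monoid (series_ring R))"
    proof (rule group.subgroupI)
      show "group (add_monoid (series_ring R))" by (rule a_group)
      show "?J \<subseteq> carrier (add_monoid (series_ring R))" using sub(2) by simp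
      show "?J \<noteq> {}" using submodD(1)[OF sp] by (auto intro: exI[of _ 0])
      show "inv\<^bsub>add_monoid (series_ring R)\<^esub> g \<in> ?J" if g: "g \<in> ?J" for g
      proof -
        have gR: "g \<in> carrier (series_ring R)" using g sub(2) by auto
        have "\<ominus>\<^bsub>series_ring R\<^esub> g = - g"
          using minus_equality[of "- g" g] gR cl(3) by simp
        moreover have "- g \<in> ?J"
          using submod_minus(1)[OF sp cl(3)[OF cl(1)], of "sgl 0 g"] g by (simp add: single_uminus)
        ultimately show ?thesis by (simp add: a_inv_def)
      qed
      show "g \<otimes>\<^bsub>add_monoid (series_ring R)\<^esub> h \<in> ?J" if "g \<in> ?J" "h \<in> ?J" for g h
        using submodD(2)[OF sp, of "sgl 0 g" "sgl 0 h"] that by (simp add: series_ring_def single_add)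
    qed
    fix g x assume g: "g \<in> ?J" and x: "x \<in> carrier (series_ring R)"
    have "x * g \<in> ?J" using submodD(3)[OF sp, of x "sgl 0 g"] g x by (simp add: scl_sgl)
    then show "x \<otimes>\<^bsub>series_ring R\<^esub> g \<in> ?J" "g \<otimes>\<^bsub>series_ring R\<^esub> x \<in> ?J" by (simp_all add: mult.commute)
  qed
  moreover have "S \<subseteq> ?J" by (auto intro: lspan_base cl)
  ultimately have "genideal (series_ring R) S \<subseteq> ?J" unfolding genideal_def by blast
  then show "sgl 0 ` genideal (series_ring R) S \<subseteq> lspan R (sgl 0 ` S)" by blast
  have "?J \<subseteq> genideal (series_ring R) S"
    unfolding genideal_def
  proof (rule Inter_greatest, clarify)
    fix J g assume J: "ideal J (series_ring R)" "S \<subseteq> J" and g: "sgl 0 g \<in> lspan R (sgl 0 ` S)"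
    interpret J: ideal J "series_ring R" by (rule J(1))
    have "submod R (sgl 0 ` J)"
      unfolding submod_def
    proof (intro conjI ballI)
      show "0 \<in> sgl 0 ` J" using J.zero_closed by (intro image_eqI[of _ _ 0]) auto
      show "f + g \<in> sgl 0 ` J" if "f \<in> sgl 0 ` J" "g \<in> sgl 0 ` J" for f g
        using that J.a_closed by (auto simp: single_add[symmetric])
      show "a \<odot> f \<in> sgl 0 ` J" if "a \<in> R" "f \<in> sgl 0 ` J" for a f
        using that J.I_l_closed by (auto simp: scl_sgl)
    qed
    moreover have "sgl 0 ` S \<subseteq> sgl 0 ` J" using J(2) by blast
    ultimately have "lspan R (sgl 0 ` S) \<subseteq> sgl 0 ` J" by (rule lspan_least)
    from subsetD[OF this g] obtain h where h: "(sgl 0 g :: ('n, 'k) dop) = sgl 0 h" "h \<in> J" by (rule imageE)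
    have "g = h" using arg_cong[OF h(1), of "\<lambda>F. lkp F 0"] by simp
    then show "g \<in> J" using h(2) by simp
  qed
  then show "lspan R (sgl 0 ` S) \<subseteq> sgl 0 ` genideal (series_ring R) S" using sub(1) by blast
qed

text \<open>
  Series are operators of order \<open>0\<close> in the derivations. Any extension of \<open>u\<close> to a weight for operators
  measures them like \<open>u\<close> itself, and \<open>(u, - u)\<close> is one that is admissible.
\<close>

lemma ser_weight_W_loc: "u \<in> U_loc \<Longrightarrow> (u, - u) \<in> W_loc"
  by (auto simp: U_loc_def W_loc_def)

lemma op_in_sgl: "op_in (u, - u) (sgl 0 f) = sgl 0 (ser_in u f)"
proof -
  have "(\<exists>\<alpha> \<beta>. coeff (lkp (sgl 0 f) \<beta>) \<alpha> \<noteq> 0 \<and> m = op_wt (u, - u) \<alpha> \<beta>) \<longleftrightarrow>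
      (\<exists>\<alpha>. coeff f \<alpha> \<noteq> 0 \<and> m = wt u \<alpha>)" for m
    by (auto simp: lookup_single when_def op_wt_def split: if_splits intro!: exI[of _ 0])
  then have "op_ord (u, - u) (sgl 0 f) = ser_ord u f" by (simp add: op_ord_def ser_ord_def)
  then show ?thesis
    by (intro poly_mapping_eqI) (simp add: op_in_def ser_in_def lookup_single when_def)
qed

lemma in_module_sgl:
  assumes u: "u \<in> U_loc" and C: "cring (series_ring C)" and I: "I \<subseteq> C"
  shows "in_module C (u, - u) (sgl 0 ` I) = sgl 0 ` ser_in_ideal C u I"
proof -
  have "ser_in u f \<in> ser_gr C u" if "f \<in> I" for f
    unfolding ser_gr_def ser_in_def
    by (rule graded_sum_piece[where m = "ser_ord u f"]) (use that I in \<open>auto simp: ser_filt_def\<close>)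
  then have "ser_in u ` I \<subseteq> ser_gr C u" by blast
  then have "lspan (ser_gr C u) (sgl 0 ` ser_in u ` I) = sgl 0 ` ser_in_ideal C u I"
    unfolding ser_in_ideal_def by (rule genideal_eq_lspan[OF cring_ser_gr[OF u C]])
  then show ?thesis by (simp add: in_module_def image_image op_in_sgl)
qed

context coefficient_ring
begin

text \<open>
  An ideal is a module of operators of order \<open>0\<close>, and \<open>in_module_eq_iff\<close> is applied to the weights
  \<open>(u, - u)\<close>.
\<close>

theorem ser_fan_eq:
  assumes I: "ideal I (series_ring C)"
  shows "ser_fan C I = ser_fan UNIV (genideal (series_ring UNIV) I)"
proof -
  interpret I: ideal I "series_ring C" by (rule I)
  have IC: "I \<subseteq> C" using I.a_subset by simp
  have "genideal (series_ring C) I = I"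
    by (rule equalityI, rule I.genideal_minimal[OF I order_refl])
      (use I.genideal_self[of I] IC in simp)
  then have "lspan C (sgl 0 ` I) = sgl 0 ` I" using genideal_eq_lspan[OF C IC] by simp
  moreover have "submod C (lspan C (sgl 0 ` I))" by (rule submod_lspan) (rule C_closed)
  ultimately have L: "submod C (sgl 0 ` I)" by simp
  have LC: "sgl 0 ` I \<subseteq> ops C" using IC C_closed by (auto simp: ops_def lookup_single when_def)
  have inj: "inj (sgl 0 :: ('n, 'k) mps \<Rightarrow> ('n, 'k) dop)" by (metis injI lookup_single_eq)
  have "ser_in_ideal C u I = ser_in_ideal C u' I \<longleftrightarrow>
      ser_in_ideal UNIV u (genideal (series_ring UNIV) I) = ser_in_ideal UNIV u' (genideal (series_ring UNIV) I)"
    if u: "u \<in> U_loc" "u' \<in> U_loc" "neg_vars u = neg_vars u'" for u u'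
    using in_module_eq_iff[OF ser_weight_W_loc[OF u(1)] ser_weight_W_loc[OF u(2)] _ LC L] u(3)
    unfolding genideal_eq_lspan[OF cring_UNIV subset_UNIV]
      in_module_sgl[OF u(1) C IC] in_module_sgl[OF u(2) C IC]
      in_module_sgl[OF u(1) cring_UNIV subset_UNIV] in_module_sgl[OF u(2) cring_UNIV subset_UNIV]
      inj_image_eq_iff[OF inj] by simp
  then have "{(u, u'). u \<in> U_loc \<and> u' \<in> U_loc \<and> neg_vars u = neg_vars u' \<and>
      ser_in_ideal C u I = ser_in_ideal C u' I} =
    {(u, u'). u \<in> U_loc \<and> u' \<in> U_loc \<and> neg_vars u = neg_vars u' \<and>
      ser_in_ideal UNIV u (genideal (series_ring UNIV) I) = ser_in_ideal UNIV u' (genideal (series_ring UNIV) I)}"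
    by auto
  then show ?thesis unfolding ser_fan_def by simp
qed

theorem op_fan_eq:
  assumes I: "left_ideal I (op_ring {} (ops C))"
  shows "op_fan C I = op_fan UNIV (gen_left_ideal (op_ring {} (ops UNIV)) I)"
proof -
  note ID = left_ideal_op_ringD[OF I]
  have const: "sgl \<beta> a \<in> ops C" if "a \<in> C" for \<beta> a
    using that C_closed by (simp add: ops_def lookup_single when_def)
  have L: "submod C I"
    unfolding submod_def using ID(1,3) ID(4)[OF const, of _ _ 0] unfolding op_mult_const by blast
  have d: "op_mult {} (sgl \<beta> 1) f \<in> I" if "f \<in> I" for \<beta> f
    using that C_closed by (intro ID(4) const)
  have ops: "ops (UNIV :: ('n, 'k) mps set) = UNIV" by (simp add: ops_def)
  let ?J = "gen_left_ideal (op_ring {} (ops UNIV)) I"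
  have J: "?J = lspan UNIV I"
    by (rule gen_left_ideal_eq_lspan[OF cring_UNIV ring_ops[OF cring_UNIV pdiff_closed_UNIV]])
      (use d in \<open>auto simp: ops intro: lspan_base\<close>)
  have dJ: "op_mult {} (sgl \<beta> 1) f \<in> ?J" if "f \<in> ?J" for \<beta> f
    unfolding gen_left_ideal_def
  proof (rule InterI, clarify)
    fix K assume K: "left_ideal K (op_ring {} (ops UNIV))" "I \<subseteq> K"
    then have "f \<in> K" using that unfolding gen_left_ideal_def by blast
    then show "op_mult {} (sgl \<beta> 1) f \<in> K" using left_ideal_op_ringD(4)[OF K(1)] by (simp add: ops)
  qed
  have "op_in_ideal C w I = op_in_ideal C w' I \<longleftrightarrow> op_in_ideal UNIV w ?J = op_in_ideal UNIV w' ?J"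
    if w: "w \<in> W_loc" "w' \<in> W_loc" "neg_vars (fst w) = neg_vars (fst w')" for w w'
  proof -
    have eqs: "op_in_ideal C v I = in_module C v I" "op_in_ideal UNIV v ?J = in_module UNIV v (lspan UNIV I)"
      if v: "v \<in> W_loc" for v
    proof -
      show "op_in_ideal C v I = in_module C v I"
        by (rule op_in_ideal_eq_in_module[OF v C pdiff_C ID(2) d])
      have "op_in_ideal UNIV v ?J = in_module UNIV v ?J"
        by (rule op_in_ideal_eq_in_module[OF v cring_UNIV pdiff_closed_UNIV _ dJ]) (simp_all add: ops)
      then show "op_in_ideal UNIV v ?J = in_module UNIV v (lspan UNIV I)" by (simp only: J)
    qed
    show ?thesis
      unfolding eqs[OF w(1)] eqs[OF w(2)] by (rule in_module_eq_iff[OF w ID(2) L])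
  qed
  then have "{(w, w'). w \<in> W_loc \<and> w' \<in> W_loc \<and> neg_vars (fst w) = neg_vars (fst w') \<and>
      pos_vars w = pos_vars w' \<and> op_in_ideal C w I = op_in_ideal C w' I} =
    {(w, w'). w \<in> W_loc \<and> w' \<in> W_loc \<and> neg_vars (fst w) = neg_vars (fst w') \<and>
      pos_vars w = pos_vars w' \<and> op_in_ideal UNIV w ?J = op_in_ideal UNIV w' ?J}"
    by (intro arg_cong[where f = "\<lambda>p. Collect (case_prod p)"] ext conj_cong refl)
  then show ?thesis unfolding op_fan_def by simp
qed

end

section \<open>Localised polynomials and convergent series as coefficients\<close>

lemma coefficient_ring_loc_polys: "coefficient_ring (loc_polys :: ('n::finite, 'k::field) mps set)"
proof (rule coefficient_ring.intro)
  fix u u' :: "real^'n"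
  show "ser_gr loc_polys u \<subseteq> (loc_polys :: ('n, 'k) mps set)" if u: "u \<in> U_loc"
    unfolding ser_gr_loc_polys[OF u] unfolding loc_polys_def by blast
  show "ser_gr (loc_polys :: ('n, 'k) mps set) u = ser_gr loc_polys u'"
    if "u \<in> U_loc" "u' \<in> U_loc" "neg_vars u = neg_vars u'"
    using that by (simp add: ser_gr_loc_polys)
qed (rule loc_polys_cring pdiff_closed_loc_polys polys_loc_polys descent_loc_polys)+

lemma coefficient_ring_conv_series: "coefficient_ring (conv_series :: ('n::finite, complex) mps set)"
proof (rule coefficient_ring.intro)
  fix u u' :: "real^'n"
  show "ser_gr conv_series u \<subseteq> (conv_series :: ('n, complex) mps set)" if u: "u \<in> U_loc"
    unfolding ser_gr_conv_series[OF u] by blast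
  show "ser_gr (conv_series :: ('n, complex) mps set) u = ser_gr conv_series u'"
    if "u \<in> U_loc" "u' \<in> U_loc" "neg_vars u = neg_vars u'"
    using that by (simp add: ser_gr_conv_series)
qed (rule conv_series_cring pdiff_closed_conv_series polys_conv descent_conv_series)+

theorem proposition4p1p8:
  shows "(\<forall>I :: ('n::finite, 'k::field) mps set. ideal I (series_ring loc_polys) \<longrightarrow>
      ser_fan loc_polys I = ser_fan UNIV (genideal (series_ring UNIV) I)) \<and>
    (\<forall>I :: ('n, complex) mps set. ideal I (series_ring conv_series) \<longrightarrow>
      ser_fan conv_series I = ser_fan UNIV (genideal (series_ring UNIV) I)) \<and>
    (\<forall>I :: ('n, 'k) dop set. left_ideal I (op_ring {} (ops loc_polys)) \<longrightarrow>
      op_fan loc_polys I = op_fan UNIV (gen_left_ideal (op_ring {} (ops UNIV)) I)) \<and>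
    (\<forall>I :: ('n, complex) dop set. left_ideal I (op_ring {} (ops conv_series)) \<longrightarrow>
      op_fan conv_series I = op_fan UNIV (gen_left_ideal (op_ring {} (ops UNIV)) I))"
  using coefficient_ring.ser_fan_eq[OF coefficient_ring_loc_polys]
    coefficient_ring.ser_fan_eq[OF coefficient_ring_conv_series]
    coefficient_ring.op_fan_eq[OF coefficient_ring_loc_polys]
    coefficient_ring.op_fan_eq[OF coefficient_ring_conv_series]
  by blast

end
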